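(* Let $\theta_k$ be the natural parameters at time $t_k=k\Delta t$, for some $k\in\mathbb{N}$, where $\Delta t>0$ is the measurement sampling time. Then the sum-of-squares relaxation (defined in the context) of the natural parameters $\theta_t$ between two consecutive measurement sampling times, $t\in(k\Delta t,(k+1)\Delta t)$, can be written compactly as $$\frac{d}{dt}\begin{bmatrix}\theta_{l,t}\\ \nu_t\end{bmatrix}=\begin{bmatrix} I_{m_l} & 0_{m_l\times m_u}\\ 0_{m_s\times m_l} & -\Delta(L_t)\,\tilde K\, C(L_t)\,T_p^+\end{bmatrix} g(\theta_t)^{-1}\frac{d\eta_t}{dt},$$ where $m_s=\mathrm{lt}(z_1)$, $\theta_t^\top=[\theta_{l,t}^\top,\theta_{u,t}^\top]$, $\theta_{u,t}=-T_p\,\mathrm{vecs}(L_tL_t^\top)$, and $L_t=\mathrm{vecl}^{-1}(\nu_t)$.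
   Context: **Filtering setting.** The state satisfies the SDE $dx_t=f(x_t)\,dt+\varrho(x_t)\,dW_t$ on $\mathbb{R}^d$, with $W_t$ a Wiener process in $\mathbb{R}^{d_w}$ and $f,\varrho$ satisfying standard conditions for existence and uniqueness of solutions. Its backward Kolmogorov operator is $\mathcal{L}(\varphi)=\sum_{i=1}^d f_i\frac{\partial\varphi}{\partial x_i}+\frac12\sum_{i,j=1}^d(\varrho\varrho^\top)_{ij}\frac{\partial^2\varphi}{\partial x_i\partial x_j}$ (applied componentwise to vector functions). The regular exponential family with natural statistics $c:\mathbb{R}^d\to\mathbb{R}^m$ consists of the densities $p_\theta(x)=\exp(c(x)^\top\theta-\psi(\theta))$ with $\psi(\theta)=\log\int\exp(c(x)^\top\theta)\,dx$ and $\theta\in\Theta=\{\theta\in\mathbb{R}^m:\int\exp(c(x)^\top\theta)\,dx<\infty\}$, assumed open. $\mathbb{E}_\theta$ is expectation under $p_\theta$, $g(\theta)$ is the Fisher information matrix (the covariance of $c$ under $p_\theta$), and $\frac{d\eta_t}{dt}:=\mathbb{E}_{\theta_t}[\mathcal{L}(c)]$. The (unrelaxed) projection filter prediction equation is $\frac{d\theta_t}{dt}=g(\theta_t)^{-1}\mathbb{E}_{\theta_t}[\mathcal{L}(c)]$ for $t\in(k\Delta t,(k+1)\Delta t)$. **Natural statistics.** $c=[c_l^\top,c_u^\top]^\top$ with $c_l:\mathbb{R}^d\to\mathbb{R}^{m_l}$, $c_u:\mathbb{R}^d\to\mathbb{R}^{m_u}$, $m_l+m_u=m$, $c_u=w_{2r}$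 for some $r\in\mathbb{N}$, all elements of $c$ linearly independent, and $\lim_{\|x\|\to\infty}\|c_l(x)\|/\|c_u(x)\|=0$. Correspondingly $\theta=[\theta_l^\top,\theta_u^\top]^\top$. Here $w_s(x)=[x^\alpha]_{|\alpha|=s}$ is the vector of all monomials of degree exactly $s$ in $x\in\mathbb{R}^d$. Put $z_1=\binom{r+d-1}{d-1}$ and $z_2=m_u=\binom{2r+d-1}{d-1}$. **Matrix notation.** $\mathrm{lt}(n)=\frac12n(n+1)$. $\mathcal{S}_n$, $\mathcal{S}_n^+$, $\mathcal{L}_n$, $\mathcal{L}_n^+$ are respectively the symmetric, symmetric positive definite, lower triangular, and lower triangular with positive diagonal, real $n\times n$ matrices. $\mathrm{vec}$ is column stacking. $\mathrm{vecs}(A)=[d_{A,0}^\top,d_{A,1}^\top,\dots,d_{A,n-1}]^\top\in\mathbb{R}^{\mathrm{lt}(n)}$ stacks the main diagonal $d_{A,0}$ and the sub-diagonals $d_{A,i}$ of $A$; $\mathrm{vecs}^{-1}$ denotes the inverse of its restriction to $\mathcal{S}_n$. $\mathrm{vecl}:\mathcal{L}_n^+\to\mathbb{R}^{\mathrm{lt}(n)}$ is $\mathrm{vecl}(L)=[\log(d_{L,0})^\top,d_{L,1}^\top,\dots,d_{L,n-1}^\top]^\top$ (log entrywise); its Jacobian in $\mathrm{vecs}$ coordinates is $\mathrm{vecl}_{\ast,L}=\mathrm{diag}(1/d_{L,0},\,1_{\mathrm{lt}(n)-n})$ (reciprocals of the diagonal entries of $L$, then ones). $\mathscr{L}:\mathcal{S}_n^+\to\mathcal{L}_n^+$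 maps $P$ to its Cholesky factor $L$, $P=LL^\top$; $\mathscr{L}_{\ast,P}$ is its differential. $A^+$ is the Moore–Penrose pseudo-inverse. $D_n\in\mathbb{R}^{n^2\times\mathrm{lt}(n)}$ satisfies $D_n\mathrm{vecs}(A)=\mathrm{vec}(A)$ for $A\in\mathcal{S}_n$, and $E_n\in\mathbb{R}^{n^2\times\mathrm{lt}(n)}$ satisfies $E_n\mathrm{vecs}(X)=\mathrm{vec}(X)$ for $X\in\mathcal{L}_n$. With $n=z_1$: $C(L)=D_n^+(L^{-1}\otimes L^{-1})D_n$; $\Delta(L)=\mathrm{vecl}_{\ast,L}E_n^+(I_n\otimes L)E_n$; $\tilde K$ is the $\mathrm{lt}(n)\times\mathrm{lt}(n)$ diagonal matrix with $\tilde K_{k,k}=\frac12$ for $k\le n$ and $\tilde K_{k,k}=1$ for $k>n$. **The matrix $T_p$.** $T_p=(TT^\top)^{-1}TK\in\mathbb{R}^{z_2\times\mathrm{lt}(z_1)}$, where $K$ is diagonal with $K_{k,k}=1$ for $k\le z_1$, $K_{k,k}=2$ for $k>z_1$, and $T\in\mathbb{R}^{z_2\times\mathrm{lt}(z_1)}$ has $T_{l,k}=1$ if $k$ is the position in the $\mathrm{vecs}$ ordering of the entry $(i,j)$, $i\ge j$, with $\alpha_l=\beta_i+\beta_j$, and $T_{l,k}=0$ otherwise; $\beta_i$ is the exponent of the $i$-th component of $w_r$ and $\alpha_l$ that of the $l$-th component of $w_{2r}$. **Sum-of-squares relaxation.** Assume $\theta_{u,k}=-T_p\mathrm{vecs}(P_k)$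 with $P_k\in\mathcal{S}_{z_1}^+$. The sum-of-squares relaxation on $(k\Delta t,(k+1)\Delta t)$ is the system, started from $\theta_{l,k}$ and $P_k$, for $\theta_{l,t}$ and the log-Cholesky coordinate $\nu_t=\mathrm{vecl}(\mathscr{L}(P_t))$ of $P_t\in\mathcal{S}_{z_1}^+$, with $L_t=\mathscr{L}(P_t)$, $\theta_{u,t}=-T_p\mathrm{vecs}(P_t)$: $$\frac{d\theta_{l,t}}{dt}=[\,I_{m_l}\ \ 0_{m_l\times m_u}]\,g(\theta_t)^{-1}\frac{d\eta_t}{dt},\qquad \frac{d\nu_t}{dt}=\mathrm{vecl}_{\ast,L_t}\circ\mathscr{L}_{\ast,P_t}\left(\frac{dP_t}{dt}\right),$$ $$\frac{dP_t}{dt}=-\mathrm{vecs}^{-1}\left(T_p^+[\,0_{m_u\times m_l}\ \ I_{m_u}]\,g(\theta_t)^{-1}\frac{d\eta_t}{dt}\right).$$ *)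

theory Defs
  imports
    "HOL-Analysis.Analysis"
    "Jordan_Normal_Form.Matrix"
begin

hide_type (open) Finite_Cartesian_Product.vec
hide_const (open) Finite_Cartesian_Product.vec Finite_Cartesian_Product.mat
unbundle no vec_syntax
unbundle no inner_syntax
notation vec_nth (infixl "$h" 90)

text \<open>
  The state space is \<open>real ^ 'd\<close>. The dimensions on the parameter side are binomial
  coefficients, so vectors and matrices there are those of \<open>Jordan_Normal_Form.Matrix\<close>, whose
  dimensions are terms. All indices are zero-based.
\<close>

subsection \<open>Matrix notation\<close>

definition lt :: "nat \<Rightarrow> nat" where
  "lt n = n * (n + 1) div 2"

definition sym_mats :: "nat \<Rightarrow> real mat set" where
  "sym_mats n = {A \<in> carrier_mat n n. A\<^sup>T = A}"

definition spd_mats :: "nat \<Rightarrow> real mat set" where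
  "spd_mats n =
    {A \<in> sym_mats n. \<forall>v \<in> carrier_vec n. v \<noteq> 0\<^sub>v n \<longrightarrow> 0 < v \<bullet> (A *\<^sub>v v)}"

definition lower_mats :: "nat \<Rightarrow> real mat set" where
  "lower_mats n = {A \<in> carrier_mat n n. \<forall>i < n. \<forall>j < n. i < j \<longrightarrow> A $$ (i, j) = 0}"

definition lower_pos_mats :: "nat \<Rightarrow> real mat set" where
  "lower_pos_mats n = {A \<in> lower_mats n. \<forall>i < n. 0 < A $$ (i, i)}"

definition vec_of_cols :: "real mat \<Rightarrow> real vec" where
  "vec_of_cols A = vec (dim_row A * dim_col A) (\<lambda>k. A $$ (k mod dim_row A, k div dim_row A))"

text \<open>
  The positions \<open>(i, j)\<close> with \<open>i \<ge> j\<close>, diagonal by diagonal, main diagonal first; this list has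
  length \<open>lt n\<close>.
\<close>

definition vecs_order :: "nat \<Rightarrow> (nat \<times> nat) list" where
  "vecs_order n = concat (map (\<lambda>s. map (\<lambda>j. (j + s, j)) [0..<n - s]) [0..<n])"

definition vecs :: "real mat \<Rightarrow> real vec" where
  "vecs A = vec (lt (dim_row A)) (\<lambda>k. A $$ (vecs_order (dim_row A) ! k))"

definition vecs_inv :: "nat \<Rightarrow> real vec \<Rightarrow> real mat" where
  "vecs_inv n = the_inv_into (sym_mats n) vecs"

definition vecl :: "real mat \<Rightarrow> real vec" where
  "vecl L = vec (lt (dim_row L)) (\<lambda>k.
     let (i, j) = vecs_order (dim_row L) ! k
     in if i = j then ln (L $$ (i, j)) else L $$ (i, j))"

definition vecl_inv :: "nat \<Rightarrow> real vec \<Rightarrow> real mat" where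
  "vecl_inv n = the_inv_into (lower_pos_mats n) vecl"

text \<open>The Jacobian of \<^const>\<open>vecl\<close> at \<open>L\<close> in \<^const>\<open>vecs\<close> coordinates.\<close>

definition vecl_jac :: "real mat \<Rightarrow> real mat" where
  "vecl_jac L = (let n = dim_row L in
     mat (lt n) (lt n) (\<lambda>(k, l). if k = l then (if k < n then 1 / L $$ (k, k) else 1) else 0))"

definition chol :: "real mat \<Rightarrow> real mat" where
  "chol P = (THE L. L \<in> lower_pos_mats (dim_row P) \<and> P = L * L\<^sup>T)"

definition frob_norm :: "real mat \<Rightarrow> real" where
  "frob_norm A = sqrt (\<Sum>i < dim_row A. \<Sum>j < dim_col A. (A $$ (i, j))\<^sup>2)"

text \<open>
  \<open>D\<close> is the Frechet differential at \<open>P\<close> of \<open>F\<close>, a map from a neighbourhood of \<open>P\<close> in the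
  linear space \<open>V\<close> of matrices to the linear space \<open>W\<close>.
\<close>

definition has_differential ::
    "real mat set \<Rightarrow> real mat set \<Rightarrow> (real mat \<Rightarrow> real mat) \<Rightarrow> (real mat \<Rightarrow> real mat) \<Rightarrow> real mat \<Rightarrow> bool"
  where
  "has_differential V W F D P \<longleftrightarrow>
     D \<in> V \<rightarrow>\<^sub>E W \<and>
     (\<forall>A \<in> V. \<forall>B \<in> V. D (A + B) = D A + D B) \<and>
     (\<forall>a. \<forall>A \<in> V. D (a \<cdot>\<^sub>m A) = a \<cdot>\<^sub>m D A) \<and>
     (\<forall>e > 0. \<exists>\<delta> > 0. \<forall>H \<in> V. frob_norm H < \<delta> \<longrightarrow>
        frob_norm (F (P + H) - F P - D H) \<le> e * frob_norm H)"

definition chol_differential :: "real mat \<Rightarrow> real mat \<Rightarrow> real mat" where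
  "chol_differential P = (let n = dim_row P in
     THE D. has_differential (sym_mats n) (lower_mats n) chol D P)"

definition pinv :: "real mat \<Rightarrow> real mat" where
  "pinv A = (THE X. X \<in> carrier_mat (dim_col A) (dim_row A) \<and>
     A * X * A = A \<and> X * A * X = X \<and> (A * X)\<^sup>T = A * X \<and> (X * A)\<^sup>T = X * A)"

text \<open>As with \<open>inverse 0 = 0\<close>, a singular matrix is given the inverse zero.\<close>

definition mat_inv :: "real mat \<Rightarrow> real mat" where
  "mat_inv A = (let n = dim_row A in
     if invertible_mat A
     then (THE B. B \<in> carrier_mat n n \<and> A * B = 1\<^sub>m n \<and> B * A = 1\<^sub>m n)
     else 0\<^sub>m n n)"

definition kron :: "real mat \<Rightarrow> real mat \<Rightarrow> real mat" (infixl "\<otimes>\<^sub>m" 70) where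
  "A \<otimes>\<^sub>m B = mat (dim_row A * dim_row B) (dim_col A * dim_col B)
     (\<lambda>(i, j). A $$ (i div dim_row B, j div dim_col B) * B $$ (i mod dim_row B, j mod dim_col B))"

definition append_cols :: "real mat \<Rightarrow> real mat \<Rightarrow> real mat" (infixr "@\<^sub>c" 65) where
  "A @\<^sub>c B = (A\<^sup>T @\<^sub>r B\<^sup>T)\<^sup>T"

definition dup_mat :: "nat \<Rightarrow> real mat" where
  "dup_mat n = (THE D. D \<in> carrier_mat (n\<^sup>2) (lt n) \<and>
     (\<forall>A \<in> sym_mats n. D *\<^sub>v vecs A = vec_of_cols A))"

definition elim_mat :: "nat \<Rightarrow> real mat" where
  "elim_mat n = (THE E. E \<in> carrier_mat (n\<^sup>2) (lt n) \<and>
     (\<forall>X \<in> lower_mats n. E *\<^sub>v vecs X = vec_of_cols X))"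

definition C_mat :: "real mat \<Rightarrow> real mat" where
  "C_mat L = (let n = dim_row L in
     pinv (dup_mat n) * (mat_inv L \<otimes>\<^sub>m mat_inv L) * dup_mat n)"

definition Delta_mat :: "real mat \<Rightarrow> real mat" where
  "Delta_mat L = (let n = dim_row L in
     vecl_jac L * pinv (elim_mat n) * (1\<^sub>m n \<otimes>\<^sub>m L) * elim_mat n)"

definition Ktilde :: "nat \<Rightarrow> real mat" where
  "Ktilde n = mat (lt n) (lt n) (\<lambda>(k, l). if k = l then (if k < n then 1 / 2 else 1) else 0)"

definition vnorm :: "real vec \<Rightarrow> real" where
  "vnorm v = sqrt (v \<bullet> v)"

definition vec_tendsto :: "nat \<Rightarrow> (real \<Rightarrow> real vec) \<Rightarrow> real vec \<Rightarrow> real filter \<Rightarrow> bool" where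
  "vec_tendsto n x v F \<longleftrightarrow> v \<in> carrier_vec n \<and> (\<forall>i < n. ((\<lambda>s. x s $ i) \<longlongrightarrow> v $ i) F)"

definition mat_tendsto :: "nat \<Rightarrow> (real \<Rightarrow> real mat) \<Rightarrow> real mat \<Rightarrow> real filter \<Rightarrow> bool" where
  "mat_tendsto n X A F \<longleftrightarrow>
     A \<in> carrier_mat n n \<and> (\<forall>i < n. \<forall>j < n. ((\<lambda>s. X s $$ (i, j)) \<longlongrightarrow> A $$ (i, j)) F)"

definition vec_has_deriv :: "nat \<Rightarrow> (real \<Rightarrow> real vec) \<Rightarrow> real vec \<Rightarrow> real \<Rightarrow> bool" where
  "vec_has_deriv n x v t \<longleftrightarrow>
     v \<in> carrier_vec n \<and> (\<forall>i < n. ((\<lambda>s. x s $ i) has_real_derivative v $ i) (at t))"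

definition mat_has_deriv :: "nat \<Rightarrow> (real \<Rightarrow> real mat) \<Rightarrow> real mat \<Rightarrow> real \<Rightarrow> bool" where
  "mat_has_deriv n X A t \<longleftrightarrow> A \<in> carrier_mat n n \<and>
     (\<forall>i < n. \<forall>j < n. ((\<lambda>s. X s $$ (i, j)) has_real_derivative A $$ (i, j)) (at t))"

subsection \<open>Monomials\<close>

definition exponents :: "nat \<Rightarrow> ('d::finite \<Rightarrow> nat) set" where
  "exponents s = {a. (\<Sum>q \<in> UNIV. a q) = s}"

text \<open>
  The vector of monomials with exponents \<open>a 0, \<dots>, a (N - 1)\<close>; it is the vector of all monomials
  of degree \<open>s\<close> when \<open>a\<close> is a bijection from \<open>{..<N}\<close> to \<open>exponents s\<close>.
\<close>

definition monomials :: "nat \<Rightarrow> (nat \<Rightarrow> 'd::finite \<Rightarrow> nat) \<Rightarrow> real ^ 'd \<Rightarrow> real vec" where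
  "monomials N a x = vec N (\<lambda>l. \<Prod>q \<in> UNIV. (x $h q) ^ a l q)"

definition T_mat ::
    "nat \<Rightarrow> nat \<Rightarrow> (nat \<Rightarrow> 'd \<Rightarrow> nat) \<Rightarrow> (nat \<Rightarrow> 'd \<Rightarrow> nat) \<Rightarrow> real mat" where
  "T_mat z1 z2 \<beta> \<alpha> = mat z2 (lt z1) (\<lambda>(l, k).
     let (i, j) = vecs_order z1 ! k
     in if \<alpha> l = (\<lambda>q. \<beta> i q + \<beta> j q) then 1 else 0)"

definition K_mat :: "nat \<Rightarrow> real mat" where
  "K_mat z1 = mat (lt z1) (lt z1) (\<lambda>(k, l). if k = l then (if k < z1 then 1 else 2) else 0)"

definition Tp_mat ::
    "nat \<Rightarrow> nat \<Rightarrow> (nat \<Rightarrow> 'd \<Rightarrow> nat) \<Rightarrow> (nat \<Rightarrow> 'd \<Rightarrow> nat) \<Rightarrow> real mat" where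
  "Tp_mat z1 z2 \<beta> \<alpha> = (let T = T_mat z1 z2 \<beta> \<alpha> in mat_inv (T * T\<^sup>T) * T * K_mat z1)"

subsection \<open>Exponential family and projection filter\<close>

definition partial :: "'d \<Rightarrow> (real ^ 'd \<Rightarrow> real) \<Rightarrow> real ^ 'd \<Rightarrow> real" where
  "partial i \<phi> x = deriv (\<lambda>h. \<phi> (x + h *\<^sub>R axis i 1)) 0"

text \<open>The backward Kolmogorov operator of the SDE with drift \<open>f\<close> and diffusion coefficient \<open>\<rho>\<close>.\<close>

definition generator ::
    "(real ^ 'd \<Rightarrow> real ^ 'd) \<Rightarrow> (real ^ 'd \<Rightarrow> real ^ 'w ^ 'd) \<Rightarrow>
      (real ^ 'd \<Rightarrow> real) \<Rightarrow> real ^ 'd \<Rightarrow> real" where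
  "generator f \<rho> \<phi> x =
     (\<Sum>i \<in> UNIV. f x $h i * partial i \<phi> x) +
     1 / 2 * (\<Sum>i \<in> UNIV. \<Sum>j \<in> UNIV.
        (\<rho> x ** transpose (\<rho> x)) $h i $h j * partial i (partial j \<phi>) x)"

definition param_space :: "nat \<Rightarrow> (real ^ 'd \<Rightarrow> real vec) \<Rightarrow> real vec set" where
  "param_space m c = {\<theta> \<in> carrier_vec m. integrable lborel (\<lambda>x. exp (c x \<bullet> \<theta>))}"

definition vec_open :: "nat \<Rightarrow> real vec set \<Rightarrow> bool" where
  "vec_open m S \<longleftrightarrow> S \<subseteq> carrier_vec m \<and>
     (\<forall>u \<in> S. \<exists>e > 0. \<forall>v \<in> carrier_vec m. vnorm (v - u) < e \<longrightarrow> v \<in> S)"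

definition log_partition :: "(real ^ 'd \<Rightarrow> real vec) \<Rightarrow> real vec \<Rightarrow> real" where
  "log_partition c \<theta> = ln (LINT x|lborel. exp (c x \<bullet> \<theta>))"

definition exp_density :: "(real ^ 'd \<Rightarrow> real vec) \<Rightarrow> real vec \<Rightarrow> real ^ 'd \<Rightarrow> real" where
  "exp_density c \<theta> x = exp (c x \<bullet> \<theta> - log_partition c \<theta>)"

definition expect ::
    "(real ^ 'd \<Rightarrow> real vec) \<Rightarrow> real vec \<Rightarrow> (real ^ 'd \<Rightarrow> real) \<Rightarrow> real" where
  "expect c \<theta> \<phi> = integral\<^sup>L (density lborel (\<lambda>x. ennreal (exp_density c \<theta> x))) \<phi>"

definition fisher :: "nat \<Rightarrow> (real ^ 'd \<Rightarrow> real vec) \<Rightarrow> real vec \<Rightarrow> real mat" where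
  "fisher m c \<theta> = mat m m (\<lambda>(i, j).
     expect c \<theta> (\<lambda>x. (c x $ i - expect c \<theta> (\<lambda>y. c y $ i)) *
                       (c x $ j - expect c \<theta> (\<lambda>y. c y $ j))))"

text \<open>The rate \<open>d\<eta>/dt\<close>, i.e. the expectation of the generator applied to the entries of \<open>c\<close>.\<close>

definition eta_rate ::
    "(real ^ 'd \<Rightarrow> real ^ 'd) \<Rightarrow> (real ^ 'd \<Rightarrow> real ^ 'w ^ 'd) \<Rightarrow>
      nat \<Rightarrow> (real ^ 'd \<Rightarrow> real vec) \<Rightarrow> real vec \<Rightarrow> real vec" where
  "eta_rate f \<rho> m c \<theta> = vec m (\<lambda>i. expect c \<theta> (generator f \<rho> (\<lambda>x. c x $ i)))"

definition lin_indep_components :: "nat \<Rightarrow> (real ^ 'd \<Rightarrow> real vec) \<Rightarrow> bool" where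
  "lin_indep_components m c \<longleftrightarrow>
     (\<forall>a \<in> carrier_vec m. (\<forall>x. a \<bullet> c x = 0) \<longrightarrow> a = 0\<^sub>v m)"

subsection \<open>The sum-of-squares relaxation\<close>

text \<open>
  \<open>sos_relaxation\<close> says that the functions \<open>\<theta>l\<close>, \<open>P\<close> and \<open>\<nu> = vecl (chol P)\<close> of time solve the
  relaxed system on \<open>{t0<..<t1}\<close>, started at time \<open>t0\<close> from \<open>\<theta>l0\<close> and \<open>P0\<close>. Here \<open>n\<close> is the size
  of the matrices \<open>P t\<close>, and \<open>ml\<close>, \<open>mu\<close> are the numbers of entries of \<open>c_l\<close> and \<open>c_u\<close>.
\<close>

definition sos_relaxation ::
    "(real ^ 'd \<Rightarrow> real ^ 'd) \<Rightarrow> (real ^ 'd \<Rightarrow> real ^ 'w ^ 'd) \<Rightarrow>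
      nat \<Rightarrow> nat \<Rightarrow> (real ^ 'd \<Rightarrow> real vec) \<Rightarrow> nat \<Rightarrow> real mat \<Rightarrow>
      real \<Rightarrow> real \<Rightarrow> real vec \<Rightarrow> real mat \<Rightarrow>
      (real \<Rightarrow> real vec) \<Rightarrow> (real \<Rightarrow> real mat) \<Rightarrow> (real \<Rightarrow> real vec) \<Rightarrow> bool" where
  "sos_relaxation f \<rho> ml mu c n Tp t0 t1 \<theta>l0 P0 \<theta>l P \<nu> \<longleftrightarrow>
     vec_tendsto ml \<theta>l \<theta>l0 (at_right t0) \<and>
     mat_tendsto n P P0 (at_right t0) \<and>
     (\<forall>t \<in> {t0<..<t1}.
        let \<theta> = \<theta>l t @\<^sub>v - (Tp *\<^sub>v vecs (P t));
            L = chol (P t);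
            v = mat_inv (fisher (ml + mu) c \<theta>) *\<^sub>v eta_rate f \<rho> (ml + mu) c \<theta>;
            dP = - vecs_inv n (pinv Tp *\<^sub>v ((0\<^sub>m mu ml @\<^sub>c 1\<^sub>m mu) *\<^sub>v v))
        in \<theta>l t \<in> carrier_vec ml \<and> P t \<in> spd_mats n \<and> \<nu> t = vecl L \<and>
           vec_has_deriv ml \<theta>l ((1\<^sub>m ml @\<^sub>c 0\<^sub>m ml mu) *\<^sub>v v) t \<and>
           mat_has_deriv n P dP t \<and>
           vec_has_deriv (lt n) \<nu> (vecl_jac L *\<^sub>v vecs (chol_differential (P t) dP)) t)"

text \<open>
  The compact form is a system in \<open>\<theta>l\<close> and \<open>\<nu>\<close> alone, with initial values \<open>\<theta>l0\<close> and \<open>\<nu>0\<close>.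
\<close>

definition sos_compact ::
    "(real ^ 'd \<Rightarrow> real ^ 'd) \<Rightarrow> (real ^ 'd \<Rightarrow> real ^ 'w ^ 'd) \<Rightarrow>
      nat \<Rightarrow> nat \<Rightarrow> (real ^ 'd \<Rightarrow> real vec) \<Rightarrow> nat \<Rightarrow> real mat \<Rightarrow>
      real \<Rightarrow> real \<Rightarrow> real vec \<Rightarrow> real vec \<Rightarrow>
      (real \<Rightarrow> real vec) \<Rightarrow> (real \<Rightarrow> real vec) \<Rightarrow> bool" where
  "sos_compact f \<rho> ml mu c n Tp t0 t1 \<theta>l0 \<nu>0 \<theta>l \<nu> \<longleftrightarrow>
     vec_tendsto ml \<theta>l \<theta>l0 (at_right t0) \<and>
     vec_tendsto (lt n) \<nu> \<nu>0 (at_right t0) \<and>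
     (\<forall>t \<in> {t0<..<t1}.
        let L = vecl_inv n (\<nu> t);
            \<theta> = \<theta>l t @\<^sub>v - (Tp *\<^sub>v vecs (L * L\<^sup>T));
            M = four_block_mat
                  (1\<^sub>m ml)          (0\<^sub>m ml mu)
                  (0\<^sub>m (lt n) ml)   (- (Delta_mat L * Ktilde n * C_mat L * pinv Tp))
        in \<theta>l t \<in> carrier_vec ml \<and> \<nu> t \<in> carrier_vec (lt n) \<and>
           vec_has_deriv (ml + lt n) (\<lambda>s. \<theta>l s @\<^sub>v \<nu> s)
             (M *\<^sub>v (mat_inv (fisher (ml + mu) c \<theta>) *\<^sub>v eta_rate f \<rho> (ml + mu) c \<theta>)) t)"

end

theory Submission
  imports Defs "Jordan_Normal_Form.Determinant"
begin

text \<open>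
  Both systems prescribe the same rates; they differ in the coordinates in which the rate of the
  positive definite matrix \<open>P = L L\<^sup>T\<close> is written. The relaxation gives the rate \<open>H\<close> of
  \<open>P\<close> and transports it to \<open>\<nu> = vecl L\<close> by the differential of the Cholesky map. The compact
  form writes this transport as one matrix. The theorem therefore rests on three points.

  The differential of the Cholesky map at \<open>P\<close> is \<open>H \<mapsto> L \<Phi> (L\<^sup>-\<^sup>1 H L\<^sup>-\<^sup>T)\<close>, where
  \<open>\<Phi>\<close> keeps the strict lower triangle and halves the diagonal: differentiating \<open>P = L L\<^sup>T\<close>
  and cancelling \<open>L\<close> on both sides shows that \<open>L\<^sup>-\<^sup>1 dL\<close> is the lower triangular matrix
  whose symmetrisation is \<open>L\<^sup>-\<^sup>1 dP L\<^sup>-\<^sup>T\<close>. For a finite increment \<open>H\<close> the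
  factor of \<open>P + H\<close> has the form \<open>L (1 + X)\<close>, and the same cancellation gives
  \<open>X + X\<^sup>T + X X\<^sup>T = L\<^sup>-\<^sup>1 H L\<^sup>-\<^sup>T\<close>. So the error of the linearisation is quadratic in \<open>X\<close>
  (\<open>chol_increment\<close>), and \<open>X\<close> tends to zero because the Cholesky factor is continuous
  (\<open>cholesky_tendsto\<close>).

  In \<^const>\<open>vecs\<close> coordinates \<^const>\<open>C_mat\<close> is the congruence \<open>H \<mapsto> L\<^sup>-\<^sup>1 H L\<^sup>-\<^sup>T\<close>,
  \<^const>\<open>Ktilde\<close> is \<open>\<Phi>\<close>, and \<^const>\<open>Delta_mat\<close> is left multiplication by \<open>L\<close> followed by
  the Jacobian of \<^const>\<open>vecl\<close>. Their product is the transport above (\<open>compact_factors_vecs\<close>).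
  The pseudo-inverses in these matrices act as left inverses, since duplication and elimination
  matrices are injective.

  Finally, \<open>L \<mapsto> L L\<^sup>T\<close> and \<^const>\<open>vecl\<close> are bijections onto the positive definite matrices
  and onto a full coordinate space, continuous in both directions. A solution of the compact form
  thus determines \<open>P\<close>, its initial limit transfers (\<open>spd_tendsto_iff\<close>), and the product rule
  recovers the rate of \<open>P\<close> from that of \<open>\<nu>\<close> (\<open>mat_has_deriv_of_chol\<close>).
\<close>

section \<open>Half-vectorisation as a coordinate system\<close>

lemma length_vecs_order: "length (vecs_order n) = lt n"
proof -
  have "length (vecs_order n) = (\<Sum>s<n. n - s)"
    by (simp add: vecs_order_def length_concat comp_def sum_list_sum_nth atLeast0LessThan)
  also have "\<dots> = (\<Sum>s<n. Suc (n - Suc s))"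
    by (rule sum.cong) auto
  also have "\<dots> = (\<Sum>s<n. Suc s)"
    by (rule sum.nat_diff_reindex)
  also have "\<dots> = lt n"
    by (induction n) (auto simp: lt_def)
  finally show ?thesis .
qed

lemma set_vecs_order: "set (vecs_order n) = {(i, j). j \<le> i \<and> i < n}"
proof -
  have "(i, j) \<in> set (vecs_order n)" if "j \<le> i" "i < n" for i j
    using that by (auto simp: vecs_order_def image_iff intro!: bexI[of _ "i - j"])
  then show ?thesis by (auto simp: vecs_order_def)
qed

lemma distinct_vecs_order: "distinct (vecs_order n)"
  unfolding vecs_order_def
proof (rule distinct_concat)
  have "inj_on (\<lambda>s. map (\<lambda>j. (j + s, j)) [0..<n - s]) {0..<n}"
  proof (rule inj_onI)
    fix s s'
    assume "s \<in> {0..<n}" "s' \<in> {0..<n}"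
      and eq: "map (\<lambda>j. (j + s, j)) [0..<n - s] = map (\<lambda>j. (j + s', j)) [0..<n - s']"
    then have "length [0..<n - s] = length [0..<n - s']" by (metis length_map)
    then show "s = s'" using \<open>s \<in> _\<close> \<open>s' \<in> _\<close> by auto
  qed
  then show "distinct (map (\<lambda>s. map (\<lambda>j. (j + s, j)) [0..<n - s]) [0..<n])"
    by (simp add: distinct_map)
qed (auto simp: distinct_map inj_on_def)

lemma vecs_order_nth:
  assumes "k < lt n"
  obtains i j where "vecs_order n ! k = (i, j)" "j \<le> i" "i < n"
  using nth_mem[of k "vecs_order n"] assms that
  by (auto simp: set_vecs_order length_vecs_order)

lemma vecs_order_position:
  assumes "j \<le> i" "i < n"
  obtains k where "k < lt n" "vecs_order n ! k = (i, j)"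
proof -
  from assms have "(i, j) \<in> set (vecs_order n)" by (simp add: set_vecs_order)
  then show ?thesis using that by (auto simp: in_set_conv_nth length_vecs_order)
qed

lemma vecs_order_nth_eq_iff:
  "k < lt n \<Longrightarrow> l < lt n \<Longrightarrow> vecs_order n ! k = vecs_order n ! l \<longleftrightarrow> k = l"
  by (simp add: nth_eq_iff_index_eq[OF distinct_vecs_order] length_vecs_order)

lemma le_lt: "n \<le> lt n"
  by (cases n) (auto simp: lt_def)

lemma vecs_order_nth_diag:
  assumes "k < n"
  shows "vecs_order n ! k = (k, k)"
proof -
  from assms have "[0..<n] = 0 # [1..<n]" by (simp add: upt_rec)
  then show ?thesis using assms
    by (cases k) (auto simp: vecs_order_def nth_append simp del: upt_Suc)
qed

lemma vecs_order_nth_offdiag: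
  assumes "n \<le> k" "k < lt n" "vecs_order n ! k = (i, j)"
  shows "j < i"
proof (rule ccontr)
  assume "\<not> j < i"
  with vecs_order_nth[OF assms(2)] assms(3) have "i = j" "i < n" by auto
  then have "vecs_order n ! k = vecs_order n ! i"
    using assms(3) by (simp add: vecs_order_nth_diag)
  moreover have "i < lt n" using \<open>i < n\<close> le_lt[of n] by simp
  ultimately have "k = i" using vecs_order_nth_eq_iff assms(2) by blast
  with assms(1) \<open>i < n\<close> show False by simp
qed

lemma vecs_carrier [simp]: "A \<in> carrier_mat n n \<Longrightarrow> vecs A \<in> carrier_vec (lt n)"
  by (auto simp: vecs_def)

lemma vecs_index: "A \<in> carrier_mat n n \<Longrightarrow> k < lt n \<Longrightarrow> vecs A $ k = A $$ (vecs_order n ! k)"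
  by (auto simp: vecs_def)

lemma vecs_eqD:
  assumes "vecs A = vecs B" "A \<in> carrier_mat n n" "B \<in> carrier_mat n n" "j \<le> i" "i < n"
  shows "A $$ (i, j) = B $$ (i, j)"
proof -
  obtain k where k: "k < lt n" "vecs_order n ! k = (i, j)"
    using vecs_order_position assms(4,5) .
  have "vecs A $ k = vecs B $ k" using assms(1) by simp
  then show ?thesis
    unfolding vecs_index[OF assms(2) k(1)] vecs_index[OF assms(3) k(1)] k(2) .
qed

lemma vecs_uminus: "A \<in> carrier_mat n n \<Longrightarrow> vecs (- A) = - vecs A"
  by (rule eq_vecI) (auto simp: vecs_def elim!: vecs_order_nth)

lemma sym_mats_carrier: "A \<in> sym_mats n \<Longrightarrow> A \<in> carrier_mat n n"
  by (simp add: sym_mats_def)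

lemma sym_mats_index: "A \<in> sym_mats n \<Longrightarrow> i < n \<Longrightarrow> j < n \<Longrightarrow> A $$ (i, j) = A $$ (j, i)"
  unfolding sym_mats_def by (metis (mono_tags, lifting) carrier_matD index_transpose_mat(1) mem_Collect_eq)

lemma sym_matsI:
  assumes "A \<in> carrier_mat n n" "\<And>i j. i < n \<Longrightarrow> j < n \<Longrightarrow> A $$ (i, j) = A $$ (j, i)"
  shows "A \<in> sym_mats n"
  using assms by (auto simp: sym_mats_def)

lemma sym_mats_uminus: "A \<in> sym_mats n \<Longrightarrow> - A \<in> sym_mats n"
  by (simp add: sym_mats_def transpose_uminus)

lemma sym_mats_add: "A \<in> sym_mats n \<Longrightarrow> B \<in> sym_mats n \<Longrightarrow> A + B \<in> sym_mats n"
  using transpose_add[of A n n B] by (simp add: sym_mats_def)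

lemma sym_mats_smult: "A \<in> sym_mats n \<Longrightarrow> a \<cdot>\<^sub>m A \<in> sym_mats n"
  using sym_mats_carrier[of A n] sym_mats_index[of A n] by (intro sym_matsI) auto

lemma lower_mats_carrier: "A \<in> lower_mats n \<Longrightarrow> A \<in> carrier_mat n n"
  by (simp add: lower_mats_def)

lemma lower_mats_zero: "A \<in> lower_mats n \<Longrightarrow> i < j \<Longrightarrow> j < n \<Longrightarrow> A $$ (i, j) = 0"
  by (simp add: lower_mats_def)

lemma lower_pos_mats_lower: "A \<in> lower_pos_mats n \<Longrightarrow> A \<in> lower_mats n"
  by (simp add: lower_pos_mats_def)

lemmas lower_pos_mats_carrier = lower_mats_carrier[OF lower_pos_mats_lower]

lemma lower_pos_mats_pos: "A \<in> lower_pos_mats n \<Longrightarrow> i < n \<Longrightarrow> 0 < A $$ (i, i)"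
  by (simp add: lower_pos_mats_def)

lemma lower_mats_eqI:
  assumes "A \<in> lower_mats n" "B \<in> lower_mats n"
    and "\<And>i j. j \<le> i \<Longrightarrow> i < n \<Longrightarrow> A $$ (i, j) = B $$ (i, j)"
  shows "A = B"
proof (rule eq_matI)
  fix i j assume "i < dim_row B" "j < dim_col B"
  then have "i < n" "j < n" using lower_mats_carrier[OF assms(2)] by auto
  then show "A $$ (i, j) = B $$ (i, j)"
    using assms by (cases "j \<le> i") (auto simp: lower_mats_zero)
qed (use lower_mats_carrier[OF assms(1)] lower_mats_carrier[OF assms(2)] in auto)

text \<open>
  Every vector of length \<open>lt n\<close> prescribes the lower triangle freely; this is the common source of
  surjectivity of \<^const>\<open>vecs\<close> on symmetric and on triangular matrices and of \<^const>\<open>vecl\<close>.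
\<close>

lemma lower_triangle_prescribed:
  fixes x :: "nat \<Rightarrow> real"
  obtains a where "\<And>k. k < lt n \<Longrightarrow> a (vecs_order n ! k) = x k"
proof
  fix k assume "k < lt n"
  then show "(\<lambda>p. x (THE l. l < lt n \<and> vecs_order n ! l = p)) (vecs_order n ! k) = x k"
    by (auto intro!: arg_cong[where f = x] simp: vecs_order_nth_eq_iff cong: conj_cong)
qed

lemma vecs_bij_sym: "bij_betw vecs (sym_mats n) (carrier_vec (lt n))"
  unfolding bij_betw_def
proof (intro conjI inj_onI subset_antisym subsetI)
  fix A B assume *: "A \<in> sym_mats n" "B \<in> sym_mats n" "vecs A = vecs B"
  show "A = B"
  proof (rule eq_matI)
    fix i j assume "i < dim_row B" "j < dim_col B"
    then have ij: "i < n" "j < n" using sym_mats_carrier[OF *(2)] by auto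
    show "A $$ (i, j) = B $$ (i, j)"
      using vecs_eqD[OF *(3) sym_mats_carrier[OF *(1)] sym_mats_carrier[OF *(2)], of j i]
        vecs_eqD[OF *(3) sym_mats_carrier[OF *(1)] sym_mats_carrier[OF *(2)], of i j]
        sym_mats_index[OF *(1) ij] sym_mats_index[OF *(2) ij] ij
      by (cases "j \<le> i") auto
  qed (use sym_mats_carrier[OF *(1)] sym_mats_carrier[OF *(2)] in auto)
next
  fix x assume "x \<in> vecs ` sym_mats n"
  then show "x \<in> carrier_vec (lt n)" by (auto simp: sym_mats_def)
next
  fix x :: "real vec" assume x: "x \<in> carrier_vec (lt n)"
  obtain a where a: "\<And>k. k < lt n \<Longrightarrow> a (vecs_order n ! k) = x $ k"
    using lower_triangle_prescribed[of n "($) x"] by blast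
  let ?A = "mat n n (\<lambda>(i, j). a (max i j, min i j))"
  have "?A \<in> sym_mats n" by (rule sym_matsI) (auto simp: max.commute min.commute)
  moreover have "vecs ?A = x"
  proof (rule eq_vecI)
    fix k assume "k < dim_vec x"
    then have k: "k < lt n" using x by auto
    obtain i j where "vecs_order n ! k = (i, j)" "j \<le> i" "i < n" using vecs_order_nth[OF k] .
    then show "vecs ?A $ k = x $ k"
      using k a[OF k] by (simp add: vecs_index[of _ n] max_absorb1 min_absorb2)
  qed (use x in \<open>auto simp: vecs_def\<close>)
  ultimately show "x \<in> vecs ` sym_mats n" by blast
qed

lemma vecs_bij_lower: "bij_betw vecs (lower_mats n) (carrier_vec (lt n))"
  unfolding bij_betw_def
proof (intro conjI inj_onI subset_antisym subsetI)
  fix A B assume "A \<in> lower_mats n" "B \<in> lower_mats n" "vecs A = vecs B"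
  then show "A = B"
    by (intro lower_mats_eqI[of A n B]) (auto intro!: vecs_eqD lower_mats_carrier)
next
  fix x assume "x \<in> vecs ` lower_mats n"
  then show "x \<in> carrier_vec (lt n)" by (auto simp: lower_mats_def)
next
  fix x :: "real vec" assume x: "x \<in> carrier_vec (lt n)"
  obtain a where a: "\<And>k. k < lt n \<Longrightarrow> a (vecs_order n ! k) = x $ k"
    using lower_triangle_prescribed[of n "($) x"] by blast
  let ?A = "mat n n (\<lambda>(i, j). if j \<le> i then a (i, j) else 0)"
  have "?A \<in> lower_mats n" by (auto simp: lower_mats_def)
  moreover have "vecs ?A = x"
  proof (rule eq_vecI)
    fix k assume "k < dim_vec x"
    then have k: "k < lt n" using x by auto
    obtain i j where "vecs_order n ! k = (i, j)" "j \<le> i" "i < n" using vecs_order_nth[OF k] .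
    then show "vecs ?A $ k = x $ k"
      using k a[OF k] by (simp add: vecs_index[of _ n])
  qed (use x in \<open>auto simp: vecs_def\<close>)
  ultimately show "x \<in> vecs ` lower_mats n" by blast
qed

lemma vecl_carrier [simp]: "L \<in> carrier_mat n n \<Longrightarrow> vecl L \<in> carrier_vec (lt n)"
  by (auto simp: vecl_def)

lemma vecl_index:
  assumes "L \<in> carrier_mat n n" "k < lt n" "vecs_order n ! k = (i, j)"
  shows "vecl L $ k = (if i = j then ln (L $$ (i, j)) else L $$ (i, j))"
  using assms by (auto simp: vecl_def)

lemma vecl_bij: "bij_betw vecl (lower_pos_mats n) (carrier_vec (lt n))"
  unfolding bij_betw_def
proof (intro conjI inj_onI subset_antisym subsetI)
  fix A B assume *: "A \<in> lower_pos_mats n" "B \<in> lower_pos_mats n" "vecl A = vecl B"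
  show "A = B"
  proof (rule lower_mats_eqI)
    fix i j assume ij: "j \<le> i" "i < n"
    obtain k where k: "k < lt n" "vecs_order n ! k = (i, j)"
      using vecs_order_position[OF ij] .
    have "vecl A $ k = vecl B $ k" using * by simp
    then show "A $$ (i, j) = B $$ (i, j)"
      using lower_pos_mats_pos[OF *(1) ij(2)] lower_pos_mats_pos[OF *(2) ij(2)]
      by (simp add: vecl_index[OF lower_pos_mats_carrier[OF *(1)] k]
          vecl_index[OF lower_pos_mats_carrier[OF *(2)] k] split: if_splits)
  qed (use * lower_pos_mats_lower in auto)
next
  fix x assume "x \<in> vecl ` lower_pos_mats n"
  then show "x \<in> carrier_vec (lt n)" by (auto dest!: lower_pos_mats_carrier)
next
  fix x :: "real vec" assume x: "x \<in> carrier_vec (lt n)"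
  obtain a where a: "\<And>k. k < lt n \<Longrightarrow> a (vecs_order n ! k) = x $ k"
    using lower_triangle_prescribed[of n "($) x"] by blast
  let ?A = "mat n n (\<lambda>(i, j). if j < i then a (i, j) else if i = j then exp (a (i, i)) else 0)"
  have "?A \<in> lower_pos_mats n" by (auto simp: lower_mats_def lower_pos_mats_def)
  moreover have "vecl ?A = x"
  proof (rule eq_vecI)
    fix k assume "k < dim_vec x"
    then have k: "k < lt n" using x by auto
    obtain i j where "vecs_order n ! k = (i, j)" "j \<le> i" "i < n" using vecs_order_nth[OF k] .
    then show "vecl ?A $ k = x $ k"
      using k a[OF k] by (cases "i = j") (simp_all add: vecl_index[of _ n])
  qed (use x in \<open>auto simp: vecl_def\<close>)
  ultimately show "x \<in> vecl ` lower_pos_mats n" by blast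
qed

lemma vecs_inv_sym: "x \<in> carrier_vec (lt n) \<Longrightarrow> vecs_inv n x \<in> sym_mats n"
  unfolding vecs_inv_def by (rule bij_betwE[OF bij_betw_the_inv_into[OF vecs_bij_sym], rule_format])

lemma vecs_vecs_inv: "x \<in> carrier_vec (lt n) \<Longrightarrow> vecs (vecs_inv n x) = x"
  unfolding vecs_inv_def by (rule f_the_inv_into_f_bij_betw[OF vecs_bij_sym]) simp

lemma vecl_inv_lower_pos: "x \<in> carrier_vec (lt n) \<Longrightarrow> vecl_inv n x \<in> lower_pos_mats n"
  unfolding vecl_inv_def by (rule bij_betwE[OF bij_betw_the_inv_into[OF vecl_bij], rule_format])

lemma vecl_vecl_inv: "x \<in> carrier_vec (lt n) \<Longrightarrow> vecl (vecl_inv n x) = x"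
  unfolding vecl_inv_def by (rule f_the_inv_into_f_bij_betw[OF vecl_bij]) simp

lemma vecl_inv_vecl: "L \<in> lower_pos_mats n \<Longrightarrow> vecl_inv n (vecl L) = L"
  unfolding vecl_inv_def by (rule the_inv_into_f_f[OF bij_betw_imp_inj_on[OF vecl_bij]])

section \<open>Inverses and pseudo-inverses\<close>

lemma scalar_prod_self_eq_0D:
  fixes v :: "real vec"
  assumes "v \<in> carrier_vec n" "v \<bullet> v = 0"
  shows "v = 0\<^sub>v n"
proof -
  from assms have "(\<Sum>i\<in>{0..<n}. v $ i * v $ i) = 0" by (simp add: scalar_prod_def)
  then have "\<forall>i\<in>{0..<n}. v $ i * v $ i = 0"
    by (subst (asm) sum_nonneg_eq_0_iff) auto
  then show ?thesis using assms by (intro eq_vecI) auto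
qed

lemma injective_square_inverse:
  fixes A :: "real mat"
  assumes A: "A \<in> carrier_mat n n"
    and inj: "\<And>v. v \<in> carrier_vec n \<Longrightarrow> A *\<^sub>v v = 0\<^sub>v n \<Longrightarrow> v = 0\<^sub>v n"
  obtains B where "B \<in> carrier_mat n n" "A * B = 1\<^sub>m n" "B * A = 1\<^sub>m n"
proof -
  have "det A \<noteq> 0" using det_0_iff_vec_prod_zero_field[OF A] inj by blast
  from det_non_zero_imp_unit[OF A this, of "()"] show ?thesis
    using that unfolding Units_def ring_mat_def by auto
qed

lemma mat_inv_eq:
  assumes A: "A \<in> carrier_mat n n" and B: "B \<in> carrier_mat n n" and AB: "A * B = 1\<^sub>m n"
  shows "mat_inv A = B"
proof -
  have BA: "B * A = 1\<^sub>m n" using mat_mult_left_right_inverse[OF A B AB] .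
  have inv: "invertible_mat A"
    using A B AB BA by (auto simp: invertible_mat_def inverts_mat_def intro!: exI[of _ B])
  have uniq: "C = B" if "C \<in> carrier_mat n n" "C * A = 1\<^sub>m n" for C
  proof -
    have "C = C * (A * B)" unfolding AB using that by simp
    also have "\<dots> = (C * A) * B" by (rule assoc_mult_mat[OF that(1) A B, symmetric])
    also have "\<dots> = B" unfolding that(2) using B by simp
    finally show ?thesis .
  qed
  have "(THE C. C \<in> carrier_mat n n \<and> A * C = 1\<^sub>m n \<and> C * A = 1\<^sub>m n) = B"
    using B AB BA uniq by (intro the_equality) blast+
  then show ?thesis using A inv by (simp add: mat_inv_def Let_def)
qed

lemma mat_inv_carrier:
  assumes A: "A \<in> carrier_mat n n"
  shows "mat_inv A \<in> carrier_mat n n"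
proof (cases "invertible_mat A")
  case True
  then obtain B where AB: "A * B = 1\<^sub>m n" and BA: "B * A = 1\<^sub>m (dim_row B)"
    using A by (auto simp: invertible_mat_def inverts_mat_def)
  have "dim_col (A * B) = n" "dim_col (B * A) = dim_row B" unfolding AB BA by simp_all
  then have B: "B \<in> carrier_mat n n" using A by auto
  then show ?thesis using mat_inv_eq[OF A B AB] by simp
qed (use A in \<open>simp add: mat_inv_def Let_def\<close>)

definition penrose :: "real mat \<Rightarrow> real mat \<Rightarrow> bool" where
  "penrose A X \<longleftrightarrow> X \<in> carrier_mat (dim_col A) (dim_row A) \<and>
     A * X * A = A \<and> X * A * X = X \<and> (A * X)\<^sup>T = A * X \<and> (X * A)\<^sup>T = X * A"

text \<open>
  The four conditions make \<open>A X\<close> and \<open>A Y\<close> symmetric projections with the same range, hence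
  equal, and likewise \<open>X A = Y A\<close>; so \<open>X = X A X = Y A Y = Y\<close>.
\<close>

lemma penrose_unique:
  assumes X: "penrose A X" and Y: "penrose A Y"
  shows "X = Y"
proof -
  define m n where "m = dim_row A" and "n = dim_col A"
  have c [simp]: "A \<in> carrier_mat m n" "X \<in> carrier_mat n m" "Y \<in> carrier_mat n m"
    using X Y by (auto simp: m_def n_def penrose_def)
  have c2 [simp]: "A * X \<in> carrier_mat m m" "A * Y \<in> carrier_mat m m"
    "X * A \<in> carrier_mat n n" "Y * A \<in> carrier_mat n n"
    by (rule mult_carrier_mat[OF c(1,2)] mult_carrier_mat[OF c(1,3)]
        mult_carrier_mat[OF c(2,1)] mult_carrier_mat[OF c(3,1)])+
  have AX: "A * X * A = A" "X * A * X = X" "(A * X)\<^sup>T = A * X" "(X * A)\<^sup>T = X * A"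
    and AY: "A * Y * A = A" "Y * A * Y = Y" "(A * Y)\<^sup>T = A * Y" "(Y * A)\<^sup>T = Y * A"
    using X Y by (auto simp: penrose_def)
  have "A * X = (A * Y * A) * X" by (simp only: AY)
  also have "\<dots> = (A * Y) * (A * X)" by (rule assoc_mult_mat[OF c2(2) c(1,2)])
  also have "\<dots> = (A * Y)\<^sup>T * (A * X)\<^sup>T" by (simp only: AX AY)
  also have "\<dots> = (A * X * (A * Y))\<^sup>T" by (rule transpose_mult[OF c2(1,2), symmetric])
  also have "A * X * (A * Y) = (A * X * A) * Y" by (rule assoc_mult_mat[OF c2(1) c(1,3), symmetric])
  also have "(A * X * A * Y)\<^sup>T = A * Y" by (simp only: AX AY)
  finally have 1: "A * X = A * Y" .
  have "X * A = X * (A * Y * A)" by (simp only: AY)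
  also have "\<dots> = X * (A * (Y * A))" by (simp only: assoc_mult_mat[OF c(1,3,1)])
  also have "\<dots> = (X * A) * (Y * A)" by (rule assoc_mult_mat[OF c(2,1) c2(4), symmetric])
  also have "\<dots> = (X * A)\<^sup>T * (Y * A)\<^sup>T" by (simp only: AX AY)
  also have "\<dots> = (Y * A * (X * A))\<^sup>T" by (rule transpose_mult[OF c2(4,3), symmetric])
  also have "Y * A * (X * A) = Y * (A * (X * A))" by (rule assoc_mult_mat[OF c(3,1) c2(3)])
  also have "\<dots> = Y * (A * X * A)" by (simp only: assoc_mult_mat[OF c(1,2,1)])
  also have "(Y * (A * X * A))\<^sup>T = Y * A" by (simp only: AX AY)
  finally have 2: "X * A = Y * A" .
  have "X = X * A * X" by (simp only: AX)
  also have "\<dots> = Y * A * X" by (simp only: 2)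
  also have "\<dots> = Y * (A * X)" by (rule assoc_mult_mat[OF c(3,1,2)])
  also have "\<dots> = Y * (A * Y)" by (simp only: 1)
  also have "\<dots> = Y * A * Y" by (rule assoc_mult_mat[OF c(3,1,3), symmetric])
  also have "\<dots> = Y" by (simp only: AY)
  finally show ?thesis .
qed

lemma pinv_eq: "penrose A X \<Longrightarrow> pinv A = X"
  unfolding pinv_def penrose_def[symmetric] using penrose_unique by blast

lemma penrose_transpose:
  assumes "penrose A X"
  shows "penrose A\<^sup>T X\<^sup>T"
proof -
  have c: "A \<in> carrier_mat (dim_row A) (dim_col A)" "X \<in> carrier_mat (dim_col A) (dim_row A)"
    and *: "A * X * A = A" "X * A * X = X" "(A * X)\<^sup>T = A * X" "(X * A)\<^sup>T = X * A"
    using assms by (auto simp: penrose_def)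
  have t: "A\<^sup>T * X\<^sup>T = (X * A)\<^sup>T" "X\<^sup>T * A\<^sup>T = (A * X)\<^sup>T"
    using transpose_mult[OF c(2,1)] transpose_mult[OF c] by simp_all
  have 1: "A\<^sup>T * X\<^sup>T * A\<^sup>T = (A * (X * A))\<^sup>T"
    unfolding t by (rule transpose_mult[OF c(1) mult_carrier_mat[OF c(2,1)], symmetric])
  have 2: "X\<^sup>T * A\<^sup>T * X\<^sup>T = (X * (A * X))\<^sup>T"
    unfolding t by (rule transpose_mult[OF c(2) mult_carrier_mat[OF c(1,2)], symmetric])
  have "X\<^sup>T \<in> carrier_mat (dim_col A\<^sup>T) (dim_row A\<^sup>T)" using c(2) by simp
  moreover have "A\<^sup>T * X\<^sup>T * A\<^sup>T = A\<^sup>T" "X\<^sup>T * A\<^sup>T * X\<^sup>T = X\<^sup>T"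
    unfolding 1 2 assoc_mult_mat[OF c(1,2,1), symmetric] assoc_mult_mat[OF c(2,1,2), symmetric] *(1,2)
    by (rule refl)+
  moreover have "(A\<^sup>T * X\<^sup>T)\<^sup>T = A\<^sup>T * X\<^sup>T" "(X\<^sup>T * A\<^sup>T)\<^sup>T = X\<^sup>T * A\<^sup>T"
    by (simp_all only: t *(3,4))
  ultimately show ?thesis unfolding penrose_def by blast
qed

lemma penrose_zero: "penrose (0\<^sub>m m n) (0\<^sub>m n m)"
  by (simp add: penrose_def)

text \<open>
  For injective \<open>A\<close> the Gram matrix \<open>A\<^sup>T A\<close> is invertible, and the pseudo-inverse is
  \<open>(A\<^sup>T A)\<^sup>-\<^sup>1 A\<^sup>T\<close>.
\<close>

lemma penrose_of_injective:
  fixes A :: "real mat"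
  assumes A: "A \<in> carrier_mat m n"
    and inj: "\<And>v. v \<in> carrier_vec n \<Longrightarrow> A *\<^sub>v v = 0\<^sub>v m \<Longrightarrow> v = 0\<^sub>v n"
  obtains X where "penrose A X" "X * A = 1\<^sub>m n"
proof -
  have At: "A\<^sup>T \<in> carrier_mat n m" and G: "A\<^sup>T * A \<in> carrier_mat n n" using A by auto
  have "v = 0\<^sub>v n" if v: "v \<in> carrier_vec n" and z: "A\<^sup>T * A *\<^sub>v v = 0\<^sub>v n" for v
  proof -
    have Av: "A *\<^sub>v v \<in> carrier_vec m" using A v by simp
    have "(A *\<^sub>v v) \<bullet> (A *\<^sub>v v) = (A\<^sup>T *\<^sub>v (A *\<^sub>v v)) \<bullet> v"
      using transpose_vec_mult_scalar[OF A v Av] by simp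
    also have "A\<^sup>T *\<^sub>v (A *\<^sub>v v) = 0\<^sub>v n" using z assoc_mult_mat_vec[OF At A v] by simp
    also have "0\<^sub>v n \<bullet> v = 0" using v by simp
    finally show ?thesis using scalar_prod_self_eq_0D[OF Av] inj[OF v] by simp
  qed
  from injective_square_inverse[OF G this]
  obtain B where B: "B \<in> carrier_mat n n" and GB: "A\<^sup>T * A * B = 1\<^sub>m n" and BG: "B * (A\<^sup>T * A) = 1\<^sub>m n"
    by blast
  have Gt: "(A\<^sup>T * A)\<^sup>T = A\<^sup>T * A" using transpose_mult[OF At A] by simp
  have Bt: "B\<^sup>T \<in> carrier_mat n n" using B by simp
  have "A\<^sup>T * A * B\<^sup>T = 1\<^sub>m n" using transpose_mult[OF B G] BG Gt by simp
  (* Both are right inverses of the symmetric Gram matrix. *)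
  then have sym: "B\<^sup>T = B"
    using mat_inv_eq[OF G Bt] mat_inv_eq[OF G B GB] by simp
  let ?X = "B * A\<^sup>T"
  have X: "?X \<in> carrier_mat n m" using B At by simp
  have XA: "?X * A = 1\<^sub>m n" using assoc_mult_mat[OF B At A] BG by simp
  have "(A * ?X)\<^sup>T = ?X\<^sup>T * A\<^sup>T" using A X by (rule transpose_mult)
  also have "?X\<^sup>T = A * B" using transpose_mult[OF B At] sym by simp
  also have "A * B * A\<^sup>T = A * ?X" using A B At by (rule assoc_mult_mat)
  finally have "(A * ?X)\<^sup>T = A * ?X" .
  moreover have "A * ?X * A = A" using assoc_mult_mat[OF A X A] XA A by simp
  moreover have "?X * A * ?X = ?X" unfolding XA by (rule left_mult_one_mat[OF X])
  moreover have "(?X * A)\<^sup>T = ?X * A" unfolding XA by simp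
  moreover have "?X \<in> carrier_mat (dim_col A) (dim_row A)" using X A by simp
  ultimately have "penrose A ?X" unfolding penrose_def by blast
  with XA show ?thesis using that by blast
qed

lemma pinv_of_injective:
  fixes A :: "real mat"
  assumes A: "A \<in> carrier_mat m n"
    and inj: "\<And>v. v \<in> carrier_vec n \<Longrightarrow> A *\<^sub>v v = 0\<^sub>v m \<Longrightarrow> v = 0\<^sub>v n"
  shows "pinv A \<in> carrier_mat n m" "pinv A * A = 1\<^sub>m n"
proof -
  obtain X where X: "penrose A X" "X * A = 1\<^sub>m n" using penrose_of_injective[OF assms] by blast
  then show "pinv A \<in> carrier_mat n m" "pinv A * A = 1\<^sub>m n"
    using A pinv_eq[OF X(1)] by (auto simp: penrose_def)
qed

lemma diagonal_mult_vec:
  fixes d :: "nat \<Rightarrow> real"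
  assumes "x \<in> carrier_vec n" "k < n"
  shows "(mat n n (\<lambda>(k, l). if k = l then d k else 0) *\<^sub>v x) $ k = d k * x $ k"
proof -
  have "(mat n n (\<lambda>(k, l). if k = l then d k else 0) *\<^sub>v x) $ k =
      (\<Sum>l\<in>{0..<n}. (if k = l then d k else 0) * x $ l)"
    using assms by (simp add: scalar_prod_def)
  also have "\<dots> = (\<Sum>l\<in>{0..<n}. if k = l then d k * x $ l else 0)"
    by (rule sum.cong) auto
  finally show ?thesis using assms by simp
qed

text \<open>
  If \<open>T T\<^sup>T\<close> is invertible then the transpose of \<open>T\<^sub>p = (T T\<^sup>T)\<^sup>-\<^sup>1 T K\<close> is injective,
  because \<open>T\<^sup>T\<close> and the diagonal matrix \<open>K\<close> are; the pseudo-inverse of \<open>T\<^sub>p\<close> is the transpose of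
  the one of \<open>T\<^sub>p\<^sup>T\<close>. In the singular case the convention for \<^const>\<open>mat_inv\<close> makes \<open>T\<^sub>p\<close> zero.
\<close>

lemma pinv_Tp_carrier: "pinv (Tp_mat z1 z2 \<beta> \<alpha>) \<in> carrier_mat (lt z1) z2"
proof -
  define T K where "T = T_mat z1 z2 \<beta> \<alpha>" and "K = K_mat z1"
  have T: "T \<in> carrier_mat z2 (lt z1)" and K: "K \<in> carrier_mat (lt z1) (lt z1)"
    by (auto simp: T_def K_def T_mat_def K_mat_def)
  have Tt: "T\<^sup>T \<in> carrier_mat (lt z1) z2" and G: "T * T\<^sup>T \<in> carrier_mat z2 z2" using T by auto
  have Tp: "Tp_mat z1 z2 \<beta> \<alpha> = mat_inv (T * T\<^sup>T) * T * K"
    by (simp add: Tp_mat_def Let_def T_def K_def)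
  show ?thesis
  proof (cases "invertible_mat (T * T\<^sup>T)")
    case False
    then have "mat_inv (T * T\<^sup>T) = 0\<^sub>m z2 z2" using G T by (simp add: mat_inv_def Let_def)
    then have "Tp_mat z1 z2 \<beta> \<alpha> = 0\<^sub>m z2 (lt z1)" unfolding Tp using T K by simp
    then show ?thesis using pinv_eq[OF penrose_zero] by simp
  next
    case True
    then obtain B where AB: "T * T\<^sup>T * B = 1\<^sub>m z2" and BA: "B * (T * T\<^sup>T) = 1\<^sub>m (dim_row B)"
      using G T by (auto simp: invertible_mat_def inverts_mat_def)
    have "dim_col (T * T\<^sup>T * B) = z2" "dim_col (B * (T * T\<^sup>T)) = dim_row B"
      unfolding AB BA by simp_all
    then have B: "B \<in> carrier_mat z2 z2" using T by auto
    have inv: "mat_inv (T * T\<^sup>T) = B" using mat_inv_eq[OF G B AB] .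
    have Bt: "B\<^sup>T \<in> carrier_mat z2 z2" using B by simp
    have BT: "B * T \<in> carrier_mat z2 (lt z1)" using B T by simp
    have Kt: "K\<^sup>T = K" by (auto simp: K_def K_mat_def)
    have A: "(B * T * K)\<^sup>T \<in> carrier_mat (lt z1) z2" using BT K by simp
    have tr: "(B * T * K)\<^sup>T = K * (T\<^sup>T * B\<^sup>T)"
      using transpose_mult[OF BT K] transpose_mult[OF B T] Kt by simp
    have "v = 0\<^sub>v z2" if v: "v \<in> carrier_vec z2" and z: "(B * T * K)\<^sup>T *\<^sub>v v = 0\<^sub>v (lt z1)" for v
    proof -
      define u where "u = B\<^sup>T *\<^sub>v v"
      have u: "u \<in> carrier_vec z2" using Bt v by (simp add: u_def)
      have Tu: "T\<^sup>T *\<^sub>v u \<in> carrier_vec (lt z1)" using Tt u by simp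
      have TB: "T\<^sup>T * B\<^sup>T \<in> carrier_mat (lt z1) z2" using Tt Bt by simp
      have "K *\<^sub>v (T\<^sup>T *\<^sub>v u) = 0\<^sub>v (lt z1)"
        using z unfolding tr u_def assoc_mult_mat_vec[OF K TB v] assoc_mult_mat_vec[OF Tt Bt v] .
      moreover have "(K *\<^sub>v w) $ k = (if k < z1 then 1 else 2) * w $ k"
        if "w \<in> carrier_vec (lt z1)" "k < lt z1" for w k
        unfolding K_def K_mat_def using diagonal_mult_vec[OF that] .
      ultimately have "(if k < z1 then 1 else 2) * (T\<^sup>T *\<^sub>v u) $ k = 0" if "k < lt z1" for k
        using that Tu by (metis index_zero_vec(1))
      then have "(T\<^sup>T *\<^sub>v u) $ k = 0" if "k < lt z1" for k
        using that by (cases "k < z1") fastforce+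
      then have "T\<^sup>T *\<^sub>v u = 0\<^sub>v (lt z1)"
        using Tu T by (intro eq_vecI) auto
      then have "T *\<^sub>v (T\<^sup>T *\<^sub>v u) = 0\<^sub>v z2" using T by auto
      moreover have "v = (T * T\<^sup>T) *\<^sub>v u"
      proof -
        have "T * T\<^sup>T * B\<^sup>T = (B * (T * T\<^sup>T))\<^sup>T"
          using transpose_mult[OF B G] transpose_mult[OF T Tt] by simp
        also have "\<dots> = 1\<^sub>m z2" using BA B by simp
        finally show ?thesis
          unfolding u_def assoc_mult_mat_vec[OF G Bt v, symmetric] using v by simp
      qed
      ultimately show ?thesis by (simp only: assoc_mult_mat_vec[OF T Tt u])
    qed
    then obtain X where "penrose (B * T * K)\<^sup>T X" using penrose_of_injective[OF A] by metis
    then have P: "penrose (B * T * K) X\<^sup>T" using penrose_transpose by fastforce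
    then have "X\<^sup>T \<in> carrier_mat (lt z1) z2" using B K by (simp add: penrose_def)
    then show ?thesis unfolding Tp inv pinv_eq[OF P] .
  qed
qed

section \<open>Duplication and elimination matrices\<close>

lemma vec_of_cols_carrier: "A \<in> carrier_mat n n \<Longrightarrow> vec_of_cols A \<in> carrier_vec (n\<^sup>2)"
  by (simp add: vec_of_cols_def power2_eq_square)

lemma vec_of_cols_index:
  "A \<in> carrier_mat n n \<Longrightarrow> r < n\<^sup>2 \<Longrightarrow> vec_of_cols A $ r = A $$ (r mod n, r div n)"
  by (simp add: vec_of_cols_def power2_eq_square)

lemma div_mod_less_square:
  assumes "r < n\<^sup>2" shows "r mod n < n" "r div n < (n::nat)"
proof -
  have "0 < n" using assms by (cases n) auto
  then show "r mod n < n" "r div n < n"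
    using assms by (auto simp: power2_eq_square less_mult_imp_div_less)
qed

lemma vec_of_cols_eq_0D:
  assumes "A \<in> carrier_mat n n" "vec_of_cols A = 0\<^sub>v (n\<^sup>2)"
  shows "A = 0\<^sub>m n n"
proof (rule eq_matI)
  fix i j assume "i < dim_row (0\<^sub>m n n)" "j < dim_col (0\<^sub>m n n)"
  then have ij: "i < n" "j < n" by auto
  have "i + n * j < n * Suc j" using ij by simp
  also have "\<dots> \<le> n\<^sup>2" using ij unfolding power2_eq_square by (intro mult_le_mono2) simp
  finally have r: "i + n * j < n\<^sup>2" .
  then have "vec_of_cols A $ (i + n * j) = A $$ (i, j)"
    using ij by (simp add: vec_of_cols_index[OF assms(1)])
  then show "A $$ (i, j) = 0\<^sub>m n n $$ (i, j)" using assms(2) r ij by simp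
qed (use assms in auto)

lemma mat_eq_of_mult_vec_eq:
  fixes A B :: "real mat"
  assumes "A \<in> carrier_mat m n" "B \<in> carrier_mat m n"
    and "\<And>v. v \<in> carrier_vec n \<Longrightarrow> A *\<^sub>v v = B *\<^sub>v v"
  shows "A = B"
proof (rule eq_matI)
  fix i j assume "i < dim_row B" "j < dim_col B"
  then have ij: "i < m" "j < n" using assms by auto
  have "(A *\<^sub>v unit_vec n j) $ i = (B *\<^sub>v unit_vec n j) $ i" using assms by simp
  then have "row A i \<bullet> unit_vec n j = row B i \<bullet> unit_vec n j" using ij assms(1,2) by simp
  then show "A $$ (i, j) = B $$ (i, j)"
    using ij assms(1,2) by (simp add: scalar_prod_right_unit)
qed (use assms in auto)

text \<open>
  Both the duplication and the elimination matrix express all entries of the members of a linear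
  space \<open>S\<close> of matrices through the entries in the lower triangle: the entry \<open>(i, j)\<close> is either
  the one at \<open>q i j\<close> or zero. The matrix is then a selection matrix, unique because \<^const>\<open>vecs\<close>
  maps \<open>S\<close> onto the whole coordinate space. It is injective, which turns its pseudo-inverse into
  a left inverse.
\<close>

lemma vecs_representation:
  fixes S :: "real mat set"
  assumes bij: "bij_betw vecs S (carrier_vec (lt n))"
    and S: "S \<subseteq> carrier_mat n n" and z: "0\<^sub>m n n \<in> S"
    and q: "\<And>A i j. A \<in> S \<Longrightarrow> i < n \<Longrightarrow> j < n \<Longrightarrow>
      A $$ (i, j) = (if q i j \<in> set (vecs_order n) then A $$ q i j else 0)"
  defines "D \<equiv> THE D. D \<in> carrier_mat (n\<^sup>2) (lt n) \<and> (\<forall>A \<in> S. D *\<^sub>v vecs A = vec_of_cols A)"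
  shows "D \<in> carrier_mat (n\<^sup>2) (lt n)"
    and "\<And>A. A \<in> S \<Longrightarrow> D *\<^sub>v vecs A = vec_of_cols A"
    and "pinv D \<in> carrier_mat (lt n) (n\<^sup>2)"
    and "\<And>A. A \<in> S \<Longrightarrow> pinv D *\<^sub>v vec_of_cols A = vecs A"
proof -
  define E :: "real mat" where
    "E = mat (n\<^sup>2) (lt n) (\<lambda>(r, k). if vecs_order n ! k = q (r mod n) (r div n) then 1 else 0)"
  have E: "E \<in> carrier_mat (n\<^sup>2) (lt n)" by (simp add: E_def)
  have EA: "E *\<^sub>v vecs A = vec_of_cols A" if A: "A \<in> S" for A
  proof (rule eq_vecI)
    have Ac: "A \<in> carrier_mat n n" using A S by blast
    fix r assume "r < dim_vec (vec_of_cols A)"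
    then have r: "r < n\<^sup>2" using vec_of_cols_carrier[OF Ac] by simp
    let ?q = "q (r mod n) (r div n)"
    have *: "(E *\<^sub>v vecs A) $ r =
        (\<Sum>k\<in>{0..<lt n}. if vecs_order n ! k = ?q then A $$ ?q else 0)"
      using r vecs_carrier[OF Ac]
      by (auto simp: E_def scalar_prod_def vecs_index[OF Ac] intro!: sum.cong)
    have "\<dots> = (if ?q \<in> set (vecs_order n) then A $$ ?q else 0)"
    proof (cases "?q \<in> set (vecs_order n)")
      case True
      then obtain l where l: "l < lt n" "?q = vecs_order n ! l"
        by (metis in_set_conv_nth length_vecs_order)
      have "(\<Sum>k\<in>{0..<lt n}. if vecs_order n ! k = ?q then A $$ ?q else 0) =
          (\<Sum>k\<in>{0..<lt n}. if k = l then A $$ ?q else 0)"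
        using l by (intro sum.cong) (auto simp: vecs_order_nth_eq_iff)
      then show ?thesis using True l by simp
    next
      case False
      then show ?thesis
        by (auto intro!: sum.neutral) (metis length_vecs_order nth_mem)
    qed
    also have "\<dots> = A $$ (r mod n, r div n)"
      using q[OF A div_mod_less_square[OF r]] by simp
    finally show "(E *\<^sub>v vecs A) $ r = vec_of_cols A $ r"
      using * by (simp add: vec_of_cols_index[OF Ac r])
  qed (use E A S in \<open>auto simp: vec_of_cols_def power2_eq_square\<close>)
  have ex: "\<exists>A\<in>S. v = vecs A" if "v \<in> carrier_vec (lt n)" for v
    using bij that unfolding bij_betw_def by blast
  have DE: "D = E" unfolding D_def
  proof (rule the_equality)
    fix D' assume D': "D' \<in> carrier_mat (n\<^sup>2) (lt n) \<and> (\<forall>A \<in> S. D' *\<^sub>v vecs A = vec_of_cols A)"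
    show "D' = E"
      by (rule mat_eq_of_mult_vec_eq[of _ "n\<^sup>2" "lt n"]) (use D' E EA ex in force)+
  qed (use E EA in blast)
  show D: "D \<in> carrier_mat (n\<^sup>2) (lt n)" and DA: "\<And>A. A \<in> S \<Longrightarrow> D *\<^sub>v vecs A = vec_of_cols A"
    unfolding DE using E EA by blast+
  have inj: "v = 0\<^sub>v (lt n)" if v: "v \<in> carrier_vec (lt n)" and vz: "D *\<^sub>v v = 0\<^sub>v (n\<^sup>2)" for v
  proof -
    obtain A where A: "A \<in> S" "v = vecs A" using ex[OF v] by blast
    then have "A = 0\<^sub>m n n" using vz DA vec_of_cols_eq_0D S by auto
    then show ?thesis
      using A by (intro eq_vecI) (auto simp: vecs_def elim!: vecs_order_nth)
  qed
  show P: "pinv D \<in> carrier_mat (lt n) (n\<^sup>2)" by (rule pinv_of_injective[OF D inj])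
  fix A assume A: "A \<in> S"
  then have v: "vecs A \<in> carrier_vec (lt n)" using S by auto
  have "pinv D *\<^sub>v vec_of_cols A = (pinv D * D) *\<^sub>v vecs A"
    unfolding DA[OF A, symmetric] using P D v by simp
  also have "pinv D * D = 1\<^sub>m (lt n)" by (rule pinv_of_injective[OF D inj])
  finally show "pinv D *\<^sub>v vec_of_cols A = vecs A" using v by simp
qed

lemma dup_mat_carrier: "dup_mat n \<in> carrier_mat (n\<^sup>2) (lt n)"
  and dup_mat_vecs: "A \<in> sym_mats n \<Longrightarrow> dup_mat n *\<^sub>v vecs A = vec_of_cols A"
  and pinv_dup_mat_carrier: "pinv (dup_mat n) \<in> carrier_mat (lt n) (n\<^sup>2)"
  and pinv_dup_mat: "A \<in> sym_mats n \<Longrightarrow> pinv (dup_mat n) *\<^sub>v vec_of_cols A = vecs A"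
proof -
  have *: "A $$ (i, j) = (if (max i j, min i j) \<in> set (vecs_order n) then A $$ (max i j, min i j) else 0)"
    if "A \<in> sym_mats n" "i < n" "j < n" for A i j
    using sym_mats_index[OF that] that by (auto simp: set_vecs_order max_def min_def)
  have z: "0\<^sub>m n n \<in> sym_mats n" by (simp add: sym_mats_def)
  have S: "sym_mats n \<subseteq> carrier_mat n n" by (auto simp: sym_mats_def)
  note rep = vecs_representation[OF vecs_bij_sym S z *, folded dup_mat_def]
  show "dup_mat n \<in> carrier_mat (n\<^sup>2) (lt n)" "pinv (dup_mat n) \<in> carrier_mat (lt n) (n\<^sup>2)"
    "A \<in> sym_mats n \<Longrightarrow> dup_mat n *\<^sub>v vecs A = vec_of_cols A"
    "A \<in> sym_mats n \<Longrightarrow> pinv (dup_mat n) *\<^sub>v vec_of_cols A = vecs A"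
    by (rule rep; assumption)+
qed

lemma elim_mat_carrier: "elim_mat n \<in> carrier_mat (n\<^sup>2) (lt n)"
  and elim_mat_vecs: "A \<in> lower_mats n \<Longrightarrow> elim_mat n *\<^sub>v vecs A = vec_of_cols A"
  and pinv_elim_mat_carrier: "pinv (elim_mat n) \<in> carrier_mat (lt n) (n\<^sup>2)"
  and pinv_elim_mat: "A \<in> lower_mats n \<Longrightarrow> pinv (elim_mat n) *\<^sub>v vec_of_cols A = vecs A"
proof -
  have *: "A $$ (i, j) = (if (i, j) \<in> set (vecs_order n) then A $$ (i, j) else 0)"
    if "A \<in> lower_mats n" "i < n" "j < n" for A i j
    using lower_mats_zero[OF that(1)] that by (auto simp: set_vecs_order)
  have z: "0\<^sub>m n n \<in> lower_mats n" by (simp add: lower_mats_def)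
  have S: "lower_mats n \<subseteq> carrier_mat n n" by (auto simp: lower_mats_def)
  note rep = vecs_representation[OF vecs_bij_lower S z *, folded elim_mat_def]
  show "elim_mat n \<in> carrier_mat (n\<^sup>2) (lt n)" "pinv (elim_mat n) \<in> carrier_mat (lt n) (n\<^sup>2)"
    "A \<in> lower_mats n \<Longrightarrow> elim_mat n *\<^sub>v vecs A = vec_of_cols A"
    "A \<in> lower_mats n \<Longrightarrow> pinv (elim_mat n) *\<^sub>v vec_of_cols A = vecs A"
    by (rule rep; assumption)+
qed

section \<open>The factors of the compact form as linear maps\<close>

text \<open>
  Kronecker products and column stacking encode index pairs as \<open>s = k n + l\<close>; this lemma undoes the
  encoding in a sum.
\<close>

lemma sum_div_mod:
  fixes g :: "nat \<Rightarrow> nat \<Rightarrow> real"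
  shows "(\<Sum>s\<in>{0..<m * n}. g (s div n) (s mod n)) = (\<Sum>k\<in>{0..<m}. \<Sum>l\<in>{0..<n}. g k l)"
proof (induction m)
  case (Suc m)
  have "(\<Sum>s\<in>{0..<Suc m * n}. g (s div n) (s mod n)) =
      (\<Sum>s\<in>{0..<m * n}. g (s div n) (s mod n)) +
      (\<Sum>s\<in>{m * n..<m * n + n}. g (s div n) (s mod n))"
    by (subst sum.atLeastLessThan_concat) (auto simp: add.commute)
  also have "(\<Sum>s\<in>{m * n..<m * n + n}. g (s div n) (s mod n)) = (\<Sum>l\<in>{0..<n}. g m l)"
    by (subst sum.atLeastLessThan_shift_0) (auto intro!: sum.cong)
  finally show ?case using Suc by simp
qed simp

text \<open>
  The identity that explains the Kronecker products in \<^const>\<open>C_mat\<close> and \<^const>\<open>Delta_mat\<close>: on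
  stacked columns, \<open>B \<otimes> A\<close> acts as \<open>X \<mapsto> A X B\<^sup>T\<close>.
\<close>

lemma kron_mult_vec_of_cols:
  assumes A: "A \<in> carrier_mat n n" and B: "B \<in> carrier_mat n n" and X: "X \<in> carrier_mat n n"
  shows "(B \<otimes>\<^sub>m A) *\<^sub>v vec_of_cols X = vec_of_cols (A * X * B\<^sup>T)"
proof (rule eq_vecI)
  have R: "A * X * B\<^sup>T \<in> carrier_mat n n" using A B X by simp
  fix r assume "r < dim_vec (vec_of_cols (A * X * B\<^sup>T))"
  then have r: "r < n\<^sup>2" using vec_of_cols_carrier[OF R] by simp
  define i j where "i = r mod n" and "j = r div n"
  have ij: "i < n" "j < n" using div_mod_less_square[OF r] by (auto simp: i_def j_def)
  have "((B \<otimes>\<^sub>m A) *\<^sub>v vec_of_cols X) $ r =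
      (\<Sum>s\<in>{0..<n * n}. B $$ (j, s div n) * A $$ (i, s mod n) * X $$ (s mod n, s div n))"
    using r A B X
    by (auto simp: kron_def scalar_prod_def vec_of_cols_def power2_eq_square i_def j_def intro!: sum.cong)
  also have "\<dots> = (\<Sum>k\<in>{0..<n}. \<Sum>l\<in>{0..<n}. B $$ (j, k) * A $$ (i, l) * X $$ (l, k))"
    by (rule sum_div_mod)
  also have "\<dots> = (\<Sum>l\<in>{0..<n}. \<Sum>k\<in>{0..<n}. B $$ (j, k) * A $$ (i, l) * X $$ (l, k))"
    by (rule sum.swap)
  also have "\<dots> = (A * X * B\<^sup>T) $$ (i, j)"
    using A B X ij
    by (auto simp: scalar_prod_def sum_distrib_left sum_distrib_right mult_ac intro!: sum.cong)
  also have "\<dots> = vec_of_cols (A * X * B\<^sup>T) $ r"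
    using vec_of_cols_index[OF R r] by (simp add: i_def j_def)
  finally show "((B \<otimes>\<^sub>m A) *\<^sub>v vec_of_cols X) $ r = vec_of_cols (A * X * B\<^sup>T) $ r" .
qed (use A B X in \<open>auto simp: kron_def vec_of_cols_def\<close>)

lemma kron_carrier: "A \<in> carrier_mat n n \<Longrightarrow> B \<in> carrier_mat n n \<Longrightarrow> A \<otimes>\<^sub>m B \<in> carrier_mat (n\<^sup>2) (n\<^sup>2)"
  by (simp add: kron_def power2_eq_square)

lemma lower_mult_index:
  assumes "L \<in> lower_mats n" "X \<in> carrier_mat n n" "i < n" "j < n"
  shows "(L * X) $$ (i, j) = (\<Sum>k\<in>{0..<Suc i}. L $$ (i, k) * X $$ (k, j))"
proof -
  have "(L * X) $$ (i, j) = (\<Sum>k\<in>{0..<n}. L $$ (i, k) * X $$ (k, j))"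
    using assms lower_mats_carrier[OF assms(1)] by (simp add: scalar_prod_def)
  also have "\<dots> = (\<Sum>k\<in>{0..<Suc i}. L $$ (i, k) * X $$ (k, j))"
    using assms lower_mats_zero[OF assms(1)] by (intro sum.mono_neutral_right) auto
  finally show ?thesis .
qed

lemma lower_mats_mult:
  assumes L: "L \<in> lower_mats n" and X: "X \<in> lower_mats n"
  shows "L * X \<in> lower_mats n"
proof -
  have "(L * X) $$ (i, j) = 0" if "i < n" "j < n" "i < j" for i j
    unfolding lower_mult_index[OF L lower_mats_carrier[OF X] that(1,2)]
    using that lower_mats_zero[OF X] by (intro sum.neutral) auto
  then show ?thesis
    using lower_mats_carrier[OF L] lower_mats_carrier[OF X] by (auto simp: lower_mats_def)
qed

lemma lower_pos_inverse:
  assumes L: "L \<in> lower_pos_mats n"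
  shows "mat_inv L \<in> carrier_mat n n" "L * mat_inv L = 1\<^sub>m n" "mat_inv L * L = 1\<^sub>m n"
proof -
  have Lc: "L \<in> carrier_mat n n" using lower_pos_mats_carrier[OF L] .
  have "det L = prod_list (diag_mat L)"
    using lower_mats_zero[OF lower_pos_mats_lower[OF L]] Lc by (intro det_lower_triangular) auto
  also have "\<dots> \<noteq> 0"
    using lower_pos_mats_pos[OF L] Lc by (fastforce simp: prod_list_zero_iff diag_mat_def)
  finally have "det L \<noteq> 0" .
  then have "L \<in> Units (ring_mat TYPE(real) n ())" by (rule det_non_zero_imp_unit[OF Lc])
  then obtain B where B: "B \<in> carrier_mat n n" "L * B = 1\<^sub>m n" "B * L = 1\<^sub>m n"
    unfolding Units_def ring_mat_def by auto
  then show "mat_inv L \<in> carrier_mat n n" "L * mat_inv L = 1\<^sub>m n" "mat_inv L * L = 1\<^sub>m n"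
    using mat_inv_eq[OF Lc B(1,2)] by simp_all
qed

lemma congruence_sym:
  assumes M: "M \<in> carrier_mat n n" and H: "H \<in> sym_mats n"
  shows "M * H * M\<^sup>T \<in> sym_mats n"
proof -
  note Hc = sym_mats_carrier[OF H]
  have MH: "M * H \<in> carrier_mat n n" and Mt: "M\<^sup>T \<in> carrier_mat n n" using M Hc by simp_all
  have "(M * H * M\<^sup>T)\<^sup>T = M * (H\<^sup>T * M\<^sup>T)"
    using transpose_mult[OF MH Mt] transpose_mult[OF M Hc] by simp
  also have "\<dots> = M * H * M\<^sup>T"
    using H assoc_mult_mat[OF M Hc Mt] by (simp add: sym_mats_def)
  finally show ?thesis using MH Mt by (simp add: sym_mats_def)
qed

lemma C_mat_carrier:
  assumes L: "L \<in> lower_pos_mats n"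
  shows "C_mat L \<in> carrier_mat (lt n) (lt n)"
  using lower_pos_mats_carrier[OF L] pinv_dup_mat_carrier[of n] dup_mat_carrier[of n]
  by (auto simp: C_mat_def Let_def)

lemma C_mat_vecs:
  assumes L: "L \<in> lower_pos_mats n" and S: "S \<in> sym_mats n"
  shows "C_mat L *\<^sub>v vecs S = vecs (mat_inv L * S * (mat_inv L)\<^sup>T)"
proof -
  let ?M = "mat_inv L"
  note M = lower_pos_inverse(1)[OF L] and Sc = sym_mats_carrier[OF S] and KM = kron_carrier[OF M M]
  have R: "?M * S * ?M\<^sup>T \<in> sym_mats n" by (rule congruence_sym[OF M S])
  have "C_mat L *\<^sub>v vecs S = pinv (dup_mat n) *\<^sub>v ((?M \<otimes>\<^sub>m ?M) *\<^sub>v (dup_mat n *\<^sub>v vecs S))"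
    using lower_pos_mats_carrier[OF L] vecs_carrier[OF Sc]
      assoc_mult_mat_vec[OF mult_carrier_mat[OF pinv_dup_mat_carrier KM] dup_mat_carrier vecs_carrier[OF Sc]]
      assoc_mult_mat_vec[OF pinv_dup_mat_carrier KM, of "dup_mat n *\<^sub>v vecs S"]
      mult_mat_vec_carrier[OF dup_mat_carrier vecs_carrier[OF Sc]]
    by (simp add: C_mat_def Let_def)
  also have "\<dots> = vecs (?M * S * ?M\<^sup>T)"
    unfolding dup_mat_vecs[OF S] kron_mult_vec_of_cols[OF M M Sc] pinv_dup_mat[OF R] ..
  finally show ?thesis .
qed

lemma Delta_mat_carrier:
  assumes L: "L \<in> lower_pos_mats n"
  shows "Delta_mat L \<in> carrier_mat (lt n) (lt n)"
  using lower_pos_mats_carrier[OF L] elim_mat_carrier[of n]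
  by (auto simp: Delta_mat_def vecl_jac_def Let_def)

lemma Delta_mat_vecs:
  assumes L: "L \<in> lower_pos_mats n" and X: "X \<in> lower_mats n"
  shows "Delta_mat L *\<^sub>v vecs X = vecl_jac L *\<^sub>v vecs (L * X)"
proof -
  note Lc = lower_pos_mats_carrier[OF L] and Xc = lower_mats_carrier[OF X]
  note KM = kron_carrier[OF one_carrier_mat[of n] Lc]
  have J: "vecl_jac L \<in> carrier_mat (lt n) (lt n)" using Lc by (simp add: vecl_jac_def Let_def)
  have EX: "elim_mat n *\<^sub>v vecs X \<in> carrier_vec (n\<^sup>2)"
    by (rule mult_mat_vec_carrier[OF elim_mat_carrier vecs_carrier[OF Xc]])
  have "Delta_mat L *\<^sub>v vecs X =
      vecl_jac L *\<^sub>v (pinv (elim_mat n) *\<^sub>v ((1\<^sub>m n \<otimes>\<^sub>m L) *\<^sub>v (elim_mat n *\<^sub>v vecs X)))"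
    using Lc
      assoc_mult_mat_vec[OF mult_carrier_mat[OF mult_carrier_mat[OF J pinv_elim_mat_carrier] KM]
        elim_mat_carrier vecs_carrier[OF Xc]]
      assoc_mult_mat_vec[OF mult_carrier_mat[OF J pinv_elim_mat_carrier] KM EX]
      assoc_mult_mat_vec[OF J pinv_elim_mat_carrier mult_mat_vec_carrier[OF KM EX]]
    by (simp add: Delta_mat_def Let_def)
  also have "\<dots> = vecl_jac L *\<^sub>v vecs (L * X)"
    unfolding elim_mat_vecs[OF X] kron_mult_vec_of_cols[OF Lc one_carrier_mat Xc]
    using pinv_elim_mat[OF lower_mats_mult[OF lower_pos_mats_lower[OF L] X]] Lc Xc by simp
  finally show ?thesis .
qed

text \<open>
  On symmetric matrices this inverts the symmetrisation \<open>X \<mapsto> X + X\<^sup>T\<close> of lower triangular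
  matrices, which is why the diagonal is halved.
\<close>

definition lower_half :: "real mat \<Rightarrow> real mat" where
  "lower_half A = mat (dim_row A) (dim_row A)
     (\<lambda>(i, j). if i = j then A $$ (i, j) / 2 else if j < i then A $$ (i, j) else 0)"

lemma lower_half_lower: "A \<in> carrier_mat n n \<Longrightarrow> lower_half A \<in> lower_mats n"
  by (auto simp: lower_half_def lower_mats_def)

lemma Ktilde_vecs:
  assumes A: "A \<in> carrier_mat n n"
  shows "Ktilde n *\<^sub>v vecs A = vecs (lower_half A)"
proof (rule eq_vecI)
  have H: "lower_half A \<in> carrier_mat n n" using A by (simp add: lower_half_def)
  fix k assume "k < dim_vec (vecs (lower_half A))"
  then have k: "k < lt n" using vecs_carrier[OF H] by simp
  obtain i j where ij: "vecs_order n ! k = (i, j)" "j \<le> i" "i < n" using vecs_order_nth[OF k] .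
  have "(Ktilde n *\<^sub>v vecs A) $ k = (if k < n then 1 / 2 else 1) * vecs A $ k"
    unfolding Ktilde_def by (rule diagonal_mult_vec[OF vecs_carrier[OF A] k])
  also have "\<dots> = lower_half A $$ (vecs_order n ! k)"
  proof (cases "k < n")
    case True
    then show ?thesis using A H k
      by (simp add: vecs_index[OF A] vecs_order_nth_diag lower_half_def)
  next
    case False
    then have "j < i" using vecs_order_nth_offdiag[OF _ k ij(1)] by simp
    with False show ?thesis using A H k ij
      by (simp add: vecs_index[OF A] lower_half_def)
  qed
  finally show "(Ktilde n *\<^sub>v vecs A) $ k = vecs (lower_half A) $ k"
    unfolding vecs_index[OF H k] .
qed (use A in \<open>auto simp: Ktilde_def lower_half_def vecs_def\<close>)

section \<open>Cholesky factorisation\<close>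

lemma gram_index:
  assumes L: "L \<in> lower_mats n" and ij: "j \<le> i" "i < n"
  shows "(L * L\<^sup>T) $$ (i, j) = (\<Sum>k\<in>{0..<j}. L $$ (i, k) * L $$ (j, k)) + L $$ (i, j) * L $$ (j, j)"
proof -
  have "(L * L\<^sup>T) $$ (i, j) = (\<Sum>k\<in>{0..<n}. L $$ (i, k) * L $$ (j, k))"
    using lower_mats_carrier[OF L] ij by (simp add: scalar_prod_def)
  also have "\<dots> = (\<Sum>k\<in>{0..<Suc j}. L $$ (i, k) * L $$ (j, k))"
    using ij lower_mats_zero[OF L] by (intro sum.mono_neutral_right) auto
  finally show ?thesis by simp
qed

text \<open>
  Solving the entries of \<open>L L\<^sup>T\<close> for those of \<open>L\<close>, column by column, expresses each entry of
  \<open>L\<close> through the product and the previous columns. Uniqueness of the factor and its continuous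
  dependence on the product both follow from these formulas by induction on the column.
\<close>

lemma cholesky_diag:
  assumes L: "L \<in> lower_pos_mats n" and j: "j < n"
  shows "L $$ (j, j) = sqrt ((L * L\<^sup>T) $$ (j, j) - (\<Sum>k\<in>{0..<j}. L $$ (j, k) * L $$ (j, k)))"
  using lower_pos_mats_pos[OF L j] unfolding gram_index[OF lower_pos_mats_lower[OF L] order_refl j]
  by simp

lemma cholesky_offdiag:
  assumes L: "L \<in> lower_pos_mats n" and ij: "j \<le> i" "i < n"
  shows "L $$ (i, j) =
    ((L * L\<^sup>T) $$ (i, j) - (\<Sum>k\<in>{0..<j}. L $$ (i, k) * L $$ (j, k))) / L $$ (j, j)"
  using lower_pos_mats_pos[OF L, of j] ij unfolding gram_index[OF lower_pos_mats_lower[OF L] ij]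
  by simp

lemma cholesky_unique:
  assumes L: "L \<in> lower_pos_mats n" and M: "M \<in> lower_pos_mats n" and eq: "L * L\<^sup>T = M * M\<^sup>T"
  shows "L = M"
proof (rule lower_mats_eqI[OF lower_pos_mats_lower[OF L] lower_pos_mats_lower[OF M]])
  fix i j :: nat assume "j \<le> i" "i < n"
  then show "L $$ (i, j) = M $$ (i, j)"
  proof (induction j arbitrary: i rule: less_induct)
    case (less j)
    then have prev: "L $$ (i', k) = M $$ (i', k)" if "k < j" "j \<le> i'" "i' < n" for i' k
      using that by simp
    have "L $$ (j, j) = M $$ (j, j)"
      using cholesky_diag[OF L, of j] cholesky_diag[OF M, of j] less.prems prev[of _ j]
      by (simp add: eq)
    then show ?case
      using cholesky_offdiag[OF L less.prems] cholesky_offdiag[OF M less.prems] less.prems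
        prev[of _ i] prev[of _ j]
      by (simp add: eq)
  qed
qed

lemma cholesky_tendsto:
  assumes ev: "\<forall>\<^sub>F s in F. L s \<in> lower_pos_mats n"
    and L0: "L0 \<in> lower_pos_mats n"
    and lim: "\<And>i j. i < n \<Longrightarrow> j < n \<Longrightarrow>
      ((\<lambda>s. (L s * (L s)\<^sup>T) $$ (i, j)) \<longlongrightarrow> (L0 * L0\<^sup>T) $$ (i, j)) F"
    and "j \<le> i" "i < n"
  shows "((\<lambda>s. L s $$ (i, j)) \<longlongrightarrow> L0 $$ (i, j)) F"
  using assms(4,5)
proof (induction j arbitrary: i rule: less_induct)
  case (less j)
  then have prev: "((\<lambda>s. L s $$ (i', k)) \<longlongrightarrow> L0 $$ (i', k)) F" if "k < j" "j \<le> i'" "i' < n" for i' k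
    using that by simp
  have j: "j < n" using less.prems by simp
  have "((\<lambda>s. sqrt ((L s * (L s)\<^sup>T) $$ (j, j) - (\<Sum>k\<in>{0..<j}. L s $$ (j, k) * L s $$ (j, k))))
      \<longlongrightarrow> sqrt ((L0 * L0\<^sup>T) $$ (j, j) - (\<Sum>k\<in>{0..<j}. L0 $$ (j, k) * L0 $$ (j, k)))) F"
    by (intro tendsto_intros lim j prev) (use j in auto)
  then have diag: "((\<lambda>s. L s $$ (j, j)) \<longlongrightarrow> L0 $$ (j, j)) F"
    unfolding cholesky_diag[OF L0 j, symmetric]
    by (rule Lim_transform_eventually)
      (use ev in eventually_elim, simp only: cholesky_diag[OF _ j, symmetric])
  have "((\<lambda>s. ((L s * (L s)\<^sup>T) $$ (i, j) - (\<Sum>k\<in>{0..<j}. L s $$ (i, k) * L s $$ (j, k))) / L s $$ (j, j))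
      \<longlongrightarrow> ((L0 * L0\<^sup>T) $$ (i, j) - (\<Sum>k\<in>{0..<j}. L0 $$ (i, k) * L0 $$ (j, k))) / L0 $$ (j, j)) F"
    by (intro tendsto_intros lim j prev diag)
      (use less.prems lower_pos_mats_pos[OF L0 j] in auto)
  then show ?case
    unfolding cholesky_offdiag[OF L0 less.prems, symmetric]
    by (rule Lim_transform_eventually)
      (use ev in eventually_elim, simp only: cholesky_offdiag[OF _ less.prems, symmetric])
qed

lemma quadratic_form:
  fixes v :: "real vec"
  assumes "A \<in> carrier_mat n n" "v \<in> carrier_vec n"
  shows "v \<bullet> (A *\<^sub>v v) = (\<Sum>i\<in>{0..<n}. \<Sum>j\<in>{0..<n}. v $ i * A $$ (i, j) * v $ j)"
  using assms by (auto simp: scalar_prod_def sum_distrib_left mult_ac intro!: sum.cong)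

lemma gram_quadratic_form:
  fixes v :: "real vec"
  assumes "L \<in> carrier_mat n n" "v \<in> carrier_vec n"
  shows "v \<bullet> (L * L\<^sup>T *\<^sub>v v) = (L\<^sup>T *\<^sub>v v) \<bullet> (L\<^sup>T *\<^sub>v v)"
proof -
  have t: "L\<^sup>T \<in> carrier_mat n n" using assms by simp
  show ?thesis
    using transpose_vec_mult_scalar[OF assms(1) mult_mat_vec_carrier[OF t assms(2)] assms(2)]
    by (simp add: assoc_mult_mat_vec[OF assms(1) t assms(2)])
qed

lemma scalar_prod_self_pos:
  fixes v :: "real vec"
  assumes "v \<in> carrier_vec n" "v \<noteq> 0\<^sub>v n"
  shows "0 < v \<bullet> v"
proof -
  have "0 \<le> v \<bullet> v" by (simp add: scalar_prod_def sum_nonneg)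
  then show ?thesis using scalar_prod_self_eq_0D[OF assms(1)] assms(2) by fastforce
qed

text \<open>
  Recovers \<open>v\<close> from \<open>w = L\<^sup>T v\<close>, the substitution that turns the quadratic form of
  \<open>L L\<^sup>T\<close> into \<open>w \<bullet> w\<close>.
\<close>

lemma transpose_inverse_mult_vec:
  assumes L: "L \<in> lower_pos_mats n" and v: "v \<in> carrier_vec n"
  shows "(mat_inv L)\<^sup>T *\<^sub>v (L\<^sup>T *\<^sub>v v) = v"
proof -
  note Lc = lower_pos_mats_carrier[OF L] and M = lower_pos_inverse[OF L]
  have t: "L\<^sup>T \<in> carrier_mat n n" "(mat_inv L)\<^sup>T \<in> carrier_mat n n" using Lc M by simp_all
  have "(mat_inv L)\<^sup>T * L\<^sup>T = 1\<^sub>m n" using transpose_mult[OF Lc M(1)] M(2) by simp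
  then show ?thesis unfolding assoc_mult_mat_vec[OF t(2,1) v, symmetric] using v by simp
qed

lemma gram_sym: "L \<in> carrier_mat n n \<Longrightarrow> L * L\<^sup>T \<in> sym_mats n"
  using transpose_mult[of L n n "L\<^sup>T" n] by (simp add: sym_mats_def)

lemma gram_spd:
  assumes L: "L \<in> lower_pos_mats n"
  shows "L * L\<^sup>T \<in> spd_mats n"
proof -
  note Lc = lower_pos_mats_carrier[OF L] and M = lower_pos_inverse[OF L]
  have "0 < v \<bullet> (L * L\<^sup>T *\<^sub>v v)" if v: "v \<in> carrier_vec n" "v \<noteq> 0\<^sub>v n" for v
  proof -
    have w: "L\<^sup>T *\<^sub>v v \<in> carrier_vec n" using Lc v by simp
    have "L\<^sup>T *\<^sub>v v \<noteq> 0\<^sub>v n"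
    proof
      assume "L\<^sup>T *\<^sub>v v = 0\<^sub>v n"
      then have "v = (mat_inv L)\<^sup>T *\<^sub>v 0\<^sub>v n" using transpose_inverse_mult_vec[OF L v(1)] by simp
      also have "\<dots> = 0\<^sub>v n" using M(1) by auto
      finally show False using v(2) by simp
    qed
    then show ?thesis
      unfolding gram_quadratic_form[OF Lc v(1)] by (rule scalar_prod_self_pos[OF w])
  qed
  then show ?thesis using gram_sym[OF Lc] by (simp add: spd_mats_def)
qed

text \<open>
  For the induction step of the factorisation: \<open>t = 0\<close> shows that the leading block of a positive
  definite matrix is positive definite, and \<open>t = - 1\<close> that the Schur complement of this block is positive.
\<close>

lemma bordered_quadratic_form:
  fixes P :: "real mat"
  assumes P: "P \<in> sym_mats (Suc n)" and u: "u \<in> carrier_vec n"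
  shows "vec (Suc n) (\<lambda>i. if i < n then u $ i else t) \<bullet>
      (P *\<^sub>v vec (Suc n) (\<lambda>i. if i < n then u $ i else t)) =
    u \<bullet> (mat n n (\<lambda>(i, j). P $$ (i, j)) *\<^sub>v u) +
    2 * t * (u \<bullet> vec n (\<lambda>i. P $$ (i, n))) + t\<^sup>2 * P $$ (n, n)"
proof -
  let ?v = "vec (Suc n) (\<lambda>i. if i < n then u $ i else t)"
  have "?v \<bullet> (P *\<^sub>v ?v) = (\<Sum>i\<in>{0..<Suc n}. \<Sum>j\<in>{0..<Suc n}. ?v $ i * P $$ (i, j) * ?v $ j)"
    by (rule quadratic_form[OF sym_mats_carrier[OF P]]) simp
  also have "\<dots> = (\<Sum>i\<in>{0..<n}. \<Sum>j\<in>{0..<n}. u $ i * P $$ (i, j) * u $ j) +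
      (\<Sum>i\<in>{0..<n}. u $ i * P $$ (i, n) * t) + (\<Sum>j\<in>{0..<n}. t * P $$ (n, j) * u $ j) +
      t * P $$ (n, n) * t"
    by (simp add: sum.distrib)
  also have "(\<Sum>j\<in>{0..<n}. t * P $$ (n, j) * u $ j) = (\<Sum>i\<in>{0..<n}. u $ i * P $$ (i, n) * t)"
    using sym_mats_index[OF P] by (intro sum.cong) auto
  also have "(\<Sum>i\<in>{0..<n}. u $ i * P $$ (i, n) * t) = t * (u \<bullet> vec n (\<lambda>i. P $$ (i, n)))"
    using u by (auto simp: scalar_prod_def sum_distrib_left mult_ac intro!: sum.cong)
  also have "(\<Sum>i\<in>{0..<n}. \<Sum>j\<in>{0..<n}. u $ i * P $$ (i, j) * u $ j) =
      u \<bullet> (mat n n (\<lambda>(i, j). P $$ (i, j)) *\<^sub>v u)"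
    by (subst quadratic_form[of _ n]) (use u in auto)
  finally show ?thesis by (simp add: power2_eq_square)
qed

text \<open>
  Induction on the size. If the leading block \<open>A\<close> has factor \<open>L0\<close> and the last column is \<open>b\<close>
  above \<open>d\<close>, then the new row of the factor is \<open>w = L0\<^sup>-\<^sup>1 b\<close> followed by
  \<open>sqrt (d - w \<bullet> w)\<close>. The radicand is the value of the quadratic form at \<open>(A\<^sup>-\<^sup>1 b, - 1)\<close>.
\<close>

lemma cholesky_exists: "P \<in> spd_mats n \<Longrightarrow> \<exists>L\<in>lower_pos_mats n. L * L\<^sup>T = P"
proof (induction n arbitrary: P)
  case 0
  then show ?case
    by (intro bexI[of _ P] eq_matI) (auto simp: spd_mats_def sym_mats_def lower_pos_mats_def lower_mats_def)
next
  case (Suc n)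
  have P: "P \<in> sym_mats (Suc n)" and pos: "\<And>v. v \<in> carrier_vec (Suc n) \<Longrightarrow> v \<noteq> 0\<^sub>v (Suc n) \<Longrightarrow> 0 < v \<bullet> (P *\<^sub>v v)"
    using Suc.prems by (auto simp: spd_mats_def)
  define A where "A = mat n n (\<lambda>(i, j). P $$ (i, j))"
  define b where "b = vec n (\<lambda>i. P $$ (i, n))"
  define d where "d = P $$ (n, n)"
  note form = bordered_quadratic_form[OF P, folded A_def b_def d_def]
  have b: "b \<in> carrier_vec n" by (simp add: b_def)
  have "A \<in> spd_mats n"
  proof -
    have "A \<in> sym_mats n"
      by (rule sym_matsI) (auto simp: A_def intro: sym_mats_index[OF P])
    moreover have "0 < u \<bullet> (A *\<^sub>v u)" if u: "u \<in> carrier_vec n" "u \<noteq> 0\<^sub>v n" for u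
    proof -
      let ?v = "vec (Suc n) (\<lambda>i. if i < n then u $ i else 0)"
      have "?v \<noteq> 0\<^sub>v (Suc n)"
      proof
        assume v: "?v = 0\<^sub>v (Suc n)"
        have "u $ i = 0" if "i < n" for i
          using arg_cong[OF v, of "\<lambda>x. x $ i"] that by simp
        then show False using u by (auto intro!: eq_vecI)
      qed
      then have "0 < ?v \<bullet> (P *\<^sub>v ?v)" by (intro pos) auto
      then show ?thesis unfolding form[OF u(1)] by simp
    qed
    ultimately show ?thesis by (simp add: spd_mats_def)
  qed
  then obtain L0 where L0: "L0 \<in> lower_pos_mats n" and A: "L0 * L0\<^sup>T = A" using Suc.IH by blast
  note Lc = lower_pos_mats_carrier[OF L0] and M = lower_pos_inverse[OF L0]
  define w where "w = mat_inv L0 *\<^sub>v b"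
  (* x = A^-1 b, so (x, -1) minimises the form among the vectors with last entry -1. *)
  define x where "x = (mat_inv L0)\<^sup>T *\<^sub>v w"
  have Mt: "(mat_inv L0)\<^sup>T \<in> carrier_mat n n" and Lt: "L0\<^sup>T \<in> carrier_mat n n" using M Lc by simp_all
  have w: "w \<in> carrier_vec n" using M b by (simp add: w_def)
  have x: "x \<in> carrier_vec n" using Mt w by (simp add: x_def)
  have L0w: "L0 *\<^sub>v w = b"
    unfolding w_def assoc_mult_mat_vec[OF Lc M(1) b, symmetric] M(2) using b by simp
  have "L0\<^sup>T * (mat_inv L0)\<^sup>T = 1\<^sub>m n" using transpose_mult[OF M(1) Lc] M(3) by simp
  then have "L0\<^sup>T *\<^sub>v x = w"
    unfolding x_def assoc_mult_mat_vec[OF Lt Mt w, symmetric] using w by simp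
  then have Ax: "A *\<^sub>v x = b"
    unfolding A[symmetric] assoc_mult_mat_vec[OF Lc Lt x] using L0w by simp
  have xb: "x \<bullet> b = w \<bullet> w"
    unfolding x_def transpose_vec_mult_scalar[OF M(1) b w] by (simp add: w_def)
  have "0 < d - w \<bullet> w"
  proof -
    let ?v = "vec (Suc n) (\<lambda>i. if i < n then x $ i else - 1)"
    have "?v \<noteq> 0\<^sub>v (Suc n)"
    proof
      assume v: "?v = 0\<^sub>v (Suc n)"
      show False using arg_cong[OF v, of "\<lambda>x. x $ n"] by simp
    qed
    then have "0 < ?v \<bullet> (P *\<^sub>v ?v)" by (intro pos) auto
    then show ?thesis unfolding form[OF x] Ax xb by simp
  qed
  define L where "L = mat (Suc n) (Suc n) (\<lambda>(i, j).
    if i < n then if j < n then L0 $$ (i, j) else 0 else if j < n then w $ j else sqrt (d - w \<bullet> w))"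
  have L: "L \<in> lower_pos_mats (Suc n)"
    using lower_pos_mats_pos[OF L0] lower_mats_zero[OF lower_pos_mats_lower[OF L0]] \<open>0 < d - w \<bullet> w\<close>
    by (auto simp: lower_pos_mats_def lower_mats_def L_def less_Suc_eq)
  note Lc' = lower_pos_mats_carrier[OF L]
  have ind: "(L * L\<^sup>T) $$ (i, j) = (\<Sum>k\<in>{0..<n}. L $$ (i, k) * L $$ (j, k)) + L $$ (i, n) * L $$ (j, n)"
    if "i < Suc n" "j < Suc n" for i j
    using that Lc' by (simp add: scalar_prod_def)
  have old: "(L * L\<^sup>T) $$ (i, j) = P $$ (i, j)" if "i < n" "j < n" for i j
  proof -
    have "(L * L\<^sup>T) $$ (i, j) = (\<Sum>k\<in>{0..<n}. L0 $$ (i, k) * L0 $$ (j, k))"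
      using that by (subst ind) (auto simp: L_def intro!: sum.cong)
    also have "\<dots> = (L0 * L0\<^sup>T) $$ (i, j)" using that Lc by (simp add: scalar_prod_def)
    also have "\<dots> = P $$ (i, j)" unfolding A using that by (simp add: A_def)
    finally show ?thesis .
  qed
  have new: "(L * L\<^sup>T) $$ (i, n) = P $$ (i, n)" if "i < n" for i
  proof -
    have "(L * L\<^sup>T) $$ (i, n) = (\<Sum>k\<in>{0..<n}. L0 $$ (i, k) * w $ k)"
      using that by (subst ind) (auto simp: L_def intro!: sum.cong)
    also have "\<dots> = (L0 *\<^sub>v w) $ i" using that Lc w by (simp add: scalar_prod_def)
    also have "\<dots> = P $$ (i, n)" unfolding L0w using that by (simp add: b_def)
    finally show ?thesis .
  qed
  have corner: "(L * L\<^sup>T) $$ (n, n) = P $$ (n, n)"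
  proof -
    have "(L * L\<^sup>T) $$ (n, n) = (\<Sum>k\<in>{0..<n}. w $ k * w $ k) + (d - w \<bullet> w)"
      using \<open>0 < d - w \<bullet> w\<close> by (subst ind) (auto simp: L_def intro!: sum.cong)
    also have "(\<Sum>k\<in>{0..<n}. w $ k * w $ k) = w \<bullet> w" using w by (simp add: scalar_prod_def)
    finally show ?thesis by (simp add: d_def)
  qed
  have "L * L\<^sup>T = P"
  proof (rule eq_matI)
    fix i j assume "i < dim_row P" "j < dim_col P"
    then have "i < Suc n" "j < Suc n" using sym_mats_carrier[OF P] by auto
    then show "(L * L\<^sup>T) $$ (i, j) = P $$ (i, j)"
      using old new corner sym_mats_index[OF gram_sym[OF Lc'], of n j] sym_mats_index[OF P, of n j]
      by (auto simp: less_Suc_eq simp del: index_mult_mat(1))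
  qed (use Lc' sym_mats_carrier[OF P] in auto)
  with L show ?case by blast
qed

lemma chol_gram: "L \<in> lower_pos_mats n \<Longrightarrow> chol (L * L\<^sup>T) = L"
  unfolding chol_def
  by (rule the_equality) (auto dest: lower_pos_mats_carrier cholesky_unique)

lemma chol_lower_pos: "P \<in> spd_mats n \<Longrightarrow> chol P \<in> lower_pos_mats n"
  and chol_mult_transpose: "P \<in> spd_mats n \<Longrightarrow> chol P * (chol P)\<^sup>T = P"
  using cholesky_exists[of P n] chol_gram by auto

section \<open>The Frobenius norm\<close>

lemma frob_norm_nonneg: "0 \<le> frob_norm A"
  by (simp add: frob_norm_def sum_nonneg)

lemma frob_norm_L2_set:
  "A \<in> carrier_mat n n \<Longrightarrow> frob_norm A = L2_set (\<lambda>p. A $$ p) ({..<n} \<times> {..<n})"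
  by (auto simp: frob_norm_def L2_set_def sum.cartesian_product case_prod_beta')

lemma frob_norm_add:
  assumes "A \<in> carrier_mat n n" "B \<in> carrier_mat n n"
  shows "frob_norm (A + B) \<le> frob_norm A + frob_norm B"
proof -
  have "frob_norm (A + B) = L2_set (\<lambda>p. A $$ p + B $$ p) ({..<n} \<times> {..<n})"
    using assms by (subst frob_norm_L2_set[of _ n]) (auto intro!: L2_set_cong)
  then show ?thesis
    using L2_set_triangle_ineq assms by (simp add: frob_norm_L2_set)
qed

lemma frob_norm_mono:
  assumes "A \<in> carrier_mat n n" "B \<in> carrier_mat n n"
    and "\<And>i j. i < n \<Longrightarrow> j < n \<Longrightarrow> \<bar>A $$ (i, j)\<bar> \<le> \<bar>B $$ (i, j)\<bar>"
  shows "frob_norm A \<le> frob_norm B"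
  using assms by (auto simp: frob_norm_def abs_le_square_iff intro!: sum_mono)

lemma frob_norm_uminus: "A \<in> carrier_mat n n \<Longrightarrow> frob_norm (- A) = frob_norm A"
  by (intro antisym frob_norm_mono[of _ n]) auto

lemma frob_norm_diff:
  assumes "A \<in> carrier_mat n n" "B \<in> carrier_mat n n"
  shows "frob_norm (A - B) \<le> frob_norm A + frob_norm B"
  using frob_norm_add[of A n "- B"] assms
  by (simp add: frob_norm_uminus add_uminus_minus_mat[symmetric])

lemma frob_norm_smult: "frob_norm (a \<cdot>\<^sub>m A) = \<bar>a\<bar> * frob_norm A"
  by (simp add: frob_norm_def power_mult_distrib sum_distrib_left[symmetric] real_sqrt_mult)

lemma frob_norm_transpose: "frob_norm A\<^sup>T = frob_norm A"
  unfolding frob_norm_def by (subst sum.swap) simp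

lemma abs_index_le_frob_norm:
  assumes "A \<in> carrier_mat n n" "i < n" "j < n"
  shows "\<bar>A $$ (i, j)\<bar> \<le> frob_norm A"
  using member_le_L2_set[of "{..<n} \<times> {..<n}" "(i, j)" "\<lambda>p. \<bar>A $$ p\<bar>"] assms
  by (simp add: frob_norm_L2_set L2_set_def)

lemma frob_norm_eq_0D:
  assumes "A \<in> carrier_mat n n" "frob_norm A \<le> 0"
  shows "A = 0\<^sub>m n n"
  using assms abs_index_le_frob_norm[OF assms(1)] by (intro eq_matI) (auto, force)

lemma frob_norm_mult:
  assumes A: "A \<in> carrier_mat n n" and B: "B \<in> carrier_mat n n"
  shows "frob_norm (A * B) \<le> frob_norm A * frob_norm B"
proof -
  have "(\<Sum>i<n. \<Sum>j<n. ((A * B) $$ (i, j))\<^sup>2) \<le>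
      (\<Sum>i<n. \<Sum>j<n. (\<Sum>k<n. (A $$ (i, k))\<^sup>2) * (\<Sum>k<n. (B $$ (k, j))\<^sup>2))"
  proof (intro sum_mono)
    fix i j assume "i \<in> {..<n}" "j \<in> {..<n}"
    then have "(A * B) $$ (i, j) = (\<Sum>k<n. A $$ (i, k) * B $$ (k, j))"
      using A B by (simp add: scalar_prod_def atLeast0LessThan)
    then show "((A * B) $$ (i, j))\<^sup>2 \<le> (\<Sum>k<n. (A $$ (i, k))\<^sup>2) * (\<Sum>k<n. (B $$ (k, j))\<^sup>2)"
      using Cauchy_Schwarz_ineq_sum[of "\<lambda>k. A $$ (i, k)" "\<lambda>k. B $$ (k, j)" "{..<n}"] by simp
  qed
  also have "\<dots> = (\<Sum>i<n. \<Sum>k<n. (A $$ (i, k))\<^sup>2) * (\<Sum>j<n. \<Sum>k<n. (B $$ (k, j))\<^sup>2)"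
    by (simp add: sum_product)
  also have "(\<Sum>j<n. \<Sum>k<n. (B $$ (k, j))\<^sup>2) = (\<Sum>k<n. \<Sum>j<n. (B $$ (k, j))\<^sup>2)"
    by (rule sum.swap)
  finally have "(\<Sum>i<n. \<Sum>j<n. ((A * B) $$ (i, j))\<^sup>2) \<le>
      (\<Sum>i<n. \<Sum>k<n. (A $$ (i, k))\<^sup>2) * (\<Sum>k<n. \<Sum>j<n. (B $$ (k, j))\<^sup>2)" .
  from real_sqrt_le_mono[OF this] show ?thesis
    using A B by (simp add: frob_norm_def real_sqrt_mult del: index_mult_mat(1))
qed

lemma frob_norm_congruence:
  assumes "M \<in> carrier_mat n n" "H \<in> carrier_mat n n"
  shows "frob_norm (M * H * M\<^sup>T) \<le> (frob_norm M)\<^sup>2 * frob_norm H"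
proof -
  have "frob_norm (M * H * M\<^sup>T) \<le> frob_norm (M * H) * frob_norm M\<^sup>T"
    using assms by (intro frob_norm_mult) auto
  also have "\<dots> \<le> (frob_norm M * frob_norm H) * frob_norm M"
    unfolding frob_norm_transpose using assms by (intro mult_right_mono frob_norm_mult frob_norm_nonneg)
  finally show ?thesis by (simp add: power2_eq_square mult_ac)
qed

lemma frob_norm_tendsto_0:
  assumes "\<forall>\<^sub>F s in F. A s \<in> carrier_mat n n"
    and "\<And>i j. i < n \<Longrightarrow> j < n \<Longrightarrow> ((\<lambda>s. A s $$ (i, j)) \<longlongrightarrow> 0) F"
  shows "((\<lambda>s. frob_norm (A s)) \<longlongrightarrow> 0) F"
proof -
  have "((\<lambda>s. sqrt (\<Sum>i<n. \<Sum>j<n. (A s $$ (i, j))\<^sup>2)) \<longlongrightarrow> sqrt (\<Sum>i<n. \<Sum>j<n. 0\<^sup>2)) F"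
    by (intro tendsto_intros assms(2)) auto
  then have "((\<lambda>s. sqrt (\<Sum>i<n. \<Sum>j<n. (A s $$ (i, j))\<^sup>2)) \<longlongrightarrow> 0) F" by simp
  then show ?thesis
    by (rule Lim_transform_eventually) (use assms(1) in eventually_elim, auto simp: frob_norm_def)
qed

text \<open>
  The factor \<open>n\<close> is far from sharp, but any bound by a multiple of the norm suffices to keep small
  perturbations of a positive definite matrix positive definite.
\<close>

lemma abs_quadratic_form_le:
  fixes w :: "real vec"
  assumes A: "A \<in> carrier_mat n n" and w: "w \<in> carrier_vec n"
  shows "\<bar>w \<bullet> (A *\<^sub>v w)\<bar> \<le> real n * frob_norm A * (w \<bullet> w)"
proof -
  have "\<bar>w \<bullet> (A *\<^sub>v w)\<bar> \<le> (\<Sum>i\<in>{0..<n}. \<Sum>j\<in>{0..<n}. \<bar>w $ i * A $$ (i, j) * w $ j\<bar>)"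
    unfolding quadratic_form[OF A w]
    by (rule order_trans[OF sum_abs]) (intro sum_mono sum_abs)
  also have "\<dots> \<le> (\<Sum>i\<in>{0..<n}. \<Sum>j\<in>{0..<n}. frob_norm A * ((w $ i)\<^sup>2 + (w $ j)\<^sup>2) / 2)"
  proof (intro sum_mono)
    fix i j assume ij: "i \<in> {0..<n}" "j \<in> {0..<n}"
    have "0 \<le> (\<bar>w $ i\<bar> - \<bar>w $ j\<bar>)\<^sup>2" by simp
    then have *: "\<bar>w $ i\<bar> * \<bar>w $ j\<bar> \<le> ((w $ i)\<^sup>2 + (w $ j)\<^sup>2) / 2"
      by (simp add: power2_diff)
    have "\<bar>w $ i * A $$ (i, j) * w $ j\<bar> = \<bar>A $$ (i, j)\<bar> * (\<bar>w $ i\<bar> * \<bar>w $ j\<bar>)"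
      by (simp add: abs_mult)
    also have "\<dots> \<le> frob_norm A * (((w $ i)\<^sup>2 + (w $ j)\<^sup>2) / 2)"
      using ij by (intro mult_mono * abs_index_le_frob_norm[OF A] frob_norm_nonneg) auto
    finally show "\<bar>w $ i * A $$ (i, j) * w $ j\<bar> \<le> frob_norm A * ((w $ i)\<^sup>2 + (w $ j)\<^sup>2) / 2" by simp
  qed
  also have "\<dots> = real n * frob_norm A * (\<Sum>i\<in>{0..<n}. (w $ i)\<^sup>2)"
    by (simp add: sum_distrib_left[symmetric] sum_divide_distrib[symmetric] sum.distrib)
  also have "(\<Sum>i\<in>{0..<n}. (w $ i)\<^sup>2) = w \<bullet> w"
    using w by (simp add: scalar_prod_def power2_eq_square)
  finally show ?thesis .
qed

section \<open>The differential of the Cholesky factor\<close>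

text \<open>
  This will turn out to be the differential of \<^const>\<open>chol\<close> at \<open>L L\<^sup>T\<close> in direction \<open>H\<close>.
  It is defined through the factor \<open>L\<close>, so that its algebra needs no reference to \<^const>\<open>chol\<close>.
\<close>

definition chol_deriv :: "real mat \<Rightarrow> real mat \<Rightarrow> real mat" where
  "chol_deriv L H = L * lower_half (mat_inv L * H * (mat_inv L)\<^sup>T)"

lemma lower_half_carrier: "A \<in> carrier_mat n n \<Longrightarrow> lower_half A \<in> carrier_mat n n"
  by (simp add: lower_half_def)

lemma lower_half_add:
  "A \<in> carrier_mat n n \<Longrightarrow> B \<in> carrier_mat n n \<Longrightarrow> lower_half (A + B) = lower_half A + lower_half B"
  by (intro eq_matI) (auto simp: lower_half_def add_divide_distrib)

lemma lower_half_smult: "A \<in> carrier_mat n n \<Longrightarrow> lower_half (a \<cdot>\<^sub>m A) = a \<cdot>\<^sub>m lower_half A"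
  by (intro eq_matI) (auto simp: lower_half_def)

lemma frob_norm_lower_half: "A \<in> carrier_mat n n \<Longrightarrow> frob_norm (lower_half A) \<le> frob_norm A"
  by (intro frob_norm_mono[of _ n]) (auto simp: lower_half_def)

lemma lower_half_add_transpose:
  assumes "X \<in> lower_mats n"
  shows "lower_half (X + X\<^sup>T) = X"
  using lower_mats_carrier[OF assms] lower_mats_zero[OF assms]
  by (intro eq_matI) (auto simp: lower_half_def)

lemma lower_half_symmetrise:
  assumes "S \<in> sym_mats n"
  shows "lower_half S + (lower_half S)\<^sup>T = S"
  using sym_mats_carrier[OF assms] sym_mats_index[OF assms]
  by (intro eq_matI) (auto simp: lower_half_def)

text \<open>
  Forward substitution in \<open>L L\<^sup>-\<^sup>1 = 1\<close>.
\<close>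

lemma lower_pos_inverse_lower:
  assumes L: "L \<in> lower_pos_mats n"
  shows "mat_inv L \<in> lower_mats n"
proof -
  note M = lower_pos_inverse[OF L]
  have "mat_inv L $$ (i, j) = 0" if "i < j" "j < n" for i j
    using that
  proof (induction i rule: less_induct)
    case (less i)
    then have i: "i < n" by simp
    have "0 = (L * mat_inv L) $$ (i, j)" unfolding M(2) using less.prems by simp
    also have "\<dots> = (\<Sum>k\<in>{0..<Suc i}. L $$ (i, k) * mat_inv L $$ (k, j))"
      by (rule lower_mult_index[OF lower_pos_mats_lower[OF L] M(1) i less.prems(2)])
    also have "\<dots> = L $$ (i, i) * mat_inv L $$ (i, j)"
      using less by simp
    finally show ?case using lower_pos_mats_pos[OF L i] by simp
  qed
  with M(1) show ?thesis by (simp add: lower_mats_def)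
qed

lemma mult_gram:
  assumes "M \<in> carrier_mat n n" "A \<in> carrier_mat n n"
  shows "(M * A) * (M * A)\<^sup>T = M * (A * A\<^sup>T) * (M\<^sup>T :: real mat)"
proof -
  have t: "A\<^sup>T \<in> carrier_mat n n" "M\<^sup>T \<in> carrier_mat n n" "M * A \<in> carrier_mat n n" using assms by simp_all
  show ?thesis
    unfolding transpose_mult[OF assms] assoc_mult_mat[OF t(3,1,2), symmetric]
      assoc_mult_mat[OF assms t(1)] ..
qed

text \<open>
  With \<open>w = L\<^sup>T v\<close>, the quadratic form of \<open>L L\<^sup>T + H\<close> at \<open>v\<close> is \<open>w \<bullet> w\<close> plus the form
  of \<open>L\<^sup>-\<^sup>1 H L\<^sup>-\<^sup>T\<close> at \<open>w\<close>, and the second term is too small to cancel the first.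
\<close>

lemma spd_add:
  assumes L: "L \<in> lower_pos_mats n" and H: "H \<in> sym_mats n"
    and small: "real n * frob_norm (mat_inv L * H * (mat_inv L)\<^sup>T) < 1"
  shows "L * L\<^sup>T + H \<in> spd_mats n"
proof -
  let ?M = "mat_inv L"
  note Lc = lower_pos_mats_carrier[OF L] and M = lower_pos_inverse[OF L] and Hc = sym_mats_carrier[OF H]
  have Mt: "?M\<^sup>T \<in> carrier_mat n n" and MH: "?M * H \<in> carrier_mat n n" and LL: "L * L\<^sup>T \<in> carrier_mat n n"
    using M Lc Hc by simp_all
  have "L * L\<^sup>T + H \<in> sym_mats n"
    using gram_sym[OF Lc] H transpose_add[OF LL Hc] by (simp add: sym_mats_def)
  moreover have "0 < v \<bullet> ((L * L\<^sup>T + H) *\<^sub>v v)" if v: "v \<in> carrier_vec n" "v \<noteq> 0\<^sub>v n" for v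
  proof -
    define w where "w = L\<^sup>T *\<^sub>v v"
    have w: "w \<in> carrier_vec n" using Lc v by (simp add: w_def)
    have Mw: "?M\<^sup>T *\<^sub>v w = v" unfolding w_def by (rule transpose_inverse_mult_vec[OF L v(1)])
    have Hv: "H *\<^sub>v v \<in> carrier_vec n" using Hc v by simp
    have "w \<noteq> 0\<^sub>v n" using Mw Mt v by auto
    then have ww: "0 < w \<bullet> w" by (rule scalar_prod_self_pos[OF w])
    have "w \<bullet> (?M * H * ?M\<^sup>T *\<^sub>v w) = w \<bullet> (?M *\<^sub>v (H *\<^sub>v v))"
      unfolding assoc_mult_mat_vec[OF MH Mt w] Mw assoc_mult_mat_vec[OF M(1) Hc v(1)] ..
    also have "\<dots> = v \<bullet> (H *\<^sub>v v)"
      using transpose_vec_mult_scalar[OF M(1) Hv w] unfolding Mw by simp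
    finally have "\<bar>v \<bullet> (H *\<^sub>v v)\<bar> \<le> real n * frob_norm (?M * H * ?M\<^sup>T) * (w \<bullet> w)"
      using abs_quadratic_form_le[OF _ w, of "?M * H * ?M\<^sup>T"] mult_carrier_mat[OF MH Mt] by simp
    also have "\<dots> < w \<bullet> w" using mult_strict_right_mono[OF small ww] by simp
    finally have "0 < w \<bullet> w + v \<bullet> (H *\<^sub>v v)" by linarith
    also have "\<dots> = v \<bullet> ((L * L\<^sup>T + H) *\<^sub>v v)"
      unfolding add_mult_distrib_mat_vec[OF LL Hc v(1)]
      using scalar_prod_add_distrib[OF v(1) mult_mat_vec_carrier[OF LL v(1)] Hv]
        gram_quadratic_form[OF Lc v(1)] by (simp add: w_def)
    finally show ?thesis .
  qed
  ultimately show ?thesis by (simp add: spd_mats_def)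
qed

text \<open>
  Write \<open>L' = L (1 + X)\<close>. Multiplying the factorisation of \<open>L L\<^sup>T + H\<close> by \<open>L\<^sup>-\<^sup>1\<close> from
  the left and \<open>L\<^sup>-\<^sup>T\<close> from the right gives \<open>X + X\<^sup>T + X X\<^sup>T = L\<^sup>-\<^sup>1 H L\<^sup>-\<^sup>T\<close>, so \<open>X\<close> differs
  from the lower half of the right-hand side by the lower half of \<open>X X\<^sup>T\<close>. Both estimates
  follow. The first becomes linear in \<open>H\<close> as soon as \<open>X\<close> has norm at most one half.
\<close>

lemma chol_increment:
  assumes L: "L \<in> lower_pos_mats n" and L': "L' \<in> lower_mats n" and H: "H \<in> carrier_mat n n"
    and eq: "L' * L'\<^sup>T = L * L\<^sup>T + H"
  defines "M \<equiv> mat_inv L"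
  defines "X \<equiv> M * (L' - L)"
  shows "frob_norm X \<le> frob_norm (M * H * M\<^sup>T) + (frob_norm X)\<^sup>2"
    and "frob_norm (L' - L - chol_deriv L H) \<le> frob_norm L * (frob_norm X)\<^sup>2"
proof -
  note Lc = lower_pos_mats_carrier[OF L] and Lc' = lower_mats_carrier[OF L']
  note M = lower_pos_inverse[OF L, folded M_def]
  have Mt: "M\<^sup>T \<in> carrier_mat n n" and LL: "L * L\<^sup>T \<in> carrier_mat n n" using M Lc by simp_all
  define S where "S = M * H * M\<^sup>T"
  have S: "S \<in> carrier_mat n n" unfolding S_def using M H by simp
  have K: "L' - L \<in> carrier_mat n n" using Lc by (rule minus_carrier_mat)
  have X: "X \<in> lower_mats n"
    unfolding X_def using lower_pos_inverse_lower[OF L] L' lower_pos_mats_lower[OF L] Lc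
    by (intro lower_mats_mult) (auto simp: M_def lower_mats_def)
  note Xc = lower_mats_carrier[OF X]
  have Xt: "X\<^sup>T \<in> carrier_mat n n" using Xc by simp
  define Q where "Q = X * X\<^sup>T"
  have Q: "Q \<in> carrier_mat n n" unfolding Q_def using Xc by simp
  define R where "R = lower_half Q"
  have R: "R \<in> carrier_mat n n" unfolding R_def using Q by (rule lower_half_carrier)
  have Y: "M * L' = 1\<^sub>m n + X"
  proof -
    have "X = M * L' - M * L" unfolding X_def by (rule mult_minus_distrib_mat[OF M(1) Lc' Lc])
    then show ?thesis unfolding M(3) using M Lc' by (intro eq_matI) auto
  qed
  have Yc: "1\<^sub>m n + X \<in> carrier_mat n n" using Xc by simp
  have "1\<^sub>m n + S = M * (L * L\<^sup>T) * M\<^sup>T + M * H * M\<^sup>T"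
    using mult_gram[OF M(1) Lc] by (simp add: S_def M(3))
  also have "\<dots> = M * (L * L\<^sup>T + H) * M\<^sup>T"
    unfolding mult_add_distrib_mat[OF M(1) LL H]
    by (rule add_mult_distrib_mat[symmetric]) (use M LL H Mt in auto)
  also have "\<dots> = (M * L') * (M * L')\<^sup>T"
    unfolding eq[symmetric] by (rule mult_gram[OF M(1) Lc', symmetric])
  also have "\<dots> = (1\<^sub>m n + X) * (1\<^sub>m n + X\<^sup>T)"
    unfolding Y using transpose_add[OF one_carrier_mat Xc] by simp
  also have "\<dots> = (1\<^sub>m n + X) + (X\<^sup>T + Q)"
    unfolding mult_add_distrib_mat[OF Yc one_carrier_mat Xt] add_mult_distrib_mat[OF one_carrier_mat Xc Xt]
    using Yc Xt by (simp add: Q_def)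
  finally have SX: "1\<^sub>m n + S = (1\<^sub>m n + X) + (X\<^sup>T + Q)" .
  have "S = (X + X\<^sup>T) + Q"
  proof (rule eq_matI)
    fix i j assume "i < dim_row (X + X\<^sup>T + Q)" "j < dim_col (X + X\<^sup>T + Q)"
    then have ij: "i < n" "j < n" using Q by auto
    show "S $$ (i, j) = (X + X\<^sup>T + Q) $$ (i, j)"
      using arg_cong[OF SX, of "\<lambda>A. A $$ (i, j)"] ij S Xc Q by simp
  qed (use S Q in auto)
  then have "lower_half S = lower_half (X + X\<^sup>T) + R"
    unfolding R_def using lower_half_add[OF add_carrier_mat[OF Xt] Q, of X] by simp
  then have half: "lower_half S = X + R" unfolding lower_half_add_transpose[OF X] .
  have normR: "frob_norm R \<le> (frob_norm X)\<^sup>2"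
    using frob_norm_lower_half[OF Q] frob_norm_mult[OF Xc Xt]
    by (simp add: R_def Q_def frob_norm_transpose power2_eq_square)
  have "X = lower_half S - R" unfolding half using Xc R by (intro eq_matI) auto
  then have "frob_norm X \<le> frob_norm (lower_half S) + frob_norm R"
    using frob_norm_diff[OF lower_half_carrier[OF S] R] by simp
  then show "frob_norm X \<le> frob_norm (M * H * M\<^sup>T) + (frob_norm X)\<^sup>2"
    using frob_norm_lower_half[OF S] normR by (simp add: S_def)
  have LR: "L * R \<in> carrier_mat n n" and LX: "L * X \<in> carrier_mat n n" using Lc R Xc by simp_all
  have "L * X = (L * M) * (L' - L)"
    unfolding X_def by (rule assoc_mult_mat[OF Lc M(1) K, symmetric])
  then have K_eq: "L' - L = L * X" unfolding M(2) by (simp only: left_mult_one_mat[OF K])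
  have "L' - L - chol_deriv L H = - (L * R)"
    unfolding chol_deriv_def M_def[symmetric] S_def[symmetric] half
      mult_add_distrib_mat[OF Lc Xc R] K_eq
    using LR LX by (intro eq_matI) (auto simp del: index_mult_mat(1))
  then have "frob_norm (L' - L - chol_deriv L H) \<le> frob_norm L * frob_norm R"
    using frob_norm_mult[OF Lc R] by (simp add: frob_norm_uminus[OF LR])
  also have "\<dots> \<le> frob_norm L * (frob_norm X)\<^sup>2"
    by (rule mult_left_mono[OF normR frob_norm_nonneg])
  finally show "frob_norm (L' - L - chol_deriv L H) \<le> frob_norm L * (frob_norm X)\<^sup>2" .
qed

lemma chol_deriv_lower:
  assumes L: "L \<in> lower_pos_mats n" and H: "H \<in> carrier_mat n n"
  shows "chol_deriv L H \<in> lower_mats n"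
  unfolding chol_deriv_def using lower_pos_inverse(1)[OF L] H
  by (intro lower_mats_mult lower_pos_mats_lower[OF L] lower_half_lower) auto

lemma chol_deriv_add:
  assumes L: "L \<in> lower_pos_mats n" and A: "A \<in> carrier_mat n n" and B: "B \<in> carrier_mat n n"
  shows "chol_deriv L (A + B) = chol_deriv L A + chol_deriv L B"
proof -
  let ?M = "mat_inv L"
  note Lc = lower_pos_mats_carrier[OF L] and M = lower_pos_inverse(1)[OF L]
  have c: "?M * A \<in> carrier_mat n n" "?M * B \<in> carrier_mat n n" "?M\<^sup>T \<in> carrier_mat n n"
    using M A B by simp_all
  show ?thesis
    unfolding chol_deriv_def mult_add_distrib_mat[OF M A B] add_mult_distrib_mat[OF c]
      lower_half_add[OF mult_carrier_mat[OF c(1,3)] mult_carrier_mat[OF c(2,3)]]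
    by (rule mult_add_distrib_mat[OF Lc lower_half_carrier[OF mult_carrier_mat[OF c(1,3)]]
        lower_half_carrier[OF mult_carrier_mat[OF c(2,3)]]])
qed

lemma chol_deriv_smult:
  assumes L: "L \<in> lower_pos_mats n" and A: "A \<in> carrier_mat n n"
  shows "chol_deriv L (a \<cdot>\<^sub>m A) = a \<cdot>\<^sub>m chol_deriv L A"
proof -
  let ?M = "mat_inv L"
  note Lc = lower_pos_mats_carrier[OF L] and M = lower_pos_inverse(1)[OF L]
  have c: "?M * A \<in> carrier_mat n n" "?M\<^sup>T \<in> carrier_mat n n" using M A by simp_all
  show ?thesis
    unfolding chol_deriv_def mult_smult_distrib[OF M A]
      mult_smult_assoc_mat[OF c]
      lower_half_smult[OF mult_carrier_mat[OF c]]
    by (rule mult_smult_distrib[OF Lc lower_half_carrier[OF mult_carrier_mat[OF c]]])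
qed

text \<open>
  Symmetric increments tending to zero, as a filter: the limit theorems for filters then apply to
  the bounds in the definition of a differential.
\<close>

definition small_syms :: "nat \<Rightarrow> real mat filter" where
  "small_syms n = inf (filtercomap frob_norm (nhds 0)) (principal (sym_mats n))"

lemma eventually_small_syms:
  "eventually Q (small_syms n) \<longleftrightarrow> (\<exists>\<delta>>0. \<forall>H\<in>sym_mats n. frob_norm H < \<delta> \<longrightarrow> Q H)"
proof
  assume "eventually Q (small_syms n)"
  then obtain R where R: "eventually R (nhds 0)" "\<And>H. R (frob_norm H) \<Longrightarrow> H \<in> sym_mats n \<Longrightarrow> Q H"
    by (auto simp: small_syms_def eventually_inf_principal eventually_filtercomap)
  then obtain d where "d > 0" "\<And>x. dist x 0 < d \<Longrightarrow> R x"
    by (auto simp: eventually_nhds_metric)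
  then show "\<exists>\<delta>>0. \<forall>H\<in>sym_mats n. frob_norm H < \<delta> \<longrightarrow> Q H"
    using R(2) by (intro exI[of _ d]) (auto simp: frob_norm_nonneg)
next
  assume "\<exists>\<delta>>0. \<forall>H\<in>sym_mats n. frob_norm H < \<delta> \<longrightarrow> Q H"
  then obtain d where d: "d > 0" "\<And>H. H \<in> sym_mats n \<Longrightarrow> frob_norm H < d \<Longrightarrow> Q H" by blast
  have "eventually (\<lambda>x. x < d) (nhds 0)" using d(1) by (intro eventually_nhds_in_open[of "{..<d}", simplified])
  then show "eventually Q (small_syms n)"
    unfolding small_syms_def eventually_inf_principal eventually_filtercomap
    using d(2) by (intro exI[of _ "\<lambda>x. x < d"]) auto
qed

lemma small_syms_sym: "\<forall>\<^sub>F H in small_syms n. H \<in> sym_mats n"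
  unfolding eventually_small_syms by (intro exI[of _ 1]) auto

lemma frob_norm_small_syms: "(frob_norm \<longlongrightarrow> 0) (small_syms n)"
  unfolding small_syms_def
  by (rule tendsto_mono[OF inf_le1]) (rule filterlim_filtercomap)

text \<open>
  The positive definite matrices are open among the symmetric ones, and the Cholesky factor is
  continuous there.
\<close>

lemma chol_small_syms:
  assumes P: "P \<in> spd_mats n"
  defines "L \<equiv> chol P"
  shows "\<forall>\<^sub>F H in small_syms n. P + H \<in> spd_mats n"
    and "((\<lambda>H. frob_norm (chol (P + H) - L)) \<longlongrightarrow> 0) (small_syms n)"
proof -
  have L: "L \<in> lower_pos_mats n" and LL: "L * L\<^sup>T = P"
    unfolding L_def using chol_lower_pos[OF P] chol_mult_transpose[OF P] by auto
  note Lc = lower_pos_mats_carrier[OF L] and M = lower_pos_inverse(1)[OF L]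
  have Pc: "P \<in> carrier_mat n n" using P by (simp add: spd_mats_def sym_mats_def)
  have "((\<lambda>H. real n * ((frob_norm (mat_inv L))\<^sup>2 * frob_norm H)) \<longlongrightarrow> real n * ((frob_norm (mat_inv L))\<^sup>2 * 0))
      (small_syms n)"
    by (intro tendsto_intros frob_norm_small_syms)
  then have "\<forall>\<^sub>F H in small_syms n. real n * ((frob_norm (mat_inv L))\<^sup>2 * frob_norm H) < 1"
    by (rule order_tendstoD(2)) simp
  with small_syms_sym show spd: "\<forall>\<^sub>F H in small_syms n. P + H \<in> spd_mats n"
  proof eventually_elim
    case (elim H)
    have "real n * frob_norm (mat_inv L * H * (mat_inv L)\<^sup>T) \<le>
        real n * ((frob_norm (mat_inv L))\<^sup>2 * frob_norm H)"
      by (intro mult_left_mono frob_norm_congruence[OF M sym_mats_carrier[OF elim(1)]]) simp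
    then show ?case using spd_add[OF L elim(1)] elim(2) unfolding LL by simp
  qed
  have lower: "\<forall>\<^sub>F H in small_syms n. chol (P + H) \<in> lower_pos_mats n"
    using spd by eventually_elim (rule chol_lower_pos)
  have gram: "((\<lambda>H. (chol (P + H) * (chol (P + H))\<^sup>T) $$ (i, j)) \<longlongrightarrow> (L * L\<^sup>T) $$ (i, j)) (small_syms n)"
    if "i < n" "j < n" for i j
  proof -
    have "((\<lambda>H. H $$ (i, j)) \<longlongrightarrow> 0) (small_syms n)"
      by (rule Lim_null_comparison[OF _ frob_norm_small_syms], use small_syms_sym in eventually_elim)
        (use that in \<open>auto intro: abs_index_le_frob_norm sym_mats_carrier\<close>)
    then have "((\<lambda>H. P $$ (i, j) + H $$ (i, j)) \<longlongrightarrow> P $$ (i, j) + 0) (small_syms n)"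
      by (intro tendsto_intros)
    then have "((\<lambda>H. P $$ (i, j) + H $$ (i, j)) \<longlongrightarrow> (L * L\<^sup>T) $$ (i, j)) (small_syms n)"
      unfolding LL by simp
    then show ?thesis
    proof (rule Lim_transform_eventually)
      show "\<forall>\<^sub>F H in small_syms n. P $$ (i, j) + H $$ (i, j) = (chol (P + H) * (chol (P + H))\<^sup>T) $$ (i, j)"
        using spd small_syms_sym
      proof eventually_elim
        case (elim H)
        show ?case unfolding chol_mult_transpose[OF elim(1)]
          using that Pc sym_mats_carrier[OF elim(2)] by simp
      qed
    qed
  qed
  have lim: "((\<lambda>H. chol (P + H) $$ (i, j)) \<longlongrightarrow> L $$ (i, j)) (small_syms n)" if "i < n" "j < n" for i j
  proof (cases "j \<le> i")
    case True
    then show ?thesis using cholesky_tendsto[OF lower L gram] that by blast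
  next
    case False
    then have "L $$ (i, j) = 0" using that lower_mats_zero[OF lower_pos_mats_lower[OF L]] by simp
    moreover have "\<forall>\<^sub>F H in small_syms n. 0 = chol (P + H) $$ (i, j)"
      using lower by eventually_elim
        (use that False in \<open>simp add: lower_mats_zero[OF lower_pos_mats_lower]\<close>)
    ultimately show ?thesis using Lim_transform_eventually[OF tendsto_const] by metis
  qed
  show "((\<lambda>H. frob_norm (chol (P + H) - L)) \<longlongrightarrow> 0) (small_syms n)"
  proof (rule frob_norm_tendsto_0)
    show "\<forall>\<^sub>F H in small_syms n. chol (P + H) - L \<in> carrier_mat n n"
      using Lc by (intro always_eventually allI minus_carrier_mat)
    fix i j assume ij: "i < n" "j < n"
    have "((\<lambda>H. chol (P + H) $$ (i, j) - L $$ (i, j)) \<longlongrightarrow> L $$ (i, j) - L $$ (i, j)) (small_syms n)"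
      by (intro tendsto_intros lim ij)
    then show "((\<lambda>H. (chol (P + H) - L) $$ (i, j)) \<longlongrightarrow> 0) (small_syms n)"
      using ij Lc by simp
  qed
qed

lemma has_differential_chol:
  assumes P: "P \<in> spd_mats n"
  shows "has_differential (sym_mats n) (lower_mats n) chol
    (restrict (chol_deriv (chol P)) (sym_mats n)) P"
proof -
  define L where "L = chol P"
  define M where "M = mat_inv L"
  have L: "L \<in> lower_pos_mats n" and LL: "L * L\<^sup>T = P"
    unfolding L_def using chol_lower_pos[OF P] chol_mult_transpose[OF P] by auto
  have Mc: "M \<in> carrier_mat n n" unfolding M_def by (rule lower_pos_inverse(1)[OF L])
  note ev = chol_small_syms[OF P, folded L_def]
  have "\<exists>\<delta>>0. \<forall>H\<in>sym_mats n. frob_norm H < \<delta> \<longrightarrow>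
      frob_norm (chol (P + H) - L - chol_deriv L H) \<le> e * frob_norm H" if "e > 0" for e
  proof -
    have "((\<lambda>H. frob_norm M * frob_norm (chol (P + H) - L)) \<longlongrightarrow> frob_norm M * 0) (small_syms n)"
      by (intro tendsto_intros ev)
    then have ev1: "\<forall>\<^sub>F H in small_syms n. frob_norm M * frob_norm (chol (P + H) - L) < 1 / 2"
      by (rule order_tendstoD(2)) simp
    have "((\<lambda>H. 4 * frob_norm L * (frob_norm M)^4 * frob_norm H) \<longlongrightarrow>
        4 * frob_norm L * (frob_norm M)^4 * 0) (small_syms n)"
      by (intro tendsto_intros frob_norm_small_syms)
    then have ev2: "\<forall>\<^sub>F H in small_syms n. 4 * frob_norm L * (frob_norm M)^4 * frob_norm H < e"
      by (rule order_tendstoD(2)) (use that in simp)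
    have "\<forall>\<^sub>F H in small_syms n. frob_norm (chol (P + H) - L - chol_deriv L H) \<le> e * frob_norm H"
      using ev(1) small_syms_sym ev1 ev2
    proof eventually_elim
      case (elim H)
      define x where "x = frob_norm (M * (chol (P + H) - L))"
      note Hc = sym_mats_carrier[OF elim(2)]
      have L': "chol (P + H) \<in> lower_mats n"
        by (rule lower_pos_mats_lower[OF chol_lower_pos[OF elim(1)]])
      have eq: "chol (P + H) * (chol (P + H))\<^sup>T = L * L\<^sup>T + H"
        unfolding LL by (rule chol_mult_transpose[OF elim(1)])
      note inc = chol_increment[OF L L' Hc eq, folded M_def, folded x_def]
      have x0: "0 \<le> x" unfolding x_def by (rule frob_norm_nonneg)
      have "x \<le> frob_norm M * frob_norm (chol (P + H) - L)"
        unfolding x_def by (rule frob_norm_mult[OF Mc minus_carrier_mat[OF lower_pos_mats_carrier[OF L]]])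
      (* Half of x absorbs the quadratic term of the first estimate of chol_increment. *)
      then have "x\<^sup>2 \<le> x * (1 / 2)"
        using elim(3) x0 unfolding power2_eq_square by (intro mult_left_mono) auto
      then have "x \<le> 2 * ((frob_norm M)\<^sup>2 * frob_norm H)"
        using inc(1) frob_norm_congruence[OF Mc Hc] by linarith
      then have "x\<^sup>2 \<le> (2 * ((frob_norm M)\<^sup>2 * frob_norm H))\<^sup>2"
        using x0 by (rule power_mono)
      then have "frob_norm (chol (P + H) - L - chol_deriv L H) \<le>
          frob_norm L * (2 * ((frob_norm M)\<^sup>2 * frob_norm H))\<^sup>2"
        using inc(2) mult_left_mono[OF _ frob_norm_nonneg[of L]] by (blast intro: order_trans)
      also have "\<dots> = (4 * frob_norm L * (frob_norm M)^4 * frob_norm H) * frob_norm H"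
        by (simp add: power2_eq_square power4_eq_xxxx mult_ac)
      also have "\<dots> \<le> e * frob_norm H"
        using elim(4) by (intro mult_right_mono frob_norm_nonneg) simp
      finally show ?case .
    qed
    then show ?thesis unfolding eventually_small_syms .
  qed
  then show ?thesis
    unfolding has_differential_def L_def[symmetric]
    using chol_deriv_lower[OF L] chol_deriv_add[OF L] chol_deriv_smult[OF L]
    by (auto simp: sym_mats_carrier sym_mats_add sym_mats_smult)
qed

text \<open>
  By homogeneity: scaling an increment \<open>H\<close> by a small \<open>a\<close> brings it into the range where both
  maps approximate the increment of \<open>F\<close>, and \<open>a\<close> cancels from the resulting bound.
\<close>

lemma has_differential_unique:
  assumes V: "V \<subseteq> carrier_mat n n" and W: "W \<subseteq> carrier_mat n n"
    and smult: "\<And>a A. A \<in> V \<Longrightarrow> a \<cdot>\<^sub>m A \<in> V"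
    and D1: "has_differential V W F D1 P" and D2: "has_differential V W F D2 P"
  shows "D1 = D2"
proof (rule extensionalityI[of _ V])
  show "D1 \<in> extensional V" "D2 \<in> extensional V"
    using D1 D2 by (auto simp: has_differential_def PiE_def)
  fix H assume H: "H \<in> V"
  have c: "D1 A \<in> carrier_mat n n" "D2 A \<in> carrier_mat n n" if "A \<in> V" for A
    using D1 D2 W that by (auto simp: has_differential_def)
  have hom: "D1 (a \<cdot>\<^sub>m A) = a \<cdot>\<^sub>m D1 A" "D2 (a \<cdot>\<^sub>m A) = a \<cdot>\<^sub>m D2 A" if "A \<in> V" for a A
    using D1 D2 that by (auto simp: has_differential_def)
  have bound: "frob_norm (D1 H - D2 H) \<le> 2 * e * frob_norm H" if "e > 0" for e
  proof -
    have est: "\<exists>\<delta>>0. \<forall>H\<in>V. frob_norm H < \<delta> \<longrightarrow>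
        frob_norm (F (P + H) - F P - D H) \<le> e * frob_norm H" if "has_differential V W F D P" for D
      using that \<open>e > 0\<close> by (simp add: has_differential_def)
    obtain d1 where d1: "d1 > 0"
      "\<And>H. H \<in> V \<Longrightarrow> frob_norm H < d1 \<Longrightarrow> frob_norm (F (P + H) - F P - D1 H) \<le> e * frob_norm H"
      using est[OF D1] by blast
    obtain d2 where d2: "d2 > 0"
      "\<And>H. H \<in> V \<Longrightarrow> frob_norm H < d2 \<Longrightarrow> frob_norm (F (P + H) - F P - D2 H) \<le> e * frob_norm H"
      using est[OF D2] by blast
    (* The summand 1 avoids a separate treatment of H = 0. *)
    define a where "a = min d1 d2 / (frob_norm H + 1)"
    have pos: "frob_norm H + 1 > 0" using frob_norm_nonneg[of H] by simp
    then have a: "a > 0" using d1(1) d2(1) by (simp add: a_def)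
    have aH: "a \<cdot>\<^sub>m H \<in> V" by (rule smult[OF H])
    have "a * frob_norm H < a * (frob_norm H + 1)" using a by simp
    also have "\<dots> = min d1 d2" using pos by (simp add: a_def)
    finally have small: "frob_norm (a \<cdot>\<^sub>m H) < d1" "frob_norm (a \<cdot>\<^sub>m H) < d2"
      using a by (simp_all add: frob_norm_smult)
    let ?G = "F (P + a \<cdot>\<^sub>m H) - F P"
    have G: "?G - D1 (a \<cdot>\<^sub>m H) \<in> carrier_mat n n" "?G - D2 (a \<cdot>\<^sub>m H) \<in> carrier_mat n n"
      using c[OF aH] by (simp_all add: minus_carrier_mat)
    have "a \<cdot>\<^sub>m (D1 H - D2 H) = (?G - D2 (a \<cdot>\<^sub>m H)) - (?G - D1 (a \<cdot>\<^sub>m H))"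
      using c[OF H] unfolding hom[OF H] by (intro eq_matI) (auto simp: algebra_simps)
    then have "a * frob_norm (D1 H - D2 H) = frob_norm ((?G - D2 (a \<cdot>\<^sub>m H)) - (?G - D1 (a \<cdot>\<^sub>m H)))"
      using a by (metis abs_of_pos frob_norm_smult)
    also have "\<dots> \<le> e * frob_norm (a \<cdot>\<^sub>m H) + e * frob_norm (a \<cdot>\<^sub>m H)"
      using frob_norm_diff[OF G(2,1)] d1(2)[OF aH small(1)] d2(2)[OF aH small(2)] by linarith
    also have "\<dots> = a * (2 * e * frob_norm H)" using a by (simp add: frob_norm_smult)
    finally show ?thesis using a by simp
  qed
  have "frob_norm (D1 H - D2 H) \<le> 0"
  proof (rule field_le_epsilon)
    fix e :: real assume e: "e > 0"
    have pos: "frob_norm H + 1 > 0" using frob_norm_nonneg[of H] by simp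
    have "frob_norm (D1 H - D2 H) \<le> 2 * (e / (2 * (frob_norm H + 1))) * frob_norm H"
      using e pos by (intro bound) simp
    also have "\<dots> = e * (frob_norm H / (frob_norm H + 1))" using pos by (simp add: field_simps)
    also have "\<dots> \<le> e * 1" using e pos by (intro mult_left_mono) auto
    finally show "frob_norm (D1 H - D2 H) \<le> 0 + e" by simp
  qed
  moreover have D: "D1 H - D2 H \<in> carrier_mat n n" using c(2)[OF H] by (rule minus_carrier_mat)
  ultimately have zero: "D1 H - D2 H = 0\<^sub>m n n" by (intro frob_norm_eq_0D)
  show "D1 H = D2 H"
  proof (rule eq_matI)
    fix i j assume "i < dim_row (D2 H)" "j < dim_col (D2 H)"
    then show "D1 H $$ (i, j) = D2 H $$ (i, j)"
      using arg_cong[OF zero, of "\<lambda>A. A $$ (i, j)"] c[OF H] by simp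
  qed (use c[OF H] in auto)
qed

lemma chol_differential_eq:
  assumes P: "P \<in> spd_mats n" and H: "H \<in> sym_mats n"
  shows "chol_differential P H = chol_deriv (chol P) H"
proof -
  let ?D = "restrict (chol_deriv (chol P)) (sym_mats n)"
  have "dim_row P = n" using P by (auto simp: spd_mats_def sym_mats_def)
  moreover have "(THE D. has_differential (sym_mats n) (lower_mats n) chol D P) = ?D"
  proof (rule the_equality)
    show "has_differential (sym_mats n) (lower_mats n) chol ?D P"
      by (rule has_differential_chol[OF P])
  next
    fix D assume D: "has_differential (sym_mats n) (lower_mats n) chol D P"
    show "D = ?D"
      by (rule has_differential_unique[OF _ _ sym_mats_smult D has_differential_chol[OF P]])
        (auto dest: sym_mats_carrier lower_mats_carrier)
  qed
  ultimately show ?thesis using H by (simp add: chol_differential_def Let_def)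
qed

section \<open>The block structure of the compact form\<close>

lemma zero_mat_mult_vec: "v \<in> carrier_vec n \<Longrightarrow> 0\<^sub>m m n *\<^sub>v v = (0\<^sub>v m :: real vec)"
  by (intro eq_vecI) auto

lemma append_cols_mult_vec:
  assumes A: "A \<in> carrier_mat m n1" and B: "B \<in> carrier_mat m n2"
    and a: "a \<in> carrier_vec n1" and b: "b \<in> carrier_vec n2"
  shows "(A @\<^sub>c B) *\<^sub>v (a @\<^sub>v b) = A *\<^sub>v a + B *\<^sub>v b"
proof -
  have "A @\<^sub>c B = four_block_mat A B (0\<^sub>m 0 n1) (0\<^sub>m 0 n2)"
    using A B by (intro eq_matI) (auto simp: append_cols_def append_rows_def)
  then have "(A @\<^sub>c B) *\<^sub>v (a @\<^sub>v b) = (A *\<^sub>v a + B *\<^sub>v b) @\<^sub>v (0\<^sub>m 0 n1 *\<^sub>v a + 0\<^sub>m 0 n2 *\<^sub>v b)"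
    using four_block_mat_mult_vec[OF A B _ _ a b, of "0\<^sub>m 0 n1" 0 "0\<^sub>m 0 n2"] by simp
  also have "\<dots> = A *\<^sub>v a + B *\<^sub>v b"
    using A B by (intro eq_vecI) auto
  finally show ?thesis .
qed

lemma select_first_block:
  assumes v: "v \<in> carrier_vec (ml + mu)"
  shows "(1\<^sub>m ml @\<^sub>c 0\<^sub>m ml mu) *\<^sub>v v = vec_first v ml"
proof -
  have "(1\<^sub>m ml @\<^sub>c 0\<^sub>m ml mu) *\<^sub>v (vec_first v ml @\<^sub>v vec_last v mu) = vec_first v ml"
    by (subst append_cols_mult_vec[of _ ml ml _ mu]) (auto simp: zero_mat_mult_vec)
  then show ?thesis using v by simp
qed

lemma select_last_block:
  assumes v: "v \<in> carrier_vec (ml + mu)"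
  shows "(0\<^sub>m mu ml @\<^sub>c 1\<^sub>m mu) *\<^sub>v v = vec_last v mu"
proof -
  have "(0\<^sub>m mu ml @\<^sub>c 1\<^sub>m mu) *\<^sub>v (vec_first v ml @\<^sub>v vec_last v mu) = vec_last v mu"
    by (subst append_cols_mult_vec[of _ mu ml _ mu]) (auto simp: zero_mat_mult_vec)
  then show ?thesis using v by simp
qed

lemma vecl_jac_carrier: "L \<in> carrier_mat n n \<Longrightarrow> vecl_jac L \<in> carrier_mat (lt n) (lt n)"
  by (simp add: vecl_jac_def Let_def)

text \<open>
  The algebraic core of the compact form: the three factors compose to the congruence with
  \<open>L\<^sup>-\<^sup>1\<close>, the lower half, multiplication by \<open>L\<close> and the Jacobian of \<^const>\<open>vecl\<close>.
\<close>

lemma compact_factors_vecs: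
  assumes L: "L \<in> lower_pos_mats n" and H: "H \<in> sym_mats n"
  shows "Delta_mat L *\<^sub>v (Ktilde n *\<^sub>v (C_mat L *\<^sub>v vecs H)) = vecl_jac L *\<^sub>v vecs (chol_deriv L H)"
proof -
  let ?S = "mat_inv L * H * (mat_inv L)\<^sup>T"
  have "?S \<in> sym_mats n" by (rule congruence_sym[OF lower_pos_inverse(1)[OF L] H])
  note S = sym_mats_carrier[OF this]
  show ?thesis
    unfolding C_mat_vecs[OF L H] Ktilde_vecs[OF S] Delta_mat_vecs[OF L lower_half_lower[OF S]]
      chol_deriv_def ..
qed

text \<open>
  The sign of the block is that of the rate of \<open>P\<close>; it passes through the linear factors to the
  direction of \<^const>\<open>chol_deriv\<close>.
\<close>

lemma lower_block_mult_vec: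
  assumes L: "L \<in> lower_pos_mats n" and Q: "Q \<in> carrier_mat (lt n) mu" and w: "w \<in> carrier_vec mu"
  shows "- (Delta_mat L * Ktilde n * C_mat L * Q) *\<^sub>v w =
    vecl_jac L *\<^sub>v vecs (chol_deriv L (- vecs_inv n (Q *\<^sub>v w)))"
proof -
  let ?H = "vecs_inv n (Q *\<^sub>v w)"
  have Qw: "Q *\<^sub>v w \<in> carrier_vec (lt n)" using Q w by simp
  have H: "?H \<in> sym_mats n" by (rule vecs_inv_sym[OF Qw])
  note Hc = sym_mats_carrier[OF H] and D = Delta_mat_carrier[OF L] and C = C_mat_carrier[OF L]
  have K: "Ktilde n \<in> carrier_mat (lt n) (lt n)" by (simp add: Ktilde_def)
  have mHs: "- ?H \<in> sym_mats n" by (rule sym_mats_uminus[OF H])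
  have mQw: "- (Q *\<^sub>v w) = - Q *\<^sub>v w" using Q w by (intro eq_vecI) auto
  have mQ: "- Q \<in> carrier_mat (lt n) mu" using Q by simp
  have DK: "Delta_mat L * Ktilde n \<in> carrier_mat (lt n) (lt n)" using D K by simp
  have DKC: "Delta_mat L * Ktilde n * C_mat L \<in> carrier_mat (lt n) (lt n)" using DK C by simp
  have "- (Delta_mat L * Ktilde n * C_mat L * Q) = Delta_mat L * Ktilde n * C_mat L * (- Q)"
    using uminus_mult_right_mat[of "Delta_mat L * Ktilde n * C_mat L" Q] DKC Q by auto
  also have "\<dots> *\<^sub>v w = Delta_mat L *\<^sub>v (Ktilde n *\<^sub>v (C_mat L *\<^sub>v (- Q *\<^sub>v w)))"
  proof -
    have x: "- Q *\<^sub>v w \<in> carrier_vec (lt n)" using mQ w by (rule mult_mat_vec_carrier)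
    show ?thesis
      unfolding assoc_mult_mat_vec[OF DKC mQ w] assoc_mult_mat_vec[OF DK C x]
        assoc_mult_mat_vec[OF D K mult_mat_vec_carrier[OF C x]] ..
  qed
  also have "- Q *\<^sub>v w = vecs (- ?H)"
    unfolding vecs_uminus[OF Hc] vecs_vecs_inv[OF Qw] mQw ..
  finally show ?thesis unfolding compact_factors_vecs[OF L mHs] .
qed

lemma compact_rate:
  assumes L: "L \<in> lower_pos_mats n" and Q: "Q \<in> carrier_mat (lt n) mu" and v: "v \<in> carrier_vec (ml + mu)"
  shows "four_block_mat (1\<^sub>m ml) (0\<^sub>m ml mu) (0\<^sub>m (lt n) ml)
      (- (Delta_mat L * Ktilde n * C_mat L * Q)) *\<^sub>v v =
    vec_first v ml @\<^sub>v vecl_jac L *\<^sub>v vecs (chol_deriv L (- vecs_inv n (Q *\<^sub>v vec_last v mu)))"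
proof -
  let ?G = "- (Delta_mat L * Ktilde n * C_mat L * Q)"
  have "Delta_mat L * Ktilde n \<in> carrier_mat (lt n) (lt n)"
    using Delta_mat_carrier[OF L] by (rule mult_carrier_mat) (simp add: Ktilde_def)
  then have G: "?G \<in> carrier_mat (lt n) mu"
    using mult_carrier_mat[OF mult_carrier_mat[OF _ C_mat_carrier[OF L]] Q] by simp
  have "four_block_mat (1\<^sub>m ml) (0\<^sub>m ml mu) (0\<^sub>m (lt n) ml) ?G *\<^sub>v (vec_first v ml @\<^sub>v vec_last v mu) =
      (1\<^sub>m ml *\<^sub>v vec_first v ml + 0\<^sub>m ml mu *\<^sub>v vec_last v mu) @\<^sub>v
      (0\<^sub>m (lt n) ml *\<^sub>v vec_first v ml + ?G *\<^sub>v vec_last v mu)"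
    by (rule four_block_mat_mult_vec[OF one_carrier_mat zero_carrier_mat zero_carrier_mat G]) auto
  also have "\<dots> = vec_first v ml @\<^sub>v ?G *\<^sub>v vec_last v mu"
    using mult_mat_vec_carrier[OF G vec_last_carrier] by (simp add: zero_mat_mult_vec)
  finally show ?thesis
    using v unfolding lower_block_mult_vec[OF L Q vec_last_carrier] by simp
qed

section \<open>Limits and derivatives in log-Cholesky coordinates\<close>

text \<open>
  The position of the entries of \<open>y s\<close> in the concatenation depends on the length of \<open>x s\<close>, so
  the lengths have to be known on a whole neighbourhood \<open>S\<close> of \<open>t\<close>.
\<close>

lemma vec_has_deriv_append_iff:
  assumes S: "open S" "t \<in> S"
    and x: "\<And>s. s \<in> S \<Longrightarrow> x s \<in> carrier_vec m" and y: "\<And>s. s \<in> S \<Longrightarrow> y s \<in> carrier_vec n"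
    and a: "a \<in> carrier_vec m" and b: "b \<in> carrier_vec n"
  shows "vec_has_deriv (m + n) (\<lambda>s. x s @\<^sub>v y s) (a @\<^sub>v b) t \<longleftrightarrow>
    vec_has_deriv m x a t \<and> vec_has_deriv n y b t"
proof -
  have 1: "((\<lambda>s. (x s @\<^sub>v y s) $ i) has_real_derivative d) (at t) \<longleftrightarrow>
      ((\<lambda>s. x s $ i) has_real_derivative d) (at t)" if "i < m" for i d
  proof
    assume "((\<lambda>s. (x s @\<^sub>v y s) $ i) has_real_derivative d) (at t)"
    then show "((\<lambda>s. x s $ i) has_real_derivative d) (at t)"
      by (rule has_field_derivative_transform_within_open[OF _ S]) (use x y that in fastforce)
  next
    assume "((\<lambda>s. x s $ i) has_real_derivative d) (at t)"
    then show "((\<lambda>s. (x s @\<^sub>v y s) $ i) has_real_derivative d) (at t)"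
      by (rule has_field_derivative_transform_within_open[OF _ S]) (use x y that in fastforce)
  qed
  have 2: "((\<lambda>s. (x s @\<^sub>v y s) $ (m + i)) has_real_derivative d) (at t) \<longleftrightarrow>
      ((\<lambda>s. y s $ i) has_real_derivative d) (at t)" if "i < n" for i d
  proof
    assume "((\<lambda>s. (x s @\<^sub>v y s) $ (m + i)) has_real_derivative d) (at t)"
    then show "((\<lambda>s. y s $ i) has_real_derivative d) (at t)"
      by (rule has_field_derivative_transform_within_open[OF _ S]) (use x y that in fastforce)
  next
    assume "((\<lambda>s. y s $ i) has_real_derivative d) (at t)"
    then show "((\<lambda>s. (x s @\<^sub>v y s) $ (m + i)) has_real_derivative d) (at t)"
      by (rule has_field_derivative_transform_within_open[OF _ S]) (use x y that in fastforce)
  qed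
  have split: "(\<forall>i<m + n. R i) \<longleftrightarrow> (\<forall>i<m. R i) \<and> (\<forall>i<n. R (m + i))" for R
    by (metis add_less_cancel_left le_add_diff_inverse not_less trans_less_add1)
  show ?thesis
    using a b by (auto simp: vec_has_deriv_def split 1 2)
qed

lemma vecl_jac_mult_vecs_diag:
  assumes L: "L \<in> carrier_mat n n" and X: "X \<in> carrier_mat n n" and k: "k < n"
  shows "(vecl_jac L *\<^sub>v vecs X) $ k = X $$ (k, k) / L $$ (k, k)"
proof -
  have klt: "k < lt n" using k le_lt[of n] by simp
  have "(vecl_jac L *\<^sub>v vecs X) $ k = (if k < n then 1 / L $$ (k, k) else 1) * vecs X $ k"
    using diagonal_mult_vec[OF vecs_carrier[OF X] klt, of "\<lambda>k. if k < n then 1 / L $$ (k, k) else 1"] L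
    by (simp add: vecl_jac_def Let_def)
  then show ?thesis using k klt by (simp add: vecs_index[OF X] vecs_order_nth_diag)
qed

lemma vecl_jac_mult_vecs_offdiag:
  assumes L: "L \<in> carrier_mat n n" and X: "X \<in> carrier_mat n n"
    and k: "k < lt n" "vecs_order n ! k = (i, j)" "j < i"
  shows "(vecl_jac L *\<^sub>v vecs X) $ k = X $$ (i, j)"
proof -
  have kn: "\<not> k < n" using k vecs_order_nth_diag[of k n] by auto
  have "(vecl_jac L *\<^sub>v vecs X) $ k = (if k < n then 1 / L $$ (k, k) else 1) * vecs X $ k"
    using diagonal_mult_vec[OF vecs_carrier[OF X] k(1), of "\<lambda>k. if k < n then 1 / L $$ (k, k) else 1"] L
    by (simp add: vecl_jac_def Let_def)
  then show ?thesis using kn k by (simp add: vecs_index[OF X])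
qed

text \<open>
  The converse of the chain rule for \<^const>\<open>vecl\<close>: the diagonal entries of \<open>L\<close> are exponentials
  of coordinates, and their derivatives cancel the reciprocals in the Jacobian.
\<close>

lemma mat_has_deriv_of_vecl:
  assumes S: "open S" "t \<in> S" and L: "\<And>s. s \<in> S \<Longrightarrow> L s \<in> lower_pos_mats n"
    and X: "X \<in> lower_mats n"
    and d: "vec_has_deriv (lt n) (\<lambda>s. vecl (L s)) (vecl_jac (L t) *\<^sub>v vecs X) t"
  shows "mat_has_deriv n L X t"
  unfolding mat_has_deriv_def
proof (intro conjI allI impI)
  show Xc: "X \<in> carrier_mat n n" by (rule lower_mats_carrier[OF X])
  note Lc = lower_pos_mats_carrier[OF L]
  have dk: "((\<lambda>s. vecl (L s) $ k) has_real_derivative (vecl_jac (L t) *\<^sub>v vecs X) $ k) (at t)"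
    if "k < lt n" for k
    using d that by (simp add: vec_has_deriv_def)
  fix i j assume i: "i < n" and j: "j < n"
  consider "i < j" | "i = j" | "j < i" by linarith
  then show "((\<lambda>s. L s $$ (i, j)) has_real_derivative X $$ (i, j)) (at t)"
  proof cases
    case 1
    have "((\<lambda>s. 0) has_real_derivative X $$ (i, j)) (at t)"
      using lower_mats_zero[OF X 1 j] by simp
    then show ?thesis
      by (rule has_field_derivative_transform_within_open[OF _ S])
        (use lower_mats_zero[OF lower_pos_mats_lower[OF L] 1 j] in simp)
  next
    case 2
    have k: "i < lt n" using i le_lt[of n] by simp
    have ln: "vecl (L s) $ i = ln (L s $$ (i, i))" if "s \<in> S" for s
      using vecl_index[OF Lc[OF that] k vecs_order_nth_diag[OF i]] by simp
    note pos = lower_pos_mats_pos[OF L i]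
    have "((\<lambda>s. exp (vecl (L s) $ i)) has_real_derivative
        exp (vecl (L t) $ i) * (X $$ (i, i) / L t $$ (i, i))) (at t)"
      using dk[OF k] unfolding vecl_jac_mult_vecs_diag[OF Lc[OF S(2)] Xc i]
      by (rule DERIV_fun_exp)
    also have "exp (vecl (L t) $ i) * (X $$ (i, i) / L t $$ (i, i)) = X $$ (i, j)"
      unfolding ln[OF S(2)] using pos[OF S(2)] 2 by simp
    finally show ?thesis
      by (rule has_field_derivative_transform_within_open[OF _ S]) (use pos 2 ln in auto)
  next
    case 3
    obtain k where k: "k < lt n" "vecs_order n ! k = (i, j)"
      using vecs_order_position[of j i n] 3 i by auto
    show ?thesis
      using dk[OF k(1)] unfolding vecl_jac_mult_vecs_offdiag[OF Lc[OF S(2)] Xc k 3]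
      by (rule has_field_derivative_transform_within_open[OF _ S])
        (use vecl_index[OF Lc k] 3 in simp)
  qed
qed

lemma mat_has_deriv_gram:
  assumes S: "open S" "t \<in> S" and L: "\<And>s. s \<in> S \<Longrightarrow> L s \<in> carrier_mat n n"
    and d: "mat_has_deriv n L X t"
  shows "mat_has_deriv n (\<lambda>s. L s * (L s)\<^sup>T) (X * (L t)\<^sup>T + L t * X\<^sup>T) t"
  unfolding mat_has_deriv_def
proof (intro conjI allI impI)
  have X: "X \<in> carrier_mat n n" using d by (simp add: mat_has_deriv_def)
  note Lt = L[OF S(2)]
  show "X * (L t)\<^sup>T + L t * X\<^sup>T \<in> carrier_mat n n" using X Lt by simp
  fix i j assume ij: "i < n" "j < n"
  have "((\<lambda>s. \<Sum>k\<in>{0..<n}. L s $$ (i, k) * L s $$ (j, k)) has_real_derivative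
      (\<Sum>k\<in>{0..<n}. X $$ (i, k) * L t $$ (j, k) + X $$ (j, k) * L t $$ (i, k))) (at t)"
    by (intro DERIV_sum DERIV_mult) (use d ij in \<open>auto simp: mat_has_deriv_def\<close>)
  also have "(\<Sum>k\<in>{0..<n}. X $$ (i, k) * L t $$ (j, k) + X $$ (j, k) * L t $$ (i, k)) =
      (X * (L t)\<^sup>T + L t * X\<^sup>T) $$ (i, j)"
    using X Lt ij by (simp add: scalar_prod_def sum.distrib mult.commute)
  finally show "((\<lambda>s. (L s * (L s)\<^sup>T) $$ (i, j)) has_real_derivative
      (X * (L t)\<^sup>T + L t * X\<^sup>T) $$ (i, j)) (at t)"
  proof (rule has_field_derivative_transform_within_open[OF _ S])
    fix s assume "s \<in> S"
    from L[OF this] show "(\<Sum>k\<in>{0..<n}. L s $$ (i, k) * L s $$ (j, k)) = (L s * (L s)\<^sup>T) $$ (i, j)"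
      using ij by (simp add: scalar_prod_def)
  qed
qed

text \<open>
  The lower half symmetrises back to \<open>L\<^sup>-\<^sup>1 H L\<^sup>-\<^sup>T\<close>, so the product rule for \<open>L L\<^sup>T\<close>
  returns the prescribed rate \<open>H\<close>.
\<close>

lemma chol_deriv_symmetrise:
  assumes L: "L \<in> lower_pos_mats n" and H: "H \<in> sym_mats n"
  shows "chol_deriv L H * L\<^sup>T + L * (chol_deriv L H)\<^sup>T = H"
proof -
  note Lc = lower_pos_mats_carrier[OF L] and Hc = sym_mats_carrier[OF H] and M = lower_pos_inverse[OF L]
  let ?M = "mat_inv L"
  define S where "S = ?M * H * ?M\<^sup>T"
  have S: "S \<in> sym_mats n" unfolding S_def by (rule congruence_sym[OF M(1) H])
  define F where "F = lower_half S"
  have F: "F \<in> carrier_mat n n" unfolding F_def by (rule lower_half_carrier[OF sym_mats_carrier[OF S]])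
  have Lt: "L\<^sup>T \<in> carrier_mat n n" and Ft: "F\<^sup>T \<in> carrier_mat n n" and Mt: "?M\<^sup>T \<in> carrier_mat n n"
    and LF: "L * F \<in> carrier_mat n n" and LFt: "L * F\<^sup>T \<in> carrier_mat n n"
    and MH: "?M * H \<in> carrier_mat n n"
    using Lc F M Hc by simp_all
  have "chol_deriv L H * L\<^sup>T + L * (chol_deriv L H)\<^sup>T = L * F * L\<^sup>T + L * F\<^sup>T * L\<^sup>T"
    unfolding chol_deriv_def S_def[symmetric] F_def[symmetric] transpose_mult[OF Lc F]
      assoc_mult_mat[OF Lc Ft Lt] ..
  also have "\<dots> = L * (F + F\<^sup>T) * L\<^sup>T"
    unfolding mult_add_distrib_mat[OF Lc F Ft] add_mult_distrib_mat[OF LF LFt Lt] ..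
  also have "F + F\<^sup>T = S" unfolding F_def by (rule lower_half_symmetrise[OF S])
  also have "L * S * L\<^sup>T = (L * ?M) * H * (?M\<^sup>T * L\<^sup>T)"
  proof -
    have "L * S = (L * ?M) * H * ?M\<^sup>T"
      unfolding S_def assoc_mult_mat[OF Lc MH Mt, symmetric] assoc_mult_mat[OF Lc M(1) Hc, symmetric] ..
    then show ?thesis
      using assoc_mult_mat[OF mult_carrier_mat[OF mult_carrier_mat[OF Lc M(1)] Hc] Mt Lt] by simp
  qed
  also have "?M\<^sup>T * L\<^sup>T = 1\<^sub>m n" using transpose_mult[OF Lc M(1)] M(2) by simp
  also have "L * ?M * H * 1\<^sub>m n = H" unfolding M(2) using Hc by simp
  finally show ?thesis .
qed

lemma vec_tendsto_vecl:
  assumes ev: "\<forall>\<^sub>F s in F. L s \<in> lower_pos_mats n" and L0: "L0 \<in> lower_pos_mats n"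
    and lim: "\<And>i j. j \<le> i \<Longrightarrow> i < n \<Longrightarrow> ((\<lambda>s. L s $$ (i, j)) \<longlongrightarrow> L0 $$ (i, j)) F"
  shows "vec_tendsto (lt n) (\<lambda>s. vecl (L s)) (vecl L0) F"
  unfolding vec_tendsto_def
proof (intro conjI allI impI)
  show "vecl L0 \<in> carrier_vec (lt n)" using lower_pos_mats_carrier[OF L0] by simp
  fix k assume k: "k < lt n"
  obtain i j where ij: "vecs_order n ! k = (i, j)" "j \<le> i" "i < n" using vecs_order_nth[OF k] .
  have "((\<lambda>s. if i = j then ln (L s $$ (i, j)) else L s $$ (i, j)) \<longlongrightarrow>
      (if i = j then ln (L0 $$ (i, j)) else L0 $$ (i, j))) F"
    using lim[OF ij(2,3)] lower_pos_mats_pos[OF L0 ij(3)] by (auto intro!: tendsto_ln)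
  then have "((\<lambda>s. if i = j then ln (L s $$ (i, j)) else L s $$ (i, j)) \<longlongrightarrow> vecl L0 $ k) F"
    unfolding vecl_index[OF lower_pos_mats_carrier[OF L0] k ij(1)] .
  then show "((\<lambda>s. vecl (L s) $ k) \<longlongrightarrow> vecl L0 $ k) F"
    by (rule Lim_transform_eventually)
      (use ev in eventually_elim, simp add: vecl_index[OF lower_pos_mats_carrier k ij(1)])
qed

lemma tendsto_of_vecl:
  assumes ev: "\<forall>\<^sub>F s in F. L s \<in> lower_pos_mats n" and L0: "L0 \<in> lower_pos_mats n"
    and lim: "vec_tendsto (lt n) (\<lambda>s. vecl (L s)) (vecl L0) F"
    and ij: "i < n" "j < n"
  shows "((\<lambda>s. L s $$ (i, j)) \<longlongrightarrow> L0 $$ (i, j)) F"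
proof (cases "j \<le> i")
  case True
  obtain k where k: "k < lt n" "vecs_order n ! k = (i, j)" using vecs_order_position[OF True ij(1)] .
  have *: "L $$ (i, j) = (if i = j then exp (vecl L $ k) else vecl L $ k)"
    if "L \<in> lower_pos_mats n" for L
    using vecl_index[OF lower_pos_mats_carrier[OF that] k] lower_pos_mats_pos[OF that ij(1)] by auto
  have "((\<lambda>s. vecl (L s) $ k) \<longlongrightarrow> vecl L0 $ k) F"
    using lim k(1) by (simp add: vec_tendsto_def)
  then have "((\<lambda>s. if i = j then exp (vecl (L s) $ k) else vecl (L s) $ k) \<longlongrightarrow> L0 $$ (i, j)) F"
    unfolding *[OF L0] by (auto intro!: tendsto_intros)
  then show ?thesis
    by (rule Lim_transform_eventually) (use ev in eventually_elim, simp only: *[symmetric])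
next
  case False
  then have "L0 $$ (i, j) = 0" using lower_mats_zero[OF lower_pos_mats_lower[OF L0]] ij by simp
  moreover have "\<forall>\<^sub>F s in F. 0 = L s $$ (i, j)"
    using ev by eventually_elim (use ij False in \<open>simp add: lower_mats_zero[OF lower_pos_mats_lower]\<close>)
  ultimately show ?thesis using Lim_transform_eventually[OF tendsto_const] by metis
qed

text \<open>
  Towards the coordinates this is continuity of the Cholesky factor and of the logarithm; back, it is
  continuity of the exponential and of \<open>L \<mapsto> L L\<^sup>T\<close>.
\<close>

lemma spd_tendsto_iff:
  assumes ev: "\<forall>\<^sub>F s in F. P s \<in> spd_mats n" and P0: "P0 \<in> spd_mats n"
  shows "mat_tendsto n P P0 F \<longleftrightarrow> vec_tendsto (lt n) (\<lambda>s. vecl (chol (P s))) (vecl (chol P0)) F"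
proof
  have L: "\<forall>\<^sub>F s in F. chol (P s) \<in> lower_pos_mats n"
    using ev by eventually_elim (rule chol_lower_pos)
  note L0 = chol_lower_pos[OF P0]
  have gram: "\<forall>\<^sub>F s in F. P s $$ (i, j) = (chol (P s) * (chol (P s))\<^sup>T) $$ (i, j)" for i j
    using ev by eventually_elim (simp only: chol_mult_transpose)
  {
    assume lim: "mat_tendsto n P P0 F"
    have "((\<lambda>s. (chol (P s) * (chol (P s))\<^sup>T) $$ (i, j)) \<longlongrightarrow> (chol P0 * (chol P0)\<^sup>T) $$ (i, j)) F"
      if "i < n" "j < n" for i j
      unfolding chol_mult_transpose[OF P0]
      by (rule Lim_transform_eventually[OF _ gram]) (use lim that in \<open>simp add: mat_tendsto_def\<close>)
    note cholesky_tendsto[OF L L0 this]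
    then show "vec_tendsto (lt n) (\<lambda>s. vecl (chol (P s))) (vecl (chol P0)) F"
      by (rule vec_tendsto_vecl[OF L L0])
  }
  {
    assume lim: "vec_tendsto (lt n) (\<lambda>s. vecl (chol (P s))) (vecl (chol P0)) F"
    have ind: "(A * A\<^sup>T) $$ (i, j) = (\<Sum>k\<in>{0..<n}. A $$ (i, k) * A $$ (j, k))"
      if "A \<in> lower_pos_mats n" "i < n" "j < n" for A i j
      using lower_pos_mats_carrier[OF that(1)] that(2,3) by (simp add: scalar_prod_def)
    show "mat_tendsto n P P0 F"
      unfolding mat_tendsto_def
    proof (intro conjI allI impI)
      show "P0 \<in> carrier_mat n n" using P0 by (simp add: spd_mats_def sym_mats_def)
      fix i j assume ij: "i < n" "j < n"
      have "((\<lambda>s. \<Sum>k\<in>{0..<n}. chol (P s) $$ (i, k) * chol (P s) $$ (j, k)) \<longlongrightarrow>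
          (\<Sum>k\<in>{0..<n}. chol P0 $$ (i, k) * chol P0 $$ (j, k))) F"
        by (intro tendsto_intros tendsto_of_vecl[OF L L0 lim]) (use ij in auto)
      then have "((\<lambda>s. \<Sum>k\<in>{0..<n}. chol (P s) $$ (i, k) * chol (P s) $$ (j, k)) \<longlongrightarrow> P0 $$ (i, j)) F"
        unfolding ind[OF L0 ij, symmetric] chol_mult_transpose[OF P0] .
      then show "((\<lambda>s. P s $$ (i, j)) \<longlongrightarrow> P0 $$ (i, j)) F"
      proof (rule Lim_transform_eventually)
        show "\<forall>\<^sub>F s in F. (\<Sum>k\<in>{0..<n}. chol (P s) $$ (i, k) * chol (P s) $$ (j, k)) = P s $$ (i, j)"
          using ev
          by eventually_elim (simp only: ind[OF chol_lower_pos ij, symmetric] chol_mult_transpose)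
      qed
    qed
  }
qed

section \<open>Equivalence of the two systems\<close>

lemma vec_tendsto_cong:
  assumes "\<forall>\<^sub>F s in F. x s = y s"
  shows "vec_tendsto n x v F \<longleftrightarrow> vec_tendsto n y v F"
proof -
  have "((\<lambda>s. x s $ i) \<longlongrightarrow> l) F \<longleftrightarrow> ((\<lambda>s. y s $ i) \<longlongrightarrow> l) F" for i l
    by (rule tendsto_cong) (use assms in eventually_elim, simp)
  then show ?thesis by (simp add: vec_tendsto_def)
qed

lemma vec_has_deriv_cong:
  assumes S: "open S" "t \<in> S" and eq: "\<And>s. s \<in> S \<Longrightarrow> x s = y s"
  shows "vec_has_deriv n x v t \<longleftrightarrow> vec_has_deriv n y v t"
proof -
  have "((\<lambda>s. x s $ i) has_real_derivative d) (at t) \<longleftrightarrow> ((\<lambda>s. y s $ i) has_real_derivative d) (at t)" for i d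
    using has_field_derivative_transform_within_open[OF _ S, of "\<lambda>s. x s $ i" d "\<lambda>s. y s $ i"]
      has_field_derivative_transform_within_open[OF _ S, of "\<lambda>s. y s $ i" d "\<lambda>s. x s $ i"] eq
    by auto
  then show ?thesis by (simp add: vec_has_deriv_def)
qed

lemma mat_has_deriv_cong:
  assumes S: "open S" "t \<in> S" and eq: "\<And>s. s \<in> S \<Longrightarrow> X s = Y s" and d: "mat_has_deriv n X A t"
  shows "mat_has_deriv n Y A t"
  unfolding mat_has_deriv_def
proof (intro conjI allI impI)
  show "A \<in> carrier_mat n n" using d by (simp add: mat_has_deriv_def)
  fix i j assume "i < n" "j < n"
  then have "((\<lambda>s. X s $$ (i, j)) has_real_derivative A $$ (i, j)) (at t)"
    using d by (simp add: mat_has_deriv_def)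
  then show "((\<lambda>s. Y s $$ (i, j)) has_real_derivative A $$ (i, j)) (at t)"
    by (rule has_field_derivative_transform_within_open[OF _ S]) (simp add: eq)
qed

text \<open>
  Along a curve in the positive definite cone, the rate equation for the log-Cholesky coordinates
  already forces the rate equation for the matrix itself.
\<close>

lemma mat_has_deriv_of_chol:
  assumes S: "open S" "t \<in> S" and P: "\<And>s. s \<in> S \<Longrightarrow> P s \<in> spd_mats n" and H: "H \<in> sym_mats n"
    and d: "vec_has_deriv (lt n) (\<lambda>s. vecl (chol (P s)))
      (vecl_jac (chol (P t)) *\<^sub>v vecs (chol_deriv (chol (P t)) H)) t"
  shows "mat_has_deriv n P H t"
proof -
  note L = chol_lower_pos[OF P]
  note Lt = L[OF S(2)]
  have "mat_has_deriv n (\<lambda>s. chol (P s)) (chol_deriv (chol (P t)) H) t"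
    by (rule mat_has_deriv_of_vecl[OF S L chol_deriv_lower[OF Lt sym_mats_carrier[OF H]] d])
  from mat_has_deriv_gram[OF S lower_pos_mats_carrier[OF L] this]
  have "mat_has_deriv n (\<lambda>s. chol (P s) * (chol (P s))\<^sup>T) H t"
    unfolding chol_deriv_symmetrise[OF Lt H] .
  then show ?thesis
    by (rule mat_has_deriv_cong[OF S, rotated]) (rule chol_mult_transpose[OF P])
qed

text \<open>
  Once \<open>P\<close> and \<open>\<nu>\<close> are known to describe the same positive definite matrix, both systems consist
  of the same rates. The relaxation states one more equation, the one for \<open>P\<close>, which follows from
  the equation for \<open>\<nu>\<close>.
\<close>

lemma sos_relaxation_iff_compact_of_coordinates:
  assumes t01: "t0 < t1" and P0: "P0 \<in> spd_mats n" and Q: "pinv Tp \<in> carrier_mat (lt n) mu"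
    and P: "\<And>s. s \<in> {t0<..<t1} \<Longrightarrow> P s \<in> spd_mats n"
    and \<nu>: "\<And>s. s \<in> {t0<..<t1} \<Longrightarrow> \<nu> s = vecl (chol (P s))"
  shows "sos_relaxation f \<rho> ml mu c n Tp t0 t1 \<theta>l0 P0 \<theta>l P \<nu> \<longleftrightarrow>
    sos_compact f \<rho> ml mu c n Tp t0 t1 \<theta>l0 (vecl (chol P0)) \<theta>l \<nu>"
proof -
  let ?I = "{t0<..<t1}"
  define v where "v t = mat_inv (fisher (ml + mu) c (\<theta>l t @\<^sub>v - (Tp *\<^sub>v vecs (P t)))) *\<^sub>v
    eta_rate f \<rho> (ml + mu) c (\<theta>l t @\<^sub>v - (Tp *\<^sub>v vecs (P t)))" for t
  have v: "v t \<in> carrier_vec (ml + mu)" for t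
    unfolding v_def
    by (intro mult_mat_vec_carrier[of _ _ "ml + mu"] mat_inv_carrier) (simp_all add: fisher_def eta_rate_def)
  define H where "H t = - vecs_inv n (pinv Tp *\<^sub>v vec_last (v t) mu)" for t
  have H: "H t \<in> sym_mats n" for t
    unfolding H_def
    by (rule sym_mats_uminus[OF vecs_inv_sym[OF mult_mat_vec_carrier[OF Q vec_last_carrier]]])
  define d\<nu> where "d\<nu> t = vecl_jac (chol (P t)) *\<^sub>v vecs (chol_deriv (chol (P t)) (H t))" for t
  have L: "chol (P t) \<in> lower_pos_mats n" if "t \<in> ?I" for t by (rule chol_lower_pos[OF P[OF that]])
  have d\<nu>: "d\<nu> t \<in> carrier_vec (lt n)" if "t \<in> ?I" for t
    unfolding d\<nu>_def
    by (rule mult_mat_vec_carrier[OF vecl_jac_carrier[OF lower_pos_mats_carrier]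
          vecs_carrier[OF lower_mats_carrier[OF chol_deriv_lower]]])
      (rule L[OF that] sym_mats_carrier[OF H])+
  have \<nu>c: "\<nu> t \<in> carrier_vec (lt n)" if "t \<in> ?I" for t
    unfolding \<nu>[OF that] using lower_pos_mats_carrier[OF L[OF that]] by simp
  have inv: "vecl_inv n (\<nu> t) = chol (P t)" if "t \<in> ?I" for t
    unfolding \<nu>[OF that] by (rule vecl_inv_vecl[OF L[OF that]])
  have evI: "\<forall>\<^sub>F s in at_right t0. s \<in> ?I" by (rule eventually_at_right_real[OF t01])
  have "\<forall>\<^sub>F s in at_right t0. P s \<in> spd_mats n" using evI by eventually_elim (rule P)
  note init = spd_tendsto_iff[OF this P0]
  have "\<forall>\<^sub>F s in at_right t0. \<nu> s = vecl (chol (P s))" using evI by eventually_elim (rule \<nu>)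
  note init = init[folded vec_tendsto_cong[OF this]]
  have relax: "sos_relaxation f \<rho> ml mu c n Tp t0 t1 \<theta>l0 P0 \<theta>l P \<nu> \<longleftrightarrow>
    vec_tendsto ml \<theta>l \<theta>l0 (at_right t0) \<and> mat_tendsto n P P0 (at_right t0) \<and>
    (\<forall>t\<in>?I. \<theta>l t \<in> carrier_vec ml \<and> vec_has_deriv ml \<theta>l (vec_first (v t) ml) t \<and>
       mat_has_deriv n P (H t) t \<and> vec_has_deriv (lt n) \<nu> (d\<nu> t) t)"
    unfolding sos_relaxation_def Let_def v_def[symmetric] select_first_block[OF v]
      select_last_block[OF v] H_def[symmetric]
    using P \<nu> by (auto simp: d\<nu>_def chol_differential_eq[OF P H])
  have "sos_compact f \<rho> ml mu c n Tp t0 t1 \<theta>l0 (vecl (chol P0)) \<theta>l \<nu> \<longleftrightarrow>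
    vec_tendsto ml \<theta>l \<theta>l0 (at_right t0) \<and> vec_tendsto (lt n) \<nu> (vecl (chol P0)) (at_right t0) \<and>
    (\<forall>t\<in>?I. \<theta>l t \<in> carrier_vec ml \<and>
       vec_has_deriv (ml + lt n) (\<lambda>s. \<theta>l s @\<^sub>v \<nu> s) (vec_first (v t) ml @\<^sub>v d\<nu> t) t)"
    unfolding sos_compact_def Let_def
    using \<nu>c by (auto simp: inv chol_mult_transpose[OF P] v_def[symmetric]
        compact_rate[OF L Q v] H_def[symmetric] d\<nu>_def[symmetric])
  also have "\<dots> \<longleftrightarrow>
    vec_tendsto ml \<theta>l \<theta>l0 (at_right t0) \<and> vec_tendsto (lt n) \<nu> (vecl (chol P0)) (at_right t0) \<and>
    (\<forall>t\<in>?I. \<theta>l t \<in> carrier_vec ml \<and> vec_has_deriv ml \<theta>l (vec_first (v t) ml) t \<and>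
       vec_has_deriv (lt n) \<nu> (d\<nu> t) t)"
  proof -
    have "vec_has_deriv (ml + lt n) (\<lambda>s. \<theta>l s @\<^sub>v \<nu> s) (vec_first (v t) ml @\<^sub>v d\<nu> t) t \<longleftrightarrow>
        vec_has_deriv ml \<theta>l (vec_first (v t) ml) t \<and> vec_has_deriv (lt n) \<nu> (d\<nu> t) t"
      if "\<forall>s\<in>?I. \<theta>l s \<in> carrier_vec ml" "t \<in> ?I" for t
      by (rule vec_has_deriv_append_iff[OF open_greaterThanLessThan that(2)])
        (use that \<nu>c d\<nu> in auto)
    then show ?thesis by blast
  qed
  also have "\<dots> \<longleftrightarrow> sos_relaxation f \<rho> ml mu c n Tp t0 t1 \<theta>l0 P0 \<theta>l P \<nu>"
  proof -
    have "mat_has_deriv n P (H t) t" if t: "t \<in> ?I" and d: "vec_has_deriv (lt n) \<nu> (d\<nu> t) t" for t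
    proof (rule mat_has_deriv_of_chol[OF _ t P H])
      show "vec_has_deriv (lt n) (\<lambda>s. vecl (chol (P s)))
          (vecl_jac (chol (P t)) *\<^sub>v vecs (chol_deriv (chol (P t)) (H t))) t"
        using d vec_has_deriv_cong[OF _ t \<nu>] by (simp add: d\<nu>_def)
    qed auto
    then show ?thesis unfolding relax init by blast
  qed
  finally show ?thesis by blast
qed

text \<open>
  Either side makes \<open>P\<close> and \<open>\<nu>\<close> two descriptions of the same positive definite matrix: the
  relaxation by definition, the compact form with the factorisation because \<^const>\<open>vecl_inv\<close>
  returns triangular matrices with positive diagonal and the Cholesky factor is unique.
\<close>

lemma sos_relaxation_iff_compact:
  assumes t01: "t0 < t1" and P0: "P0 \<in> spd_mats n" and Q: "pinv Tp \<in> carrier_mat (lt n) mu"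
  shows "sos_relaxation f \<rho> ml mu c n Tp t0 t1 \<theta>l0 P0 \<theta>l P \<nu> \<longleftrightarrow>
    sos_compact f \<rho> ml mu c n Tp t0 t1 \<theta>l0 (vecl (chol P0)) \<theta>l \<nu> \<and>
    (\<forall>t\<in>{t0<..<t1}. P t = vecl_inv n (\<nu> t) * (vecl_inv n (\<nu> t))\<^sup>T)"
    (is "?relax \<longleftrightarrow> ?compact \<and> ?factor")
proof
  assume r: ?relax
  then have *: "P t \<in> spd_mats n" "\<nu> t = vecl (chol (P t))" if "t \<in> {t0<..<t1}" for t
    using that by (auto simp: sos_relaxation_def Let_def)
  have ?factor
    by (auto simp: * vecl_inv_vecl[OF chol_lower_pos[OF *(1)]] chol_mult_transpose[OF *(1)])
  with r show "?compact \<and> ?factor"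
    using sos_relaxation_iff_compact_of_coordinates[OF t01 P0 Q, of P \<nu>] * by blast
next
  assume r: "?compact \<and> ?factor"
  have L: "vecl_inv n (\<nu> t) \<in> lower_pos_mats n" and vecl: "vecl (vecl_inv n (\<nu> t)) = \<nu> t"
    if "t \<in> {t0<..<t1}" for t
    using r that by (auto simp: sos_compact_def Let_def intro: vecl_inv_lower_pos vecl_vecl_inv)
  have "P t \<in> spd_mats n" "\<nu> t = vecl (chol (P t))" if "t \<in> {t0<..<t1}" for t
    using r that gram_spd[OF L[OF that]] chol_gram[OF L[OF that]] vecl[OF that] by simp_all
  then show ?relax
    using sos_relaxation_iff_compact_of_coordinates[OF t01 P0 Q, of P \<nu>] r by blast
qed

theorem proposition2:
  fixes f :: "real ^ 'd \<Rightarrow> real ^ 'd"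
    and \<rho> :: "real ^ 'd \<Rightarrow> real ^ 'w ^ 'd"
    and c c\<^sub>l c\<^sub>u :: "real ^ 'd \<Rightarrow> real vec"
    and \<alpha> \<beta> :: "nat \<Rightarrow> 'd \<Rightarrow> nat"
    and r m\<^sub>l m\<^sub>u z\<^sub>1 z\<^sub>2 k :: nat
    and \<Delta>t :: real
    and \<theta>\<^sub>k :: "real vec" and P\<^sub>k :: "real mat"
    and \<theta>\<^sub>l \<nu> :: "real \<Rightarrow> real vec" and P :: "real \<Rightarrow> real mat"
  assumes z1: "z\<^sub>1 = (r + CARD('d) - 1) choose (CARD('d) - 1)"
    and z2: "z\<^sub>2 = (2 * r + CARD('d) - 1) choose (CARD('d) - 1)"
    and mu: "m\<^sub>u = z\<^sub>2"
    and beta: "bij_betw \<beta> {..<z\<^sub>1} (exponents r)"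
    and alpha: "bij_betw \<alpha> {..<z\<^sub>2} (exponents (2 * r))"
    and Tp: "T\<^sub>p = Tp_mat z\<^sub>1 z\<^sub>2 \<beta> \<alpha>"
    and cl: "\<And>x. c\<^sub>l x \<in> carrier_vec m\<^sub>l"
    and cu: "c\<^sub>u = monomials m\<^sub>u \<alpha>"
    and c: "\<And>x. c x = c\<^sub>l x @\<^sub>v c\<^sub>u x"
    and indep: "lin_indep_components (m\<^sub>l + m\<^sub>u) c"
    and growth: "((\<lambda>x. vnorm (c\<^sub>l x) / vnorm (c\<^sub>u x)) \<longlongrightarrow> 0) at_infinity"
    and regular: "vec_open (m\<^sub>l + m\<^sub>u) (param_space (m\<^sub>l + m\<^sub>u) c)"
    and dt: "\<Delta>t > 0"
    and theta_k: "\<theta>\<^sub>k \<in> param_space (m\<^sub>l + m\<^sub>u) c"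
    and P_k: "P\<^sub>k \<in> spd_mats z\<^sub>1"
    and theta_u_k: "vec_last \<theta>\<^sub>k m\<^sub>u = - (T\<^sub>p *\<^sub>v vecs P\<^sub>k)"
  shows "sos_relaxation f \<rho> m\<^sub>l m\<^sub>u c z\<^sub>1 T\<^sub>p (real k * \<Delta>t) ((real k + 1) * \<Delta>t)
           (vec_first \<theta>\<^sub>k m\<^sub>l) P\<^sub>k \<theta>\<^sub>l P \<nu> \<longleftrightarrow>
         sos_compact f \<rho> m\<^sub>l m\<^sub>u c z\<^sub>1 T\<^sub>p (real k * \<Delta>t) ((real k + 1) * \<Delta>t)
           (vec_first \<theta>\<^sub>k m\<^sub>l) (vecl (chol P\<^sub>k)) \<theta>\<^sub>l \<nu> \<and>
         (\<forall>t \<in> {real k * \<Delta>t<..<(real k + 1) * \<Delta>t}.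
            P t = vecl_inv z\<^sub>1 (\<nu> t) * (vecl_inv z\<^sub>1 (\<nu> t))\<^sup>T)"
proof -
  have "real k * \<Delta>t < (real k + 1) * \<Delta>t" using dt by (simp add: algebra_simps)
  moreover have "pinv T\<^sub>p \<in> carrier_mat (lt z\<^sub>1) m\<^sub>u" unfolding Tp mu by (rule pinv_Tp_carrier)
  ultimately show ?thesis using sos_relaxation_iff_compact[OF _ P_k] by blast
qed

end
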